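(* For $\ell=1,\dots,k'-1$ the sets $\mathcal E_{RS}^{(\ell)}$ (defined in the context) are simple closed curves containing the points \[ \left(0,\frac{x_{2\ell}+1}{x_{2\ell}-1}\right)\quad\text{and}\quad\left(0,\frac{x_{2\ell-1}+1}{x_{2\ell-1}-1}\right). \] Add the four points $(0,\pm1)$ and $\left(\pm1,\frac2k\frac{p'(1)}{p(1)}-1\right)$ to $\mathcal E_{FR}$ and denote this extended set also by $\mathcal E_{FR}$. Then $\mathcal E_{FR}$ is a simple closed curve. Moreover, the curves $\mathcal E_{FR},\mathcal E_{RS}^{(1)},\dots,\mathcal E_{RS}^{(k'-1)}$ are disjoint and symmetric with respect to the line $\chi=0$.
   Context: Let $k\ge1$ be an integer and $\alpha_1,\dots,\alpha_k,\beta_1,\dots,\beta_k>0$ with $\alpha_1\cdots\alpha_k=\beta_1\cdots\beta_k$. Let (ordered product, $m=1$ leftmost) \[ \Phi(z) = \frac{1}{(1-z^{-1})^k}\prod_{m=1}^k \begin{pmatrix}1 & \alpha_m z^{-1}\\ \alpha_m^{-1} & 1\end{pmatrix} \begin{pmatrix}1 & \beta_mz^{-1}\\ \beta_m^{-1} & 1\end{pmatrix}, \qquad p(z)=\big((z-1)^k\operatorname{Tr}\Phi(z)\big)^2-4(z-1)^{2k}. \] $p$ is a real polynomial of degree $2k-1$ whose zeros $s_0,\dots,s_{2(k-1)}$ (with multiplicity) are real and satisfy $0=s_0>s_1\ge s_2>s_3\ge s_4>\dots>s_{2k-3}\ge s_{2(k-1)}$. Write $p=q^2p_0$ with $q,p_0$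 polynomials with only simple zeros and $q$ monic; let $0=x_0>x_1>\dots>x_{2(k'-1)}$ be the zeros of $p_0$, so $1\le k'\le k$, $\deg p_0=2k'-1$, $\deg q=k-k'$. $\mathcal R$ is the compact Riemann surface $\{(z,w)\in\mathbb C^2: w^2=p_0(z)\}$ together with the point $y_{2k'-1}=(\infty,\infty)$. For $\ell=1,\dots,k'-1$ let $I_\ell=(x_{2\ell},x_{2\ell-1})$ and $C_\ell^+=\{(z,w)\in\mathcal R: z\in\overline{I_\ell}\}$; let $C_0^+=\{(z,w)\in\mathcal R: z\in[0,\infty)\}\cup\{y_{2k'-1}\}$. On $\mathcal R$ let $\rho(z,w)=\frac12\operatorname{Tr}\Phi(z)+\frac{q(z)w}{2(z-1)^k}$ (meromorphic) and, for $(\chi,\eta)\in(-1,1)^2$, \[ F(z,w;\chi,\eta)=\frac k4(\eta+1)\log z-\frac k2\log(z-1)-\frac\chi2\log\rho(z,w). \] $F$ is multivalued (one may take principal branches of the logarithms), but its differential is a well-defined meromorphic differential on $\mathcal R$; a critical point of $F$ is a zero of this differential (in local coordinates), and its order is the order of the zero. Definitions: $(\chi,\eta)\in(-1,1)^2$ belongs to $\mathcal E_{FR}$ if $F(\cdot;\chi,\eta)$ has a critical point of order two in $C_0^+$, and to $\mathcal E_{RS}^{(\ell)}$ ($\ell=1,\dots,k'-1$) if $F(\cdot;\chi,\eta)$ has a critical point of order at least two in $C_\ell^+$.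
   Formalization: The added points on χ = ±1 are taken as (±1, (1/k) p'(1)/p(1) − 1) instead of (±1, (2/k) p'(1)/p(1) − 1); the printed factor is false, e.g. for k = 1, α = β = 1 the curve is the unit circle and the points must be (±1, 0), not (±1, 1). *)

theory Defs
  imports "HOL-Complex_Analysis.Complex_Analysis"
begin

(* The weights are functions on nat of which only the values at 1, ..., k are used. *)

definition Phi_factor :: "real \<Rightarrow> complex \<Rightarrow> complex^2^2" where
  "Phi_factor a z =
     vector [vector [1, of_real a * inverse z],
             vector [inverse (of_real a), 1]]"

(* foldr puts the factor m = 1 leftmost; mat c is the scalar matrix c I. *)
definition Phi :: "nat \<Rightarrow> (nat \<Rightarrow> real) \<Rightarrow> (nat \<Rightarrow> real) \<Rightarrow> complex \<Rightarrow> complex^2^2" where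
  "Phi k \<alpha> \<beta> z =
     mat (1 / (1 - inverse z) ^ k) **
     foldr (\<lambda>m A. (Phi_factor (\<alpha> m) z ** Phi_factor (\<beta> m) z) ** A) [1..<Suc k] (mat 1)"

abbreviation cpoly :: "real poly \<Rightarrow> complex poly" where
  "cpoly \<equiv> map_poly complex_of_real"

(* The defining expression is a priori meaningful only off z = 0, 1; it agrees there with
   exactly one real polynomial. *)
definition p_poly :: "nat \<Rightarrow> (nat \<Rightarrow> real) \<Rightarrow> (nat \<Rightarrow> real) \<Rightarrow> real poly" where
  "p_poly k \<alpha> \<beta> =
     (THE p. \<forall>z. z \<noteq> 0 \<and> z \<noteq> 1 \<longrightarrow>
        poly (cpoly p) z = ((z - 1) ^ k * trace (Phi k \<alpha> \<beta> z))\<^sup>2 - 4 * (z - 1) ^ (2 * k))"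

(* The compactification of w^2 = p0(z), p0 of odd degree, has a single point at infinity. *)
datatype surface_point = Affine complex complex | Infty

definition surface :: "real poly \<Rightarrow> surface_point set" where
  "surface p0 = {Affine z w | z w. w\<^sup>2 = poly (cpoly p0) z} \<union> {Infty}"

(* local_param p0 P Z W: the map t |-> (Z t, W t) is the inverse of a holomorphic local
   coordinate t of the surface vanishing at P, i.e. an injective holomorphic map from a disc
   around 0 into the surface that sends 0 to P.  At Infty the values Z 0 and W 0 are irrelevant. *)
definition local_param ::
    "real poly \<Rightarrow> surface_point \<Rightarrow> (complex \<Rightarrow> complex) \<Rightarrow> (complex \<Rightarrow> complex) \<Rightarrow> bool" where
  "local_param p0 P Z W \<longleftrightarrow>
     (case P of
        Affine z w \<Rightarrow>
          Z 0 = z \<and> W 0 = w \<and>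
          (\<exists>r>0. Z holomorphic_on ball 0 r \<and> W holomorphic_on ball 0 r \<and>
                 inj_on (\<lambda>t. (Z t, W t)) (ball 0 r) \<and>
                 (\<forall>t\<in>ball 0 r. (W t)\<^sup>2 = poly (cpoly p0) (Z t)))
      | Infty \<Rightarrow>
          is_pole Z 0 \<and> is_pole W 0 \<and>
          (\<exists>r>0. Z holomorphic_on (ball 0 r - {0}) \<and> W holomorphic_on (ball 0 r - {0}) \<and>
                 inj_on (\<lambda>t. (Z t, W t)) (ball 0 r - {0}) \<and>
                 (\<forall>t\<in>ball 0 r - {0}. (W t)\<^sup>2 = poly (cpoly p0) (Z t))))"

definition rho ::
    "nat \<Rightarrow> (nat \<Rightarrow> real) \<Rightarrow> (nat \<Rightarrow> real) \<Rightarrow> real poly \<Rightarrow> complex \<Rightarrow> complex \<Rightarrow> complex" where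
  "rho k \<alpha> \<beta> q z w =
     trace (Phi k \<alpha> \<beta> z) / 2 + poly (cpoly q) z * w / (2 * (z - 1) ^ k)"

(* The differential of F, pulled back along t |-> (Z t, W t), is dF_coeff ... t dt; each
   logarithm contributes its logarithmic derivative. *)
definition dF_coeff ::
    "nat \<Rightarrow> (nat \<Rightarrow> real) \<Rightarrow> (nat \<Rightarrow> real) \<Rightarrow> real poly \<Rightarrow> real \<times> real \<Rightarrow>
     (complex \<Rightarrow> complex) \<Rightarrow> (complex \<Rightarrow> complex) \<Rightarrow> complex \<Rightarrow> complex" where
  "dF_coeff k \<alpha> \<beta> q c Z W t =
     (case c of (chi, \<eta>) \<Rightarrow>
        of_real (real k / 4 * (\<eta> + 1)) * (deriv Z t / Z t)
        - of_real (real k / 2) * (deriv Z t / (Z t - 1))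
        - of_real (chi / 2) *
            (deriv (\<lambda>s. rho k \<alpha> \<beta> q (Z s) (W s)) t / rho k \<alpha> \<beta> q (Z t) (W t)))"

(* zorder does not depend on the value of dF_coeff at t = 0, where the formula may be
   meaningless although the differential extends; zorder is unspecified for a function that
   vanishes identically near 0, which the second conjunct excludes. *)
definition critical_point ::
    "nat \<Rightarrow> (nat \<Rightarrow> real) \<Rightarrow> (nat \<Rightarrow> real) \<Rightarrow> real poly \<Rightarrow> real poly \<Rightarrow> real \<times> real \<Rightarrow>
     surface_point \<Rightarrow> nat \<Rightarrow> bool" where
  "critical_point k \<alpha> \<beta> q p0 c P n \<longleftrightarrow>
     P \<in> surface p0 \<and> n \<ge> 1 \<and>
     (\<exists>Z W. local_param p0 P Z W \<and>
        (\<exists>\<^sub>F t in at 0. dF_coeff k \<alpha> \<beta> q c Z W t \<noteq> 0) \<and>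
        zorder (dF_coeff k \<alpha> \<beta> q c Z W) 0 = int n)"

definition oval0 :: "real poly \<Rightarrow> surface_point set" where
  "oval0 p0 = {P \<in> surface p0. \<exists>z w. P = Affine z w \<and> z \<in> complex_of_real ` {0..}} \<union> {Infty}"

definition oval :: "real poly \<Rightarrow> (nat \<Rightarrow> real) \<Rightarrow> nat \<Rightarrow> surface_point set" where
  "oval p0 x l =
     {P \<in> surface p0. \<exists>z w. P = Affine z w \<and>
        z \<in> complex_of_real ` closure {x (2 * l)<..<x (2 * l - 1)}}"

definition E_FR ::
    "nat \<Rightarrow> (nat \<Rightarrow> real) \<Rightarrow> (nat \<Rightarrow> real) \<Rightarrow> real poly \<Rightarrow> real poly \<Rightarrow> (real \<times> real) set" where
  "E_FR k \<alpha> \<beta> q p0 =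
     {c \<in> {-1<..<1} \<times> {-1<..<1}. \<exists>P\<in>oval0 p0. critical_point k \<alpha> \<beta> q p0 c P 2}"

definition E_RS ::
    "nat \<Rightarrow> (nat \<Rightarrow> real) \<Rightarrow> (nat \<Rightarrow> real) \<Rightarrow> real poly \<Rightarrow> real poly \<Rightarrow> (nat \<Rightarrow> real) \<Rightarrow> nat \<Rightarrow>
     (real \<times> real) set" where
  "E_RS k \<alpha> \<beta> q p0 x l =
     {c \<in> {-1<..<1} \<times> {-1<..<1}. \<exists>P\<in>oval p0 x l. \<exists>n\<ge>2. critical_point k \<alpha> \<beta> q p0 c P n}"

(* The ordinate of the points on the lines \<chi> = \<plusminus>1.  The coefficient is 1/k; the source prints
   2/k, a misprint.  Let T = (z - 1)^k Tr \<Phi>, so that p'(1)/p(1) = 2 T'(1)/T(1).  Near the pole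
   of \<rho> over z = 1,
     dF/dz = - (k/2) (1 - \<chi>) / (z - 1) + (k/4) (\<eta> + 1) - (\<chi>/2) T'(1)/T(1) + O(z - 1),
   so a double zero tending to this pole forces \<chi> -> 1 and \<eta> + 1 -> (2/k) T'(1)/T(1).
   For k = 1 and \<alpha> = \<beta> = 1 the curve is the unit circle and the point is (1, 0): here
   p(z) = 16 z, so 2/k would give (1, 1), which is not a limit point of the curve. *)
definition tangency_ordinate :: "nat \<Rightarrow> (nat \<Rightarrow> real) \<Rightarrow> (nat \<Rightarrow> real) \<Rightarrow> real" where
  "tangency_ordinate k \<alpha> \<beta> =
     1 / real k * (poly (pderiv (p_poly k \<alpha> \<beta>)) 1 / poly (p_poly k \<alpha> \<beta>) 1) - 1"

definition E_FR_ext ::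
    "nat \<Rightarrow> (nat \<Rightarrow> real) \<Rightarrow> (nat \<Rightarrow> real) \<Rightarrow> real poly \<Rightarrow> real poly \<Rightarrow> (real \<times> real) set" where
  "E_FR_ext k \<alpha> \<beta> q p0 =
     E_FR k \<alpha> \<beta> q p0 \<union>
     {(0, 1), (0, -1), (1, tangency_ordinate k \<alpha> \<beta>), (-1, tangency_ordinate k \<alpha> \<beta>)}"

definition simple_closed_curve :: "(real \<times> real) set \<Rightarrow> bool" where
  "simple_closed_curve S \<longleftrightarrow>
     (\<exists>\<gamma>. simple_path \<gamma> \<and> pathfinish \<gamma> = pathstart \<gamma> \<and> path_image \<gamma> = S)"

definition symmetric_chi :: "(real \<times> real) set \<Rightarrow> bool" where
  "symmetric_chi S \<longleftrightarrow> (\<lambda>(chi, \<eta>). (- chi, \<eta>)) ` S = S"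

end

theory Submission
  imports Defs
begin

text \<open>
  Write \<open>T = (z - 1)\<^sup>k Tr \<Phi>\<close>. The numerator \<open>(z - 1) T' - k T\<close> of \<open>d(Tr \<Phi>)\<close> is divisible by \<open>q\<close>, with
  quotient \<open>r\<close> of degree \<open>d = k' - 1\<close>, and \<open>d log \<rho> = r dz / ((z - 1) w)\<close>. By Rolle's theorem \<open>r\<close>
  has exactly one zero \<open>y\<^sub>l\<close> in each interval \<open>I\<^sub>l\<close>, and no other zero.

  Hence \<open>dF\<close> has the form \<open>A dz/z + B dz/(z - 1) + C d log \<rho>\<close>, and its zeros on the surface are, with
  multiplicity, the zeros of the real polynomial
  \<open>Q = (A (z - 1) + B z)\<^sup>2 p\<^sub>0/z - C\<^sup>2 z r\<^sup>2\<close> of degree at most \<open>2 d + 2\<close>. It is positive at the ends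
  of every \<open>I\<^sub>l\<close> and nonpositive at \<open>y\<^sub>l\<close>, which gives \<open>2 d\<close> zeros, and a double zero of
  \<open>dF\<close> at \<open>z\<close> leaves all of these in the quotient of \<open>Q\<close> by the square of \<open>X - z\<close>. So \<open>dF\<close> cannot
  have two double zeros, and one double zero makes that quotient positive on \<open>[0, \<infinity>)\<close>, which forces
  \<open>(\<chi>, \<eta>)\<close> into the open square. Solving the two linear equations for \<open>(\<chi>, \<eta>)\<close> parametrizes the half
  of each curve that belongs to the sheet \<open>w > 0\<close>; it is an arc with end points on \<open>\<chi> = 0\<close>, and the
  other sheet gives its mirror image.
\<close>

text \<open>The count is tight: \<open>2 * d\<close> forced sign changes and the two zeros of a
  tangency exhaust the degree bound \<open>2 * d + 2\<close> of \<open>Q\<close>, so any further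
  sign change is a contradiction. Since \<open>Q\<close> depends on \<open>C\<close> only through
  its square, uniqueness holds for chi and -chi together; this is why an arc never crosses its
  mirror image. The divisibility of the numerator by \<open>q\<close> rests on T(1) > 0, which makes
  \<open>T\<close> coprime to z - 1. The residues of d log \<rho> over z = 1 are k and -k, whence
  the bound |chi| < 1. Over z = 0, over z = 1 and at infinity dF has simple poles as long as (chi,
  \<eta>) lies in the open square, so there are no critical points there. The four points added to
  \<open>E_FR\<close> are the values or limits of the parametrization at exactly these places. A
  critical point is defined by the existence of a local parameter. One inclusion must therefore
  treat an arbitrary parameter, while the other must exhibit one: z itself at regular points, w at
  branch points.\<close>

lemma degree_ge_sign_changes:
  fixes S :: "real poly" and a b :: "nat \<Rightarrow> real"
  assumes sign: "\<And>i. i < n \<Longrightarrow> a i < b i \<and> poly S (a i) * poly S (b i) < 0"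
    and sep: "\<And>i. Suc i < n \<Longrightarrow> b (Suc i) \<le> a i"
  shows "n \<le> degree S"
proof (cases "n = 0")
  case False
  have "\<exists>u. a i < u \<and> u < b i \<and> poly S u = 0" if "i < n" for i
    using poly_IVT[of "a i" "b i" S] sign[OF that] by blast
  then obtain u where u: "\<And>i. i < n \<Longrightarrow> a i < u i \<and> u i < b i \<and> poly S (u i) = 0"
    by metis
  have step: "u (Suc i) < u i" if "Suc i < n" for i
    using u[of i] u[of "Suc i"] sep[of i] that by force
  have dec: "u j < u i" if "i < j" "j < n" for i j
    using that
  proof (induction j)
    case (Suc j)
    then show ?case
      using step[of j] by (cases "i = j") (auto intro: less_trans)
  qed simp
  have inj: "inj_on u {..<n}"
  proof (rule inj_onI)
    fix i j assume "i \<in> {..<n}" "j \<in> {..<n}" "u i = u j"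
    then show "i = j"
      using dec[of i j] dec[of j i] by (metis lessThan_iff less_irrefl linorder_neqE_nat)
  qed
  have "poly S (a 0) \<noteq> 0"
    using sign[of 0] False by auto
  then have S: "S \<noteq> 0"
    by auto
  have "n = card (u ` {..<n})"
    using inj by (simp add: card_image)
  also have "\<dots> \<le> card {z. poly S z = 0}"
    using u by (intro card_mono poly_roots_finite S) auto
  also have "\<dots> \<le> degree S"
    by (rule card_poly_roots_bound[OF S])
  finally show ?thesis .
qed simp

lemma double_root_dvd:
  fixes Q :: "real poly"
  assumes "poly Q z = 0" "poly (pderiv Q) z = 0"
  shows "[:-z, 1:]\<^sup>2 dvd Q"
proof -
  from assms(1) obtain S where S: "Q = [:-z, 1:] * S"
    by (auto simp: poly_eq_0_iff_dvd)
  have "pderiv Q = S + [:-z, 1:] * pderiv S"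
    unfolding S pderiv_mult by (simp add: pderiv_pCons)
  with assms(2) have "poly S z = 0"
    by simp
  then obtain R where "S = [:-z, 1:] * R"
    by (auto simp: poly_eq_0_iff_dvd)
  with S show ?thesis
    by (metis dvd_def mult.assoc power2_eq_square)
qed

text \<open>Here \<open>K\<close> stands for \<open>k\<close> and \<open>p\<^sub>1\<close> for \<open>p\<^sub>0/z\<close>; \<open>t\<^sub>0\<close> is an auxiliary point of the gap
  \<open>(x\<^sub>1, 0)\<close>.\<close>

locale hyperelliptic_data =
  fixes K :: real and d :: nat and x y :: "nat \<Rightarrow> real" and p1 r :: "real poly" and t0 :: real
  assumes K: "K > 0"
    and x0: "x 0 = 0"
    and x_anti: "\<And>i j. i < j \<Longrightarrow> j \<le> 2 * d \<Longrightarrow> x j < x i"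
    and y_between: "\<And>l. l \<in> {1..d} \<Longrightarrow> x (2 * l) < y l \<and> y l < x (2 * l - 1)"
    and degree_p1: "degree p1 = 2 * d"
    and p1_pos: "\<And>z. z \<ge> 0 \<Longrightarrow> poly p1 z > 0"
    and p1_neg: "\<And>l z. l \<in> {1..d} \<Longrightarrow> x (2 * l) < z \<Longrightarrow> z < x (2 * l - 1) \<Longrightarrow> poly p1 z < 0"
    and p1_root: "\<And>j. j \<in> {1..2 * d} \<Longrightarrow> poly p1 (x j) = 0"
    and p1_simple: "\<And>j. j \<in> {1..2 * d} \<Longrightarrow> poly (pderiv p1) (x j) \<noteq> 0"
    and t0: "t0 < 0" "poly p1 t0 > 0" "d \<ge> 1 \<Longrightarrow> x 1 < t0"
    and degree_r: "degree r = d"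
    and r_y: "\<And>l. l \<in> {1..d} \<Longrightarrow> poly r (y l) = 0"
    and r_x: "\<And>j. j \<in> {1..2 * d} \<Longrightarrow> poly r (x j) \<noteq> 0"
    and r_nz: "\<And>z. t0 \<le> z \<Longrightarrow> poly r z \<noteq> 0"
    and r_one: "(poly r 1)\<^sup>2 = K\<^sup>2 * poly p1 1"
begin

definition p :: "real poly" where "p = pCons 0 p1"

definition ovals :: "real set" where
  "ovals = (\<Union>l\<in>{1..d}. {x (2 * l)<..<x (2 * l - 1)})"

definition U :: "real set" where "U = {0<..} \<union> ovals"

lemma poly_p [simp]: "poly p z = z * poly p1 z"
  by (simp add: p_def)

lemma poly_pderiv_p [simp]: "poly (pderiv p) z = poly p1 z + z * poly (pderiv p1) z"
  by (simp add: p_def pderiv_pCons)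

lemma x_neg: "j \<in> {1..2 * d} \<Longrightarrow> x j < 0"
  using x_anti[of 0 j] x0 by auto

lemma ovals_neg: "z \<in> ovals \<Longrightarrow> z < 0"
proof -
  assume "z \<in> ovals"
  then obtain l where l: "l \<in> {1..d}" "z < x (2 * l - 1)"
    by (auto simp: ovals_def)
  then have "x (2 * l - 1) < 0"
    by (intro x_neg) auto
  with l show "z < 0" by simp
qed

lemma U_nz: "z \<in> U \<Longrightarrow> z \<noteq> 0"
  using ovals_neg by (auto simp: U_def)

lemma p_pos: "z \<in> U \<Longrightarrow> poly p z > 0"
proof -
  assume z: "z \<in> U"
  show "poly p z > 0"
  proof (cases "z > 0")
    case True
    then show ?thesis using p1_pos[of z] by simp
  next
    case False
    with z have o: "z \<in> ovals" by (auto simp: U_def)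
    then obtain l where "l \<in> {1..d}" "x (2 * l) < z" "z < x (2 * l - 1)"
      by (auto simp: ovals_def)
    then have "poly p1 z < 0" by (rule p1_neg)
    then show ?thesis
      using ovals_neg[OF o] by (simp add: mult_neg_neg)
  qed
qed

subsection \<open>Counting double zeros\<close>

text \<open>Every gap contributes two sign changes, one on either side of \<open>y l\<close>. In the
  second part the pair \<open>t0 < s\<close> lies to the right of all gaps and adds one
  more.\<close>

lemma degree_ge:
  fixes R :: "real poly"
  assumes pos: "\<And>j. j \<in> {1..2 * d} \<Longrightarrow> poly R (x j) > 0"
    and neg: "\<And>l. l \<in> {1..d} \<Longrightarrow> poly R (y l) \<le> 0"
  shows "2 * d \<le> degree R"
    and "poly R t0 > 0 \<Longrightarrow> s \<ge> 0 \<Longrightarrow> poly R s \<le> 0 \<Longrightarrow> 2 * d + 1 \<le> degree R"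
proof -
  \<comment> \<open>The intervals are numbered from right to left: even \<open>i\<close> runs from
    \<open>y\<close> to the upper end of its gap, odd \<open>i\<close> from the lower end to the
    same \<open>y\<close>.\<close>
  define a where "a = (\<lambda>i::nat. if even i then y (i div 2 + 1) else x (i + 1))"
  define b where "b = (\<lambda>i::nat. if even i then x (i + 1) else y (i div 2 + 1))"
  \<comment> \<open>These are the positive values that lowering by \<open>e\<close> must keep
    positive; the 1 makes the set nonempty when there are no branch points other than 0.\<close>
  define V where "V = (\<lambda>j. poly R (x j)) ` {1..2 * d} \<union> (if poly R t0 > 0 then {poly R t0} else {}) \<union> {1}"
  define e where "e = Min V / 2"
  have V: "finite V" "V \<noteq> {}" "\<And>v. v \<in> V \<Longrightarrow> v > 0"
    using pos by (auto simp: V_def split: if_splits)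
  have e: "e > 0"
    using V by (simp add: e_def)
  have eV: "e < v" if "v \<in> V" for v
    using Min_le[OF V(1) that] V(3)[OF Min_in[OF V(1,2)]] by (simp add: e_def)
  define S where "S = R - [:e:]"
    \<comment> \<open>Lowering \<open>R\<close> slightly separates the zeros, so no multiplicities have to be counted.\<close>
  have degS: "degree S \<le> degree R"
    by (simp add: S_def degree_diff_le)
  have Sx: "poly S (x j) > 0" if "j \<in> {1..2 * d}" for j
    using eV[of "poly R (x j)"] that by (auto simp: S_def V_def)
  have Sy: "poly S (y l) < 0" if "l \<in> {1..d}" for l
    using neg[OF that] e by (simp add: S_def)
  have ab: "a i < b i \<and> poly S (a i) * poly S (b i) < 0" if i: "i < 2 * d" for i
  proof (cases "even i")
    case True
    then obtain m where m: "i = 2 * m" by blast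
    with i have "Suc m \<in> {1..d}" by auto
    with Sx[of "2 * m + 1"] Sy[of "Suc m"] y_between[of "Suc m"] m show ?thesis
      by (auto simp: a_def b_def mult_neg_pos)
  next
    case False
    then obtain m where m: "i = 2 * m + 1" by (meson oddE)
    with i have "Suc m \<in> {1..d}" by auto
    with Sx[of "2 * m + 2"] Sy[of "Suc m"] y_between[of "Suc m"] m show ?thesis
      by (auto simp: a_def b_def mult_pos_neg)
  qed
  have sep: "b (Suc i) \<le> a i" if "Suc i < 2 * d" for i
    using x_anti[of "Suc i" "Suc (Suc i)"] that by (auto simp: a_def b_def)
  have "2 * d \<le> degree S"
    using ab sep by (rule degree_ge_sign_changes)
  with degS show "2 * d \<le> degree R" by simp
  show "2 * d + 1 \<le> degree R" if "poly R t0 > 0" "s \<ge> 0" "poly R s \<le> 0"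
  proof -
    have St: "poly S t0 > 0"
      using that eV[of "poly R t0"] by (simp add: S_def V_def)
    have Ss: "poly S s < 0"
      using that e by (simp add: S_def)
    have "2 * d + 1 \<le> degree S"
    proof (rule degree_ge_sign_changes[where a = "case_nat t0 a" and b = "case_nat s b"])
      fix i assume i: "i < 2 * d + 1"
      show "case_nat t0 a i < case_nat s b i \<and> poly S (case_nat t0 a i) * poly S (case_nat s b i) < 0"
        using i ab[of "i - 1"] t0(1) \<open>s \<ge> 0\<close> St Ss
        by (cases i) (auto simp: mult_pos_neg)
    next
      fix i assume i: "Suc i < 2 * d + 1"
      show "case_nat s b (Suc i) \<le> case_nat t0 a i"
        using i sep[of "i - 1"] t0(3) by (cases i) (auto simp: b_def)
    qed
    with degS show ?thesis by simp
  qed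
qed

text \<open>The first equation is the vanishing at \<open>(z, w)\<close> of the numerator of
  \<open>A/z + B/(z - 1) + C r/((z - 1) w)\<close>, the second one that of its \<open>z\<close>-derivative, multiplied by \<open>2 w\<close>.\<close>

definition tangent :: "real \<Rightarrow> real \<Rightarrow> real \<Rightarrow> real \<Rightarrow> real \<Rightarrow> bool" where
  "tangent A B C z w \<longleftrightarrow> w \<noteq> 0 \<and> w\<^sup>2 = poly p z \<and>
     (A * (z - 1) + B * z) * w + C * z * poly r z = 0 \<and>
     2 * (A + B) * poly p z + (A * (z - 1) + B * z) * poly (pderiv p) z +
       2 * w * C * (poly r z + z * poly (pderiv r) z) = 0"

text \<open>Up to the factor \<open>- z\<close> this is the product of the numerators on the two sheets.\<close>

definition Q :: "real \<Rightarrow> real \<Rightarrow> real \<Rightarrow> real poly" where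
  "Q A B C = [:-A, A + B:]\<^sup>2 * p1 - smult (C\<^sup>2) (pCons 0 (r\<^sup>2))"

lemma poly_Q: "poly (Q A B C) z = (A * (z - 1) + B * z)\<^sup>2 * poly p1 z - C\<^sup>2 * z * (poly r z)\<^sup>2"
  by (simp add: Q_def algebra_simps)

lemma degree_Q: "degree (Q A B C) \<le> 2 * d + 2"
proof -
  have "degree ([:-A, A + B:]\<^sup>2 * p1) \<le> 2 * 1 + 2 * d"
    using degree_mult_le[of "[:-A, A + B:]\<^sup>2" p1] degree_power_le[of "[:-A, A + B:]" 2] degree_p1
    by (simp split: if_splits)
  moreover have "degree (smult (C\<^sup>2) (pCons 0 (r\<^sup>2))) \<le> 2 * d + 1"
    using degree_smult_le[of "C\<^sup>2" "pCons 0 (r\<^sup>2)"] degree_pCons_le[of 0 "r\<^sup>2"]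
      degree_power_le[of r 2] degree_r by (simp add: mult.commute)
  ultimately show ?thesis
    unfolding Q_def by (intro degree_diff_le) auto
qed

text \<open>At a branch point only the term with \<open>C\<close> survives, and the negative sign of
  \<open>x j\<close> makes it positive. At \<open>y l\<close> only the other term survives, and
  there \<open>p1\<close> is negative. At \<open>t0\<close> neither term is negative and the one
  with \<open>C\<close> is positive.\<close>

lemma Q_pos:
  assumes "C \<noteq> 0"
  shows "j \<in> {1..2 * d} \<Longrightarrow> poly (Q A B C) (x j) > 0"
    and "l \<in> {1..d} \<Longrightarrow> poly (Q A B C) (y l) \<le> 0"
    and "poly (Q A B C) t0 > 0"
proof -
  show "poly (Q A B C) (x j) > 0" if j: "j \<in> {1..2 * d}"
  proof -
    have "C\<^sup>2 * (poly r (x j))\<^sup>2 > 0"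
      using r_x[OF j] assms by simp
    then have "x j * (C\<^sup>2 * (poly r (x j))\<^sup>2) < 0"
      using x_neg[OF j] by (rule mult_neg_pos[rotated])
    then show ?thesis
      by (simp add: poly_Q p1_root[OF j] mult_ac)
  qed
  show "poly (Q A B C) (y l) \<le> 0" if "l \<in> {1..d}"
    using p1_neg[OF that, of "y l"] y_between[OF that] r_y[OF that]
    by (simp add: poly_Q mult_nonneg_nonpos)
  have "C\<^sup>2 * (poly r t0)\<^sup>2 > 0"
    using r_nz[of t0] assms by simp
  then have "t0 * (C\<^sup>2 * (poly r t0)\<^sup>2) < 0"
    using t0 by (intro mult_neg_pos)
  moreover have "(A * (t0 - 1) + B * t0)\<^sup>2 * poly p1 t0 \<ge> 0"
    using t0 by simp
  ultimately show "poly (Q A B C) t0 > 0"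
    by (simp add: poly_Q mult_ac)
qed

text \<open>A double zero of the numerator on one sheet is a double zero of the product over both
  sheets, which is \<open>Q\<close> up to a factor that is nonzero at \<open>z\<close>.\<close>

lemma tangent_dvd:
  assumes t: "tangent A B C z w" and z: "z \<noteq> 0"
  shows "[:-z, 1:]\<^sup>2 dvd Q A B C"
proof (rule double_root_dvd)
  define L where "L = A * (z - 1) + B * z"
  define P where "P = poly p1 z"
  define P' where "P' = poly (pderiv p1) z"
  define \<rho> where "\<rho> = poly r z"
  define \<rho>' where "\<rho>' = poly (pderiv r) z"
  have 1: "L * w + C * z * \<rho> = 0" and w: "w\<^sup>2 = z * P" "w \<noteq> 0"
    and 2: "2 * (A + B) * (z * P) + L * (P + z * P') + 2 * w * C * (\<rho> + z * \<rho>') = 0"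
    using t by (auto simp: tangent_def L_def P_def P'_def \<rho>_def \<rho>'_def)
  have a: "z * (L\<^sup>2 * P - C\<^sup>2 * z * \<rho>\<^sup>2) = 0"
    using 1 w(1) by algebra
  then show 0: "poly (Q A B C) z = 0"
    using z by (simp add: poly_Q L_def P_def \<rho>_def)
  have "poly (pderiv (Q A B C)) z =
      2 * L * (A + B) * P + L\<^sup>2 * P' - C\<^sup>2 * (\<rho>\<^sup>2 + z * (2 * \<rho> * \<rho>'))"
    unfolding Q_def power2_eq_square pderiv_diff pderiv_mult pderiv_smult pderiv_pCons
    by (simp add: L_def P_def P'_def \<rho>_def \<rho>'_def algebra_simps)
  moreover have "z * (2 * L * (A + B) * P + L\<^sup>2 * P' - C\<^sup>2 * (\<rho>\<^sup>2 + z * (2 * \<rho> * \<rho>'))) = 0"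
    using 1 2 a by algebra
  ultimately show "poly (pderiv (Q A B C)) z = 0"
    using z by simp
qed


lemma U_not_root: "z \<in> U \<Longrightarrow> j \<in> {1..2 * d} \<Longrightarrow> z \<noteq> x j"
  using p_pos[of z] p1_root[of j] by auto

lemma U_not_t0: "z \<in> U \<Longrightarrow> z \<noteq> t0"
  using p_pos[of z] t0 by (auto simp: zero_less_mult_iff)

text \<open>If the tangency point is a zero of \<open>r\<close>, both sheets contribute, and \<open>Q\<close> has a triple zero.\<close>

lemma quotient_at_common_root:
  assumes t: "tangent A B C z w" and z: "z \<in> U" and r: "poly r z = 0"
    and R: "Q A B C = [:-z, 1:]\<^sup>2 * R"
  shows "poly R z = 0"
proof -
  have w: "w \<noteq> 0" "w\<^sup>2 = z * poly p1 z" and L: "A * (z - 1) + B * z = 0"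
    and 2: "2 * (A + B) * (z * poly p1 z) + 2 * w * C * (z * poly (pderiv r) z) = 0"
    using t r by (auto simp: tangent_def)
  obtain r1 where r1: "r = [:-z, 1:] * r1"
    using r by (auto simp: poly_eq_0_iff_dvd)
  have r1z: "poly (pderiv r) z = poly r1 z"
    unfolding r1 pderiv_mult by (simp add: pderiv_pCons)
  \<comment> \<open>The linear form and \<open>r\<close> both vanish at \<open>z\<close>, so the
    square can be divided out of \<open>Q\<close> explicitly.\<close>
  have "poly (Q A B C) s =
      poly ([:-z, 1:]\<^sup>2 * (smult ((A + B)\<^sup>2) p1 - smult (C\<^sup>2) (pCons 0 (r1\<^sup>2)))) s" for s
  proof -
    have "A * (s - 1) + B * s = (A + B) * (s - z)"
      using L by (simp add: algebra_simps)
    moreover have "poly r s = (s - z) * poly r1 s"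
      by (subst r1) (simp add: algebra_simps)
    moreover have "poly ([:-z, 1:]\<^sup>2 * (smult ((A + B)\<^sup>2) p1 - smult (C\<^sup>2) (pCons 0 (r1\<^sup>2)))) s =
        (s - z)\<^sup>2 * ((A + B)\<^sup>2 * poly p1 s - C\<^sup>2 * (s * (poly r1 s)\<^sup>2))"
      by (simp add: power2_eq_square algebra_simps)
    ultimately show ?thesis
      unfolding poly_Q by algebra
  qed
  then have "Q A B C = [:-z, 1:]\<^sup>2 * (smult ((A + B)\<^sup>2) p1 - smult (C\<^sup>2) (pCons 0 (r1\<^sup>2)))"
    by (intro poly_ext)
  with R have Req: "R = smult ((A + B)\<^sup>2) p1 - smult (C\<^sup>2) (pCons 0 (r1\<^sup>2))"
    by simp
  have "2 * w * ((A + B) * w + C * z * poly r1 z) = 0"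
    using 2 w(2) r1z by algebra
  with w have "(A + B) * w + C * z * poly r1 z = 0"
    by simp
  then have "z * ((A + B)\<^sup>2 * poly p1 z - C\<^sup>2 * z * (poly r1 z)\<^sup>2) = 0"
    using w(2) by algebra
  with U_nz[OF z] show ?thesis
    by (simp add: Req algebra_simps)
qed

text \<open>Division by a square preserves signs except at its zero. The only sample point that can
  coincide with \<open>z\<close> is some \<open>y l\<close>, and there the quotient vanishes by
  \<open>quotient_at_common_root\<close>.\<close>

lemma tangent_quotient:
  assumes t: "tangent A B C z w" and z: "z \<in> U" and C: "C \<noteq> 0"
  obtains R where "Q A B C = [:-z, 1:]\<^sup>2 * R"
    and "\<And>j. j \<in> {1..2 * d} \<Longrightarrow> poly R (x j) > 0"
    and "\<And>l. l \<in> {1..d} \<Longrightarrow> poly R (y l) \<le> 0"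
    and "poly R t0 > 0"
proof -
  obtain R where R: "Q A B C = [:-z, 1:]\<^sup>2 * R"
    using tangent_dvd[OF t U_nz[OF z]] by blast
  have pR: "poly (Q A B C) s = (s - z)\<^sup>2 * poly R s" for s
    by (simp add: R power2_eq_square algebra_simps)
  show ?thesis
  proof (rule that[OF R])
    fix j assume "j \<in> {1..2 * d}"
    then show "poly R (x j) > 0"
      using Q_pos(1)[OF C, of j A B] U_not_root[OF z, of j] by (simp add: pR zero_less_mult_iff)
  next
    fix l assume l: "l \<in> {1..d}"
    show "poly R (y l) \<le> 0"
    proof (cases "y l = z")
      case True
      then show ?thesis
        using quotient_at_common_root[OF t z _ R] r_y[OF l] by simp
    next
      case False
      then show ?thesis
        using Q_pos(2)[OF C l, of A B] by (simp add: pR mult_le_0_iff)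
    qed
  next
    show "poly R t0 > 0"
      using Q_pos(3)[OF C, of A B] U_not_t0[OF z] by (simp add: pR zero_less_mult_iff)
  qed
qed

text \<open>After removal of two squares the sign pattern still forces degree \<open>2 * d\<close>,
  so \<open>Q\<close> would have degree at least \<open>2 * d + 4\<close>.\<close>

lemma tangent_unique:
  assumes t: "tangent A B C z w" and z: "z \<in> U" and C: "C \<noteq> 0"
    and t': "tangent A B C z' w'" and z': "z' \<in> U"
  shows "z = z'"
proof (rule ccontr)
  assume ne: "z \<noteq> z'"
  obtain R where R: "Q A B C = [:-z, 1:]\<^sup>2 * R"
    and R1: "\<And>j. j \<in> {1..2 * d} \<Longrightarrow> poly R (x j) > 0"
    and R2: "\<And>l. l \<in> {1..d} \<Longrightarrow> poly R (y l) \<le> 0"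
    using tangent_quotient[OF t z C] by metis
  obtain S0 where S0: "Q A B C = [:-z', 1:]\<^sup>2 * S0"
    using tangent_dvd[OF t' U_nz[OF z']] by blast
  then have "poly ([:-z, 1:]\<^sup>2 * R) z' = 0"
    using R by simp
  then obtain R' where R': "R = [:-z', 1:] * R'"
    using ne by (auto simp: poly_eq_0_iff_dvd[of R])
  \<comment> \<open>Comparing the two factorizations and cancelling one factor shows that the second
    factor at \<open>z'\<close> also divides \<open>R\<close>, because \<open>z\<close> and
    \<open>z'\<close> differ.\<close>
  have "[:-z', 1:] * ([:-z, 1:]\<^sup>2 * R') = [:-z', 1:] * ([:-z', 1:] * S0)"
    using R R' S0 by (simp only: power2_eq_square mult_ac)
  then have "[:-z, 1:]\<^sup>2 * R' = [:-z', 1:] * S0"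
    by (subst (asm) mult_left_cancel) auto
  then have "poly ([:-z, 1:]\<^sup>2 * R') z' = 0"
    by simp
  then have "[:-z', 1:] dvd R'"
    using ne by (simp add: poly_eq_0_iff_dvd)
  then have "[:-z', 1:]\<^sup>2 dvd R"
    unfolding R' power2_eq_square by (rule mult_dvd_mono[OF dvd_refl])
  then obtain S where S: "R = [:-z', 1:]\<^sup>2 * S" by blast
  have pS: "poly R s = (s - z')\<^sup>2 * poly S s" for s
    by (simp add: S power2_eq_square algebra_simps)
  have "2 * d \<le> degree S"
  proof (rule degree_ge(1))
    fix j assume "j \<in> {1..2 * d}"
    then show "poly S (x j) > 0"
      using R1[of j] U_not_root[OF z', of j] by (simp add: pS zero_less_mult_iff)
  next
    fix l assume l: "l \<in> {1..d}"
    show "poly S (y l) \<le> 0"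
    proof (cases "y l = z'")
      case True
      \<comment> \<open>Here the triple zero is taken at \<open>z'\<close>, with the factor
        belonging to \<open>z\<close> counted into the quotient.\<close>
      have "Q A B C = [:-z', 1:]\<^sup>2 * ([:-z, 1:]\<^sup>2 * S)"
        by (simp add: R S ac_simps)
      then have "poly ([:-z, 1:]\<^sup>2 * S) z' = 0"
        using quotient_at_common_root[OF t' z'] r_y[OF l] True by simp
      with ne True show ?thesis by simp
    next
      case False
      then show ?thesis
        using R2[OF l] by (simp add: pS mult_le_0_iff)
    qed
  qed
  moreover have "S \<noteq> 0"
    using Q_pos(3)[OF C, of A B] by (auto simp: R S)
  then have "degree (Q A B C) = degree S + 4"
    by (simp add: R S degree_mult_eq degree_power_eq)
  ultimately show False
    using degree_Q[of A B C] by simp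
qed

text \<open>The sign changes in the gaps already use up the degree of \<open>R\<close>, so
  \<open>R\<close> is positive on the nonnegative axis. The three conclusions come from evaluating
  \<open>Q\<close> at the zero of its linear form, \<open>Q\<close> at 1, and \<open>R\<close> at
  \<open>z\<close>. They become |\<eta>| < 1, |chi| < 1 and order exactly two.\<close>

lemma tangent_bounds:
  assumes t: "tangent A B C z w" and z: "z \<in> U" and C: "C \<noteq> 0"
  shows "A * (A + B) < 0"
    and "z \<noteq> 1 \<Longrightarrow> K\<^sup>2 * C\<^sup>2 < B\<^sup>2"
    and "z > 0 \<Longrightarrow> \<exists>R. Q A B C = [:-z, 1:]\<^sup>2 * R \<and> poly R z \<noteq> 0"
proof -
  obtain R where R: "Q A B C = [:-z, 1:]\<^sup>2 * R"
    and R1: "\<And>j. j \<in> {1..2 * d} \<Longrightarrow> poly R (x j) > 0"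
    and R2: "\<And>l. l \<in> {1..d} \<Longrightarrow> poly R (y l) \<le> 0"
    and R3: "poly R t0 > 0"
    using tangent_quotient[OF t z C] by metis
  have pR: "poly (Q A B C) s = (s - z)\<^sup>2 * poly R s" for s
    by (simp add: R power2_eq_square algebra_simps)
  have "R \<noteq> 0" using R3 by auto
  then have deg: "degree (Q A B C) = degree R + 2"
    by (simp add: R degree_mult_eq degree_power_eq)
  have deg2: "degree (Q A B C) = 2 * d + 2"
    using degree_ge(1)[of R] R1 R2 deg degree_Q[of A B C] by simp
  have Rpos: "poly R s > 0" if "s \<ge> 0" for s
  proof (rule ccontr)
    assume "\<not> poly R s > 0"
    then have "2 * d + 1 \<le> degree R"
      using degree_ge(2)[of R s] R1 R2 R3 that by simp
    with deg deg2 show False by simp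
  qed
  have "poly (Q A B C) 0 > 0"
    using Rpos[of 0] U_nz[OF z] by (simp add: pR)
  then have A: "A \<noteq> 0"
    by (auto simp: poly_Q)
  \<comment> \<open>\<open>A + B\<close> is the leading coefficient of the linear form; without it
    the degree of \<open>Q\<close> drops below the value \<open>2 * d + 2\<close> just
    established.\<close>
  have AB: "A + B \<noteq> 0"
  proof
    assume AB: "A + B = 0"
    have "degree (Q A B C) \<le> 2 * d + 1"
      unfolding Q_def AB
      using degree_smult_le[of "C\<^sup>2" "pCons 0 (r\<^sup>2)"] degree_pCons_le[of 0 "r\<^sup>2"]
        degree_power_le[of r 2] degree_r degree_p1
      by (intro degree_diff_le) (auto simp: power2_eq_square mult.commute intro: le_trans[OF degree_smult_le])
    with deg2 show False by simp
  qed
  show "A * (A + B) < 0"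
  proof (rule ccontr)
    assume "\<not> A * (A + B) < 0"
    \<comment> \<open>This is the zero of the linear form, where \<open>Q\<close> reduces to its
      negative term. It would lie on the positive axis if \<open>A\<close> and \<open>A + B\<close>
      had the same sign.\<close>
    define s where "s = A / (A + B)"
    have s: "s > 0"
      using \<open>\<not> A * (A + B) < 0\<close> A AB by (auto simp: s_def zero_less_divide_iff not_less zero_le_mult_iff)
    have L: "A * (s - 1) + B * s = 0"
      using AB by (simp add: s_def field_simps)
    have r_pos: "poly r s \<noteq> 0"
      using r_nz[of s] s t0 by simp
    have "s \<noteq> z"
      using t L r_pos C s by (auto simp: tangent_def)
    then have "poly (Q A B C) s > 0"
      using Rpos[of s] s by (simp add: pR)
    moreover have "poly (Q A B C) s < 0"
      using L r_pos C s by (simp add: poly_Q)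
    ultimately show False by simp
  qed
  show "K\<^sup>2 * C\<^sup>2 < B\<^sup>2" if "z \<noteq> 1"
  proof -
    have "poly (Q A B C) 1 > 0"
      using Rpos[of 1] that by (simp add: pR)
    then have "(B\<^sup>2 - K\<^sup>2 * C\<^sup>2) * poly p1 1 > 0"
      by (simp add: poly_Q r_one algebra_simps)
    with p1_pos[of 1] show ?thesis
      by (simp add: zero_less_mult_iff)
  qed
  show "\<exists>R. Q A B C = [:-z, 1:]\<^sup>2 * R \<and> poly R z \<noteq> 0" if "z > 0"
    using R Rpos[of z] that by auto
qed

subsection \<open>The map from the surface to the square\<close>

text \<open>With w^2 = p, the derivative of r / w with respect to z is
  \<open>E / (2 * p * w)\<close>.\<close>

definition E :: "real poly" where "E = 2 * pderiv r * p - r * pderiv p"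

text \<open>This is \<open>p1 * w * (z - 1)^2\<close> times the z-derivative of
  \<open>z * r / ((z - 1) * w)\<close>, which is z times the coefficient of d log \<rho>.\<close>

definition D1 :: "real poly" where "D1 = smult (1/2) ([:-1, 1:] * E) - r * p1"

lemma poly_E: "poly E z = 2 * poly (pderiv r) z * (z * poly p1 z)
    - poly r z * (poly p1 z + z * poly (pderiv p1) z)"
  by (simp add: E_def)

lemma poly_D1: "poly D1 z = (z - 1) * poly E z / 2 - poly r z * poly p1 z"
  by (simp add: D1_def algebra_simps)

text \<open>The two tangency equations are linear and homogeneous in \<open>(A, B, C)\<close>; the
  triple is the cross product of their coefficient rows, cleared of denominators.\<close>

lemma tangent_canonical:
  assumes "w \<noteq> 0" "w\<^sup>2 = poly p z"
  shows "tangent (- z * poly E z) (2 * poly D1 z) (2 * poly p1 z * w) z w"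
proof -
  have w: "w\<^sup>2 = z * poly p1 z" using assms by simp
  have "(- z * poly E z * (z - 1) + 2 * poly D1 z * z) * w + 2 * poly p1 z * w * z * poly r z = 0"
    by (simp add: poly_D1 field_simps)
  moreover have "2 * (- z * poly E z + 2 * poly D1 z) * poly p z +
    (- z * poly E z * (z - 1) + 2 * poly D1 z * z) * poly (pderiv p) z +
    2 * w * (2 * poly p1 z * w) * (poly r z + z * poly (pderiv r) z) = 0"
    using w unfolding poly_D1 poly_E poly_p poly_pderiv_p by algebra
  ultimately show ?thesis
    using assms by (simp add: tangent_def)
qed

lemma tangent_scale:
  "tangent A B C z w \<Longrightarrow> tangent (s * A) (s * B) (s * C) z w"
  unfolding tangent_def by algebra

text \<open>Elimination shows that every solution is proportional to the canonical triple. The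
  proportions are cross-multiplied because \<open>D1\<close> is known to be nonzero only later, in
  \<open>D1_nz\<close>.\<close>

lemma tangent_eqs:
  assumes t: "tangent A B C z w" and z: "z \<in> U"
  shows "B * w * poly p1 z = C * poly D1 z"
    and "2 * A * poly D1 z = - B * z * poly E z"
proof -
  have w: "w \<noteq> 0" "w\<^sup>2 = z * poly p1 z" and 1: "(A * (z - 1) + B * z) * w + C * z * poly r z = 0"
   and 2: "2 * (A + B) * (z * poly p1 z) + (A * (z - 1) + B * z) * (poly p1 z + z * poly (pderiv p1) z) +
       2 * w * C * (poly r z + z * poly (pderiv r) z) = 0"
    using t by (auto simp: tangent_def)
  have p1: "poly p1 z \<noteq> 0" using w by auto
  have "2 * (z * poly p1 z) * w * (B * w * poly p1 z - C * poly D1 z) = 0"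
    using 1 2 w(2) unfolding poly_D1 poly_E by algebra
  then show e: "B * w * poly p1 z = C * poly D1 z"
    using w(1) p1 U_nz[OF z] by simp
  have "2 * (z * poly p1 z) * poly p1 z * w * (2 * A * poly D1 z + B * z * poly E z) = 0"
    using 1 2 w(2) e unfolding poly_D1 poly_E by algebra
  then show "2 * A * poly D1 z = - B * z * poly E z"
    using w(1) p1 U_nz[OF z] by simp
qed

end

section \<open>Limits at infinity, and loops made of an arc and its reflection\<close>

lemma poly_over_power_tendsto:
  fixes f :: "'a::real_normed_field poly"
  assumes "degree f \<le> n"
  shows "((\<lambda>z. poly f z / z ^ n) \<longlongrightarrow> coeff f n) at_infinity"
  using assms
proof (induction n arbitrary: f)
  case 0
  then obtain a where "f = [:a:]" by (auto elim: degree_eq_zeroE)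
  then show ?case by simp
next
  case (Suc n)
  obtain a g where f: "f = pCons a g" by (cases f)
  have deg: "degree g \<le> n"
    using Suc.prems by (auto simp: f split: if_splits)
  have "((\<lambda>z::'a. a * inverse z ^ Suc n) \<longlongrightarrow> a * 0 ^ Suc n) at_infinity"
    by (intro tendsto_intros tendsto_inverse_0)
  then have "((\<lambda>z. a * inverse z ^ Suc n + poly g z / z ^ n) \<longlongrightarrow> 0 + coeff g n) at_infinity"
    using Suc.IH[OF deg] by (intro tendsto_add) auto
  moreover have "\<forall>\<^sub>F z in at_infinity. a * inverse z ^ Suc n + poly g z / z ^ n = poly f z / z ^ Suc n"
    using eventually_not_equal_at_infinity[of 0]
    by eventually_elim (simp add: f field_simps)
  ultimately show ?case
    by (simp add: f tendsto_cong)
qed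

text \<open>This is the exchange of the sheets: in dF the function w occurs only in the term with
  \<open>C\<close>, which is odd in w, so replacing w by -w amounts to replacing chi by
  -chi.\<close>

definition mirror :: "real \<times> real \<Rightarrow> real \<times> real" where
  "mirror = (\<lambda>(chi, \<eta>). (- chi, \<eta>))"

lemma mirror_simps [simp]: "mirror (a, b) = (- a, b)" "mirror (mirror c) = c"
  by (auto simp: mirror_def split: prod.splits)

lemma symmetric_chi_mirror_union: "symmetric_chi (S \<union> mirror ` S)"
proof -
  have "mirror ` (S \<union> mirror ` S) = S \<union> mirror ` S"
    by (auto simp: image_Un image_image)
  then show ?thesis by (simp add: symmetric_chi_def mirror_def)
qed

text \<open>If a point of the arc equals the mirror image of another one, the injectivity assumption
  makes the parameters equal, so the point is its own mirror image and lies on chi = 0. Only the end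
  points do.\<close>

lemma mirror_loop:
  fixes \<gamma> :: "real \<Rightarrow> real \<times> real"
  assumes cont: "continuous_on {0..1} \<gamma>"
    and inj: "\<And>s t. s \<in> {0..1} \<Longrightarrow> t \<in> {0..1} \<Longrightarrow> \<gamma> s = \<gamma> t \<or> \<gamma> s = mirror (\<gamma> t) \<Longrightarrow> s = t"
    and ends: "fst (\<gamma> 0) = 0" "fst (\<gamma> 1) = 0"
    and inner: "\<And>s. s \<in> {0..1} \<Longrightarrow> fst (\<gamma> s) = 0 \<Longrightarrow> s = 0 \<or> s = 1"
  shows "simple_closed_curve (\<gamma> ` {0..1} \<union> mirror ` \<gamma> ` {0..1})"
proof -
  have arc1: "arc \<gamma>"
    using cont inj by (auto simp: arc_def path_def inj_on_def)
  have "continuous_on UNIV mirror"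
    unfolding mirror_def case_prod_beta by (intro continuous_intros)
  then have "continuous_on {0..1} (mirror \<circ> \<gamma>)"
    using cont by (metis continuous_on_compose continuous_on_subset subset_UNIV)
  then have arc2: "arc (mirror \<circ> \<gamma>)"
    using inj unfolding arc_def path_def inj_on_def comp_def by (metis mirror_simps(2))
  have fix_ends: "mirror (\<gamma> 0) = \<gamma> 0" "mirror (\<gamma> 1) = \<gamma> 1"
    using ends by (cases "\<gamma> 0", cases "\<gamma> 1", simp)+
  define g where "g = reversepath (mirror \<circ> \<gamma>)"
  have "arc g"
    unfolding g_def using arc2 by (rule arc_reversepath)
  moreover have "pathstart g = \<gamma> 1" "pathfinish g = \<gamma> 0"
    using fix_ends by (simp_all add: g_def pathstart_def pathfinish_def reversepath_def)
  moreover have "path_image g = mirror ` \<gamma> ` {0..1}"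
    by (simp only: g_def path_image_reversepath) (auto simp: path_image_def)
  ultimately have g: "arc g" "pathstart g = \<gamma> 1" "pathfinish g = \<gamma> 0"
    "path_image g = mirror ` \<gamma> ` {0..1}"
    by blast+
  have "simple_path (\<gamma> +++ g)"
  proof (rule simple_path_join_loop)
    show "path_image \<gamma> \<inter> path_image g \<subseteq> {pathstart \<gamma>, pathstart g}"
    proof
      fix c assume "c \<in> path_image \<gamma> \<inter> path_image g"
      then have "c \<in> \<gamma> ` {0..1}" "c \<in> mirror ` \<gamma> ` {0..1}"
        using g(4) by (auto simp: path_image_def[of \<gamma>])
      then obtain s t where st: "s \<in> {0..1}" "t \<in> {0..1}" "c = \<gamma> s" "c = mirror (\<gamma> t)"
        by blast
      then have "s = t" using inj by auto
      with st have "fst (\<gamma> s) = 0"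
        by (cases "\<gamma> s") auto
      with inner[OF st(1)] st(3) show "c \<in> {pathstart \<gamma>, pathstart g}"
        by (auto simp: pathstart_def g(2)[unfolded pathstart_def])
    qed
  qed (use arc1 g in \<open>auto simp: pathstart_def pathfinish_def\<close>)
  moreover have "pathfinish (\<gamma> +++ g) = pathstart (\<gamma> +++ g)"
    using g by (simp add: pathstart_def pathfinish_def joinpaths_def)
  moreover have "path_image (\<gamma> +++ g) = \<gamma> ` {0..1} \<union> mirror ` \<gamma> ` {0..1}"
    using path_image_join[of \<gamma> g] g(2,4) by (simp add: pathfinish_def path_image_def[of \<gamma>])
  ultimately show ?thesis
    unfolding simple_closed_curve_def by blast
qed

section \<open>The parametrization of the curves by z\<close>

context hyperelliptic_data
begin

lemma r_pos_nz: "z \<ge> 0 \<Longrightarrow> poly r z \<noteq> 0"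
  using r_nz[of z] t0 by simp

lemma D1_one: "poly D1 1 = - poly r 1 * poly p1 1" "poly D1 1 \<noteq> 0"
  using r_pos_nz[of 1] p1_pos[of 1] by (auto simp: poly_D1)

lemma D1_nz:
  assumes "z \<in> U"
  shows "poly D1 z \<noteq> 0"
proof (cases "z = 1")
  case True
  then show ?thesis using D1_one by simp
next
  case False
  define w where "w = sqrt (poly p z)"
  have w: "w \<noteq> 0" "w\<^sup>2 = poly p z"
    using p_pos[OF assms] by (auto simp: w_def)
  then have "2 * poly p1 z * w \<noteq> 0" by auto
  from tangent_bounds(2)[OF tangent_canonical[OF w] assms this False]
  have "0 < (2 * poly D1 z)\<^sup>2"
    by (smt (verit) zero_le_power2 mult_nonneg_nonneg)
  then show ?thesis by auto
qed

lemma tangent_iff: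
  assumes z: "z \<in> U" and w: "w \<noteq> 0" "w\<^sup>2 = poly p z"
  shows "tangent (K / 4 * (\<eta> + 1)) (- (K / 2)) (- (chi / 2)) z w \<longleftrightarrow>
    chi = K * poly p1 z * w / poly D1 z \<and> \<eta> = z * poly E z / poly D1 z - 1"
    (is "?T \<longleftrightarrow> ?c")
proof
  assume ?T
  note eqs = tangent_eqs[OF this z]
  have "K * (\<eta> + 1) * poly D1 z = K * (z * poly E z)"
    using eqs(2) by simp
  then have "(\<eta> + 1) * poly D1 z = z * poly E z"
    using K by (simp add: mult.assoc)
  with eqs(1) show ?c
    using D1_nz[OF z] by (simp add: field_simps)
next
  assume ?c
  then have chi: "chi = K * poly p1 z * w / poly D1 z" and eta: "\<eta> = z * poly E z / poly D1 z - 1"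
    by auto
  \<comment> \<open>The scaling factor is forced by matching \<open>- (K / 2)\<close> with the
    second entry \<open>2 * D1\<close> of the canonical triple.\<close>
  have e: "K / 4 * (\<eta> + 1) = (- K / (4 * poly D1 z)) * (- z * poly E z)"
    "- (K / 2) = (- K / (4 * poly D1 z)) * (2 * poly D1 z)"
    "- (chi / 2) = (- K / (4 * poly D1 z)) * (2 * poly p1 z * w)"
    unfolding chi eta using D1_nz[OF z] by (simp_all add: field_simps)
  show ?T
    unfolding e by (rule tangent_scale[OF tangent_canonical[OF w]])
qed

text \<open>For these coefficients \<open>A * (A + B)\<close> is a positive multiple of \<eta>^2 -
  1, and the second inequality of \<open>tangent_bounds\<close> reads chi^2 < 1.\<close>

lemma tangent_in_square:
  assumes t: "tangent (K / 4 * (\<eta> + 1)) (- (K / 2)) (- (chi / 2)) z w"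
    and z: "z \<in> U" "z \<noteq> 1" and chi: "chi \<noteq> 0"
  shows "(chi, \<eta>) \<in> {-1<..<1} \<times> {-1<..<1}"
proof -
  have C: "- (chi / 2) \<noteq> 0" using chi by simp
  have "K\<^sup>2 * chi\<^sup>2 < K\<^sup>2 * 1"
    using tangent_bounds(2)[OF t z(1) C z(2)] by (simp add: power_divide)
  then have "chi\<^sup>2 < 1"
    using K by (subst (asm) mult_less_cancel_left_pos) auto
  then have "\<bar>chi\<bar> < 1"
    by (simp add: abs_square_less_1)
  moreover have "(K / 4 * (\<eta> + 1)) * (K / 4 * (\<eta> + 1) + - (K / 2)) = (K\<^sup>2 / 16) * (\<eta>\<^sup>2 - 1)"
    by (simp add: field_simps power2_eq_square)
  with tangent_bounds(1)[OF t z(1) C] have "(K\<^sup>2 / 16) * (\<eta>\<^sup>2 - 1) < 0"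
    by simp
  then have "\<eta>\<^sup>2 < 1"
    using K by (simp add: mult_less_0_iff)
  then have "\<bar>\<eta>\<bar> < 1"
    by (simp add: abs_square_less_1)
  ultimately show ?thesis by auto
qed

text \<open>The solution (chi, \<eta>) of the tangency equations on the sheet w > 0. The same
  formula continues it to 0, to the branch points, and to z = 1, where it reaches the boundary of
  the square.\<close>

definition cmap :: "real \<Rightarrow> real \<times> real" where
  "cmap z = (K * poly p1 z * sqrt (poly p z) / poly D1 z, z * poly E z / poly D1 z - 1)"

definition Ubar :: "real set" where
  "Ubar = {0..} \<union> (\<Union>l\<in>{1..d}. {x (2 * l)..x (2 * l - 1)})"

lemma Ubar_cases:
  assumes "z \<in> Ubar"
  obtains "z \<in> U" | j where "j \<le> 2 * d" "z = x j"
proof -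
  consider "z > 0" | "z = 0" | l where "l \<in> {1..d}" "x (2 * l) \<le> z" "z \<le> x (2 * l - 1)"
    using assms by (force simp: Ubar_def)
  then show ?thesis
  proof cases
    case 3
    then have "z \<in> ovals \<or> z = x (2 * l) \<or> z = x (2 * l - 1)"
      by (force simp: ovals_def)
    with 3 show ?thesis
      using that(1) that(2)[of "2 * l"] that(2)[of "2 * l - 1"] by (auto simp: U_def)
  next
    case 2
    then show ?thesis using that(2)[of 0] x0 by simp
  qed (use that(1) in \<open>auto simp: U_def\<close>)
qed

lemma D1_zero: "poly D1 0 \<noteq> 0"
  using r_pos_nz[of 0] p1_pos[of 0] by (simp add: poly_D1 poly_E)

lemma cmap_zero: "cmap 0 = (0, -1)"
  by (simp add: cmap_def)

text \<open>At a branch point other than 0 the terms with \<open>p1\<close> drop out and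
  \<open>D1\<close> becomes \<open>(z - 1) * E / 2\<close>, so the ordinate is 2 z / (z - 1) - 1.
  Simplicity of the zero and \<open>r_x\<close> keep \<open>E\<close> away from zero.\<close>

lemma cmap_root:
  assumes "j \<le> 2 * d"
  shows "poly D1 (x j) \<noteq> 0" "cmap (x j) = (0, (x j + 1) / (x j - 1))"
proof -
  have "poly D1 (x j) \<noteq> 0 \<and> cmap (x j) = (0, (x j + 1) / (x j - 1))"
  proof (cases "j = 0")
    case True
    then show ?thesis using D1_zero x0 cmap_zero by simp
  next
    case False
    with assms have j: "j \<in> {1..2 * d}" by simp
    have E: "poly E (x j) \<noteq> 0" and p: "poly p1 (x j) = 0" and neg: "x j < 0"
      using p1_root[OF j] p1_simple[OF j] r_x[OF j] x_neg[OF j] by (auto simp: poly_E)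
    then show ?thesis
      by (simp add: cmap_def poly_D1 field_simps)
  qed
  then show "poly D1 (x j) \<noteq> 0" "cmap (x j) = (0, (x j + 1) / (x j - 1))" by auto
qed

lemma D1_nz_Ubar: "z \<in> Ubar \<Longrightarrow> poly D1 z \<noteq> 0"
  using Ubar_cases D1_nz cmap_root(1) by metis

text \<open>Here \<open>r_one\<close> enters: chi is, up to sign, k divided by the residue of d log
  \<rho> over z = 1.\<close>

lemma cmap_one: "\<bar>fst (cmap 1)\<bar> = 1"
proof -
  have "(fst (cmap 1))\<^sup>2 = K\<^sup>2 * poly p1 1 / (poly r 1)\<^sup>2"
    using p1_pos[of 1] by (simp add: cmap_def D1_one power_divide power_mult_distrib)
  also have "\<dots> = 1"
    using r_pos_nz[of 1] by (simp flip: r_one)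
  finally show ?thesis
    by (auto simp: power2_eq_1_iff)
qed

lemma cmap_tangent:
  assumes z: "z \<in> U"
  shows "fst (cmap z) \<noteq> 0"
    and "tangent (K / 4 * (snd (cmap z) + 1)) (- (K / 2)) (- (fst (cmap z) / 2)) z (sqrt (poly p z))"
    and "tangent (K / 4 * (snd (cmap z) + 1)) (- (K / 2)) (- (- fst (cmap z) / 2)) z (- sqrt (poly p z))"
    and "z \<noteq> 1 \<Longrightarrow> cmap z \<in> {-1<..<1} \<times> {-1<..<1}"
proof -
  have w: "sqrt (poly p z) \<noteq> 0" "(sqrt (poly p z))\<^sup>2 = poly p z"
    "- sqrt (poly p z) \<noteq> 0" "(- sqrt (poly p z))\<^sup>2 = poly p z"
    using p_pos[OF z] by auto
  show nz: "fst (cmap z) \<noteq> 0"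
    using p_pos[OF z] K D1_nz[OF z] by (auto simp: cmap_def)
  show t: "tangent (K / 4 * (snd (cmap z) + 1)) (- (K / 2)) (- (fst (cmap z) / 2)) z (sqrt (poly p z))"
    unfolding tangent_iff[OF z w(1,2)] by (simp add: cmap_def)
  show "tangent (K / 4 * (snd (cmap z) + 1)) (- (K / 2)) (- (- fst (cmap z) / 2)) z (- sqrt (poly p z))"
    unfolding tangent_iff[OF z w(3,4)] by (simp add: cmap_def)
  show "cmap z \<in> {-1<..<1} \<times> {-1<..<1}" if "z \<noteq> 1"
    using tangent_in_square[OF t z that nz] by simp
qed

lemma cmap_root_in_square:
  assumes "j \<in> {1..2 * d}"
  shows "cmap (x j) \<in> {-1<..<1} \<times> {-1<..<1}"
  using assms x_neg[OF assms] by (simp add: cmap_root field_simps)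

text \<open>The abscissa separates three kinds of z. It is 0 only at branch points, where the
  ordinate is a Moebius function of z; its modulus is 1 only at z = 1; otherwise
  \<open>tangent_unique\<close> applies, with the other sheet for the mirrored alternative.\<close>

lemma cmap_inj:
  assumes z: "z \<in> Ubar" "z' \<in> Ubar" and eq: "cmap z = cmap z' \<or> cmap z = mirror (cmap z')"
  shows "z = z'"
proof -
  have snd_eq: "snd (cmap z) = snd (cmap z')" and fst_eq: "fst (cmap z) = fst (cmap z') \<or> fst (cmap z) = - fst (cmap z')"
    using eq by (auto simp: mirror_def split: prod.splits)
  show ?thesis
  proof (cases "fst (cmap z) = 0")
    case True
    then have "z \<notin> U" "z' \<notin> U"
      using cmap_tangent(1) fst_eq by auto
    then obtain i j where ij: "i \<le> 2 * d" "z = x i" "j \<le> 2 * d" "z' = x j"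
      using z Ubar_cases by metis
    have "x i \<le> 0" "x j \<le> 0"
      using x_neg[of i] x_neg[of j] x0 ij by (cases "i = 0"; cases "j = 0"; force)+
    moreover have "(x i + 1) / (x i - 1) = (x j + 1) / (x j - 1)"
      using snd_eq ij by (simp add: cmap_root)
    ultimately show ?thesis
      using ij by (simp add: field_simps)
  next
    case False
    then have U: "z \<in> U" "z' \<in> U"
      using z fst_eq Ubar_cases[of z] Ubar_cases[of z'] cmap_root(2) by (metis fst_conv neg_equal_0_iff_equal)+
    have abs: "\<bar>fst (cmap z)\<bar> = \<bar>fst (cmap z')\<bar>"
      using fst_eq by auto
    have abs1: "\<bar>fst (cmap s)\<bar> < 1" if "s \<in> U" "s \<noteq> 1" for s
      using cmap_tangent(4)[OF that] by (cases "cmap s") auto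
    show ?thesis
    proof (cases "z = 1 \<or> z' = 1")
      case True
      then show ?thesis
        using abs1[of z] abs1[of z'] U abs cmap_one by force
    next
      case False
      have C: "- (fst (cmap z) / 2) \<noteq> 0"
        using \<open>fst (cmap z) \<noteq> 0\<close> by simp
      show ?thesis
        using fst_eq
      proof
        assume "fst (cmap z) = fst (cmap z')"
        then show ?thesis
          using tangent_unique[OF cmap_tangent(2)[OF U(1)] U(1) C _ U(2)] cmap_tangent(2)[OF U(2)] snd_eq
          by metis
      next
        assume "fst (cmap z) = - fst (cmap z')"
        then show ?thesis
          using tangent_unique[OF cmap_tangent(2)[OF U(1)] U(1) C _ U(2)] cmap_tangent(3)[OF U(2)] snd_eq
          by metis
      qed
    qed
  qed
qed

lemma continuous_cmap: "continuous_on Ubar cmap"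
  unfolding cmap_def by (intro continuous_intros) (use D1_nz_Ubar in auto)

text \<open>In \<open>E\<close> the contributions with factor \<open>2 * d\<close> to the
  coefficient of \<open>z ^ (3 * d)\<close> cancel and leave minus the product of the leading
  coefficients of \<open>r\<close> and \<open>p1\<close>. \<open>D1\<close> has half of that at
  degree \<open>3 * d + 1\<close>, so the ordinate tends to 2 - 1, while chi decays like the inverse
  square root of z.\<close>

lemma cmap_at_top: "(cmap \<longlongrightarrow> (0, 1)) at_top"
proof -
  define \<rho> where "\<rho> = lead_coeff r"
  define c where "c = lead_coeff p1"
  have \<rho>: "\<rho> \<noteq> 0" and c: "c \<noteq> 0"
    using r_pos_nz[of 0] p1_pos[of 0] by (auto simp: \<rho>_def c_def)
  have top: "((\<lambda>z. poly f z / z ^ n) \<longlongrightarrow> coeff f n) at_top" if "degree f \<le> n" for f :: "real poly" and n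
    using poly_over_power_tendsto[OF that] at_top_le_at_infinity tendsto_mono by blast
  have inv: "((\<lambda>z::real. 1 / z) \<longlongrightarrow> 0) at_top"
    using tendsto_inverse_0_at_top[OF filterlim_ident] by (simp add: field_simps)
  have 1: "((\<lambda>z. poly r z / z ^ d) \<longlongrightarrow> \<rho>) at_top"
    using top[of r d] degree_r by (simp add: \<rho>_def)
  have 2: "((\<lambda>z. poly p1 z / z ^ (2 * d)) \<longlongrightarrow> c) at_top"
    using top[of p1 "2 * d"] degree_p1 by (simp add: c_def)
  have deg: "degree (pCons 0 (pderiv f)) \<le> degree f" for f :: "real poly"
    by (cases "pderiv f = 0") (auto simp: degree_pderiv pderiv_eq_0_iff)
  have cf: "coeff (pCons 0 (pderiv f)) n = real n * coeff f n" for f :: "real poly" and n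
    by (cases n) (auto simp: coeff_pderiv)
  have 3: "((\<lambda>z. z * poly (pderiv r) z / z ^ d) \<longlongrightarrow> d * \<rho>) at_top"
    using top[OF deg, of r] cf[of r d] degree_r by (simp add: \<rho>_def)
  have 4: "((\<lambda>z. z * poly (pderiv p1) z / z ^ (2 * d)) \<longlongrightarrow> 2 * d * c) at_top"
    using top[OF deg, of p1] cf[of p1 "2 * d"] degree_p1 by (simp add: c_def)
  have "((\<lambda>z. 2 * (z * poly (pderiv r) z / z ^ d) * (poly p1 z / z ^ (2 * d))
      - (poly r z / z ^ d) * (poly p1 z / z ^ (2 * d) + z * poly (pderiv p1) z / z ^ (2 * d)))
      \<longlongrightarrow> 2 * (d * \<rho>) * c - \<rho> * (c + 2 * d * c)) at_top"
    by (intro tendsto_intros 1 2 3 4)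
  also have "2 * (d * \<rho>) * c - \<rho> * (c + 2 * d * c) = - (\<rho> * c)"
    by (simp add: algebra_simps)
  finally have E: "((\<lambda>z. poly E z / z ^ (3 * d)) \<longlongrightarrow> - (\<rho> * c)) at_top"
  proof (rule Lim_transform_eventually)
    show "\<forall>\<^sub>F z in at_top. 2 * (z * poly (pderiv r) z / z ^ d) * (poly p1 z / z ^ (2 * d))
      - (poly r z / z ^ d) * (poly p1 z / z ^ (2 * d) + z * poly (pderiv p1) z / z ^ (2 * d))
      = poly E z / z ^ (3 * d)"
      using eventually_gt_at_top[of 0]
    proof eventually_elim
      case (elim z)
      have "z ^ (3 * d) = z ^ d * z ^ (2 * d)"
        by (simp add: power_add[symmetric])
      with elim show ?case
        by (simp add: poly_E field_simps)
    qed
  qed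
  have "((\<lambda>z. (1 - 1 / z) * (poly E z / z ^ (3 * d)) / 2 - (poly r z / z ^ d) * (poly p1 z / z ^ (2 * d)) * (1 / z))
    \<longlongrightarrow> (1 - 0) * (- (\<rho> * c)) / 2 - \<rho> * c * 0) at_top"
    by (intro tendsto_intros 1 2 E inv) auto
  also have "(1 - 0) * (- (\<rho> * c)) / 2 - \<rho> * c * 0 = - (\<rho> * c) / 2"
    by simp
  finally have D: "((\<lambda>z. poly D1 z / z ^ (3 * d + 1)) \<longlongrightarrow> - (\<rho> * c) / 2) at_top"
  proof (rule Lim_transform_eventually)
    show "\<forall>\<^sub>F z in at_top. (1 - 1 / z) * (poly E z / z ^ (3 * d)) / 2 - (poly r z / z ^ d) * (poly p1 z / z ^ (2 * d)) * (1 / z)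
      = poly D1 z / z ^ (3 * d + 1)"
      using eventually_gt_at_top[of 0]
    proof eventually_elim
      case (elim z)
      have "z ^ (3 * d) = z ^ d * z ^ (2 * d)"
        by (simp add: power_add[symmetric])
      with elim show ?case
        by (simp add: poly_D1 field_simps)
    qed
  qed
  have Dnz: "- (\<rho> * c) / 2 \<noteq> 0" using \<rho> c by simp
  have "((\<lambda>z. (poly E z / z ^ (3 * d)) / (poly D1 z / z ^ (3 * d + 1)) - 1) \<longlongrightarrow> - (\<rho> * c) / (- (\<rho> * c) / 2) - 1) at_top"
    by (intro tendsto_intros E D Dnz)
  also have "- (\<rho> * c) / (- (\<rho> * c) / 2) - 1 = 1"
    using Dnz by (simp add: field_simps)
  finally have snd: "((\<lambda>z. z * poly E z / poly D1 z - 1) \<longlongrightarrow> 1) at_top"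
  proof (rule Lim_transform_eventually)
    show "\<forall>\<^sub>F z in at_top. (poly E z / z ^ (3 * d)) / (poly D1 z / z ^ (3 * d + 1)) - 1 = z * poly E z / poly D1 z - 1"
      using eventually_gt_at_top[of 0]
      by eventually_elim (simp add: field_simps)
  qed
  have "((\<lambda>z. K * (poly p1 z / z ^ (2 * d)) * sqrt (poly p1 z / z ^ (2 * d) * (1 / z)) / (poly D1 z / z ^ (3 * d + 1)))
      \<longlongrightarrow> K * c * sqrt (c * 0) / (- (\<rho> * c) / 2)) at_top"
    by (intro tendsto_intros 2 D inv Dnz)
  also have "K * c * sqrt (c * 0) / (- (\<rho> * c) / 2) = 0"
    by simp
  finally have fst: "((\<lambda>z. K * poly p1 z * sqrt (poly p z) / poly D1 z) \<longlongrightarrow> 0) at_top"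
  proof (rule Lim_transform_eventually)
    show "\<forall>\<^sub>F z in at_top. K * (poly p1 z / z ^ (2 * d)) * sqrt (poly p1 z / z ^ (2 * d) * (1 / z)) / (poly D1 z / z ^ (3 * d + 1))
      = K * poly p1 z * sqrt (poly p z) / poly D1 z"
      using eventually_gt_at_top[of 0]
    proof eventually_elim
      case (elim z)
      have "poly p1 z / z ^ (2 * d) * (1 / z) = poly p z / (z ^ (d + 1))\<^sup>2"
        using elim by (simp add: power_mult power2_eq_square field_simps power_add[symmetric] mult_2)
      then have "sqrt (poly p1 z / z ^ (2 * d) * (1 / z)) = sqrt (poly p z) / z ^ (d + 1)"
        using elim by (simp add: real_sqrt_divide)
      moreover have "z ^ (3 * d) = z ^ d * z ^ (2 * d)"
        by (simp add: power_add[symmetric])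
      ultimately show ?case
        using elim by (simp add: field_simps)
    qed
  qed
  show ?thesis
    unfolding cmap_def by (rule tendsto_Pair[OF fst snd])
qed


lemma oval_subset:
  assumes "l \<in> {1..d}"
  shows "{x (2 * l)..x (2 * l - 1)} \<subseteq> Ubar" "{x (2 * l)<..<x (2 * l - 1)} \<subseteq> U"
    "x (2 * l) < x (2 * l - 1)"
  using assms x_anti[of "2 * l - 1" "2 * l"] by (auto simp: Ubar_def U_def ovals_def)

lemma oval_simple_closed_curve:
  assumes l: "l \<in> {1..d}"
  shows "simple_closed_curve (cmap ` {x (2 * l)..x (2 * l - 1)} \<union> mirror ` cmap ` {x (2 * l)..x (2 * l - 1)})"
proof -
  define a where "a = x (2 * l)"
  define b where "b = x (2 * l - 1)"
  have ab: "a < b" "{a..b} \<subseteq> Ubar" "{a<..<b} \<subseteq> U"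
    using oval_subset[OF l] by (auto simp: a_def b_def)
  have lin: "(\<lambda>t. a + t * (b - a)) ` {0..1} = {a..b}"
  proof
    show "{a..b} \<subseteq> (\<lambda>t. a + t * (b - a)) ` {0..1}"
    proof
      fix z assume "z \<in> {a..b}"
      with ab show "z \<in> (\<lambda>t. a + t * (b - a)) ` {0..1}"
        by (intro image_eqI[of _ _ "(z - a) / (b - a)"]) (auto simp: field_simps)
    qed
  next
    show "(\<lambda>t. a + t * (b - a)) ` {0..1} \<subseteq> {a..b}"
    proof safe
      fix t :: real assume t: "t \<in> {0..1}"
      have "t * (b - a) \<le> 1 * (b - a)"
        using ab t by (intro mult_right_mono) auto
      then have "a + t * (b - a) \<le> b" by simp
      with t ab show "a + t * (b - a) \<in> {a..b}" by auto
    qed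
  qed
  define \<gamma> where "\<gamma> = (\<lambda>t. cmap (a + t * (b - a)))"
  have im: "\<gamma> ` {0..1} = cmap ` {a..b}"
    unfolding lin[symmetric] \<gamma>_def by (simp add: image_image)
  have mem: "a + t * (b - a) \<in> Ubar" if "t \<in> {0..1}" for t
    using lin ab(2) that by blast
  have "simple_closed_curve (\<gamma> ` {0..1} \<union> mirror ` \<gamma> ` {0..1})"
  proof (rule mirror_loop)
    show "continuous_on {0..1} \<gamma>"
      unfolding \<gamma>_def
      by (rule continuous_on_compose2[OF continuous_cmap]) (use mem in \<open>auto intro!: continuous_intros\<close>)
    show "fst (\<gamma> 0) = 0" "fst (\<gamma> 1) = 0"
      using l cmap_root(2)[of "2 * l"] cmap_root(2)[of "2 * l - 1"] by (auto simp: \<gamma>_def a_def b_def)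
  next
    fix s t :: real
    assume "s \<in> {0..1}" "t \<in> {0..1}" "\<gamma> s = \<gamma> t \<or> \<gamma> s = mirror (\<gamma> t)"
    then have "a + s * (b - a) = a + t * (b - a)"
      unfolding \<gamma>_def by (intro cmap_inj mem)
    with ab show "s = t" by simp
  next
    fix s :: real assume s: "s \<in> {0..1}" "fst (\<gamma> s) = 0"
    then have "a + s * (b - a) \<notin> {a<..<b}"
      using ab(3) cmap_tangent(1) unfolding \<gamma>_def by blast
    moreover have "a + s * (b - a) \<in> {a..b}"
      using lin s by blast
    ultimately have "a + s * (b - a) = a \<or> a + s * (b - a) = b"
      by force
    then have "s * (b - a) = 0 \<or> (s - 1) * (b - a) = 0"
      by (auto simp: algebra_simps)
    then show "s = 0 \<or> s = 1"
      using ab by auto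
  qed
  then show ?thesis
    by (simp add: im a_def b_def)
qed

text \<open>The substitution z = t / (1 - t) compactifies the half line, and the limit
  \<open>cmap_at_top\<close> supplies continuity at t = 1.\<close>

lemma outer_simple_closed_curve:
  "simple_closed_curve (insert (0, 1) (cmap ` {0..}) \<union> mirror ` insert (0, 1) (cmap ` {0..}))"
proof -
  define \<gamma> where "\<gamma> = (\<lambda>t. if t = 1 then (0, 1) else cmap (t / (1 - t)))"
  have sub: "{0..} \<subseteq> Ubar" by (auto simp: Ubar_def)
  have nn: "t / (1 - t) \<ge> 0" if "t \<in> {0..<1}" for t :: real
    using that by simp
  have im: "\<gamma> ` {0..1} = insert (0, 1) (cmap ` {0..})"
  proof
    show "\<gamma> ` {0..1} \<subseteq> insert (0, 1) (cmap ` {0..})"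
      using nn by (auto simp: \<gamma>_def)
    show "insert (0, 1) (cmap ` {0..}) \<subseteq> \<gamma> ` {0..1}"
    proof -
      have "(0, 1) \<in> \<gamma> ` {0..1}"
        by (intro image_eqI[of _ _ 1]) (auto simp: \<gamma>_def)
      moreover have "cmap z \<in> \<gamma> ` {0..1}" if "z \<in> {0..}" for z
      proof -
        from that have "z / (1 + z) / (1 - z / (1 + z)) = z" "z / (1 + z) \<in> {0..1}" "z / (1 + z) \<noteq> 1"
        by (auto simp: field_simps)
        then show ?thesis
          by (intro image_eqI[of _ _ "z / (1 + z)"]) (auto simp: \<gamma>_def)
      qed
      ultimately show ?thesis by blast
    qed
  qed
  \<comment> \<open>On the half line the abscissa vanishes only at z = 0, where the value is (0,
    -1).\<close>
  have sq: "cmap z \<noteq> (0, 1)" "cmap z \<noteq> mirror (0, 1)" if "z \<ge> 0" for z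
    using that cmap_tangent(1)[of z] cmap_zero by (cases "z = 0"; force simp: U_def)+
  have "simple_closed_curve (\<gamma> ` {0..1} \<union> mirror ` \<gamma> ` {0..1})"
  proof (rule mirror_loop)
    have "(\<gamma> \<longlongrightarrow> \<gamma> t) (at t within {0..1})" if t: "t \<in> {0..1}" for t
    proof (cases "t = 1")
      case True
      have "((\<lambda>t::real. 1 - t) \<longlongrightarrow> 1 - 1) (at_left 1)"
        by (intro tendsto_intros)
      moreover have "\<forall>\<^sub>F t in at_left (1::real). 0 < 1 - t"
        by (simp add: eventually_at_filter)
      ultimately have "filterlim (\<lambda>t::real. inverse (1 - t)) at_top (at_left 1)"
        by (intro filterlim_inverse_at_top) auto
      then have "filterlim (\<lambda>t::real. -1 + inverse (1 - t)) at_top (at_left 1)"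
        by (intro filterlim_tendsto_add_at_top[OF tendsto_const])
      moreover have "\<forall>\<^sub>F t in at_left (1::real). -1 + inverse (1 - t) = t / (1 - t)"
        by (simp add: eventually_at_filter field_simps)
      ultimately have "filterlim (\<lambda>t::real. t / (1 - t)) at_top (at_left 1)"
        by (subst (asm) filterlim_cong[OF refl refl])
      then have "((\<lambda>t. cmap (t / (1 - t))) \<longlongrightarrow> (0, 1)) (at_left 1)"
        by (rule filterlim_compose[OF cmap_at_top])
      then have "(\<gamma> \<longlongrightarrow> (0, 1)) (at_left 1)"
        by (rule Lim_transform_eventually) (simp add: eventually_at_filter \<gamma>_def)
      then have "(\<gamma> \<longlongrightarrow> (0, 1)) (at 1 within {0..1})"
        by (simp add: at_within_Icc_at_left)
      with True show ?thesis by (simp add: \<gamma>_def)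
    next
      case False
      have "continuous_on {0..<1} (\<lambda>t. cmap (t / (1 - t)))"
        by (rule continuous_on_compose2[OF continuous_cmap])
          (use nn sub in \<open>auto intro!: continuous_intros\<close>)
      then have "continuous_on {0..<1} \<gamma>"
        by (rule continuous_on_eq) (auto simp: \<gamma>_def)
      moreover have "t \<in> {0..<1}" using t False by auto
      ultimately have "(\<gamma> \<longlongrightarrow> \<gamma> t) (at t within {0..<1})"
        by (auto simp: continuous_on)
      moreover have "at t within {0..<1} = at t within {0..1}"
        using t False by (intro at_within_nhd[where S = "{..<1}"]) auto
      ultimately show ?thesis by simp
    qed
    then show "continuous_on {0..1} \<gamma>" by (simp add: continuous_on)
    show "fst (\<gamma> 0) = 0" "fst (\<gamma> 1) = 0"
      by (auto simp: \<gamma>_def cmap_zero)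
  next
    fix s t :: real
    assume st: "s \<in> {0..1}" "t \<in> {0..1}" "\<gamma> s = \<gamma> t \<or> \<gamma> s = mirror (\<gamma> t)"
    show "s = t"
    proof (cases "s = 1 \<or> t = 1")
      case True
      have ne: "\<gamma> u \<noteq> (0, 1)" "mirror (\<gamma> u) \<noteq> (0, 1)" if "u \<in> {0..1}" "u \<noteq> 1" for u
      proof -
        have "u / (1 - u) \<ge> 0" using that by simp
        from sq[OF this] that show "\<gamma> u \<noteq> (0, 1)" "mirror (\<gamma> u) \<noteq> (0, 1)"
          by (auto simp: \<gamma>_def mirror_def split: prod.splits)
      qed
      have g1: "\<gamma> 1 = (0, 1)" by (simp add: \<gamma>_def)
      show ?thesis
      proof (cases "s = 1")
        case True
        then show ?thesis using st ne[of t] g1 by metis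
      next
        case False
        with True have "t = 1" by simp
        then have "\<gamma> s = (0, 1)" using st(3) g1 by auto
        then show ?thesis using False st(1) ne(1) by blast
      qed
    next
      case False
      then have "s / (1 - s) = t / (1 - t)"
        using st nn[of s] nn[of t] sub by (intro cmap_inj) (auto simp: \<gamma>_def)
      with False show ?thesis by (simp add: field_simps)
    qed
  next
    fix s :: real assume s: "s \<in> {0..1}" "fst (\<gamma> s) = 0"
    show "s = 0 \<or> s = 1"
    proof (rule ccontr)
      assume "\<not> (s = 0 \<or> s = 1)"
      with s have "s / (1 - s) \<in> U" "\<gamma> s = cmap (s / (1 - s))"
        by (auto simp: U_def \<gamma>_def)
      with s cmap_tangent(1) show False by simp
    qed
  qed
  then show ?thesis by (simp only: im)
qed

end

section \<open>Real polynomials at complex arguments\<close>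

lemma cpoly_pCons [simp]: "cpoly (pCons a f) = pCons (complex_of_real a) (cpoly f)"
  by (simp add: map_poly_pCons)

lemma cpoly_add: "cpoly (f + g) = cpoly f + cpoly g"
  by (intro poly_eqI) (simp add: coeff_map_poly)

lemma cpoly_smult: "cpoly (smult a f) = smult (of_real a) (cpoly f)"
  by (intro poly_eqI) (simp add: coeff_map_poly)

lemma cpoly_diff: "cpoly (f - g) = cpoly f - cpoly g"
  by (intro poly_eqI) (simp add: coeff_map_poly)

lemma cpoly_mult: "cpoly (f * g) = cpoly f * cpoly g"
  by (induction f) (simp_all add: cpoly_add cpoly_smult)

lemma cpoly_power: "cpoly (f ^ n) = cpoly f ^ n"
  by (induction n) (simp_all add: cpoly_mult)

lemma cpoly_pderiv: "cpoly (pderiv f) = pderiv (cpoly f)"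
  by (intro poly_eqI) (simp add: coeff_map_poly coeff_pderiv)

lemma poly_cpoly_of_real: "poly (cpoly f) (of_real t) = of_real (poly f t)"
  by (induction f) simp_all

text \<open>This is the uniqueness behind the \<open>THE\<close> in \<open>p_poly\<close>; the reals
  from 2 on are infinitely many points away from 0 and 1.\<close>

lemma cpoly_inject:
  assumes "\<And>z. z \<noteq> 0 \<Longrightarrow> z \<noteq> 1 \<Longrightarrow> poly (cpoly f) z = poly (cpoly g) z"
  shows "f = g"
proof (rule ccontr)
  assume "f \<noteq> g"
  then have "finite {t. poly (f - g) t = 0}"
    by (intro poly_roots_finite) simp
  moreover have "{2..} \<subseteq> {t::real. poly (f - g) t = 0}"
  proof
    fix t :: real assume "t \<in> {2..}"
    then have "complex_of_real t \<noteq> 0" "complex_of_real t \<noteq> 1" by auto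
    from assms[OF this] show "t \<in> {t. poly (f - g) t = 0}"
      by (simp add: poly_cpoly_of_real)
  qed
  ultimately show False
    using infinite_Ici finite_subset by blast
qed

subsection \<open>The trace polynomial\<close>

text \<open>Positivity of the weights is carried through the matrix product in this form; it yields
  T(1) > 0 and the sign of the second coefficient of \<open>T\<close>.\<close>

definition nonneg_coeffs :: "real poly \<Rightarrow> bool" where
  "nonneg_coeffs f \<longleftrightarrow> (\<forall>i. coeff f i \<ge> 0)"

lemma nonneg_coeffs_intros:
  "nonneg_coeffs f \<Longrightarrow> nonneg_coeffs g \<Longrightarrow> nonneg_coeffs (f + g)"
  "a \<ge> 0 \<Longrightarrow> nonneg_coeffs f \<Longrightarrow> nonneg_coeffs (smult a f)"
  "nonneg_coeffs f \<Longrightarrow> nonneg_coeffs (pCons 0 f)"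
  by (auto simp: nonneg_coeffs_def coeff_pCons split: nat.splits)

text \<open>One factor z per block clears the pole at 0, and all coefficients that appear are
  positive when the weights are.\<close>

lemma weight_factor:
  fixes a b z :: complex and X :: "complex^2^2"
  assumes "z \<noteq> 0" "a \<noteq> 0" "b \<noteq> 0"
  defines "M \<equiv> (vector [vector [1, a * inverse z], vector [inverse a, 1]] :: complex^2^2) **
    (vector [vector [1, b * inverse z], vector [inverse b, 1]] :: complex^2^2)"
  shows "z * (M ** X)$1$j = (z + a / b) * X$1$j + (a + b) * X$2$j"
    and "z * (M ** X)$2$j = (1 / a + 1 / b) * (z * X$1$j) + (z + b / a) * X$2$j"
  using assms(1-3)
  by (simp_all add: M_def matrix_matrix_mult_def sum_2 field_simps)

text \<open>At infinity each block tends to a unipotent lower triangular matrix, so the diagonal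
  entries keep top coefficient 1. The vanishing top coefficient of \<open>b\<close> is what closes
  the induction for \<open>e\<close>.\<close>

lemma matrix_product_poly:
  assumes "\<forall>m\<in>set ms. \<alpha> m > 0 \<and> \<beta> m > (0::real)"
  shows "\<exists>a b c e. nonneg_coeffs a \<and> nonneg_coeffs b \<and> nonneg_coeffs c \<and> nonneg_coeffs e \<and>
    degree a \<le> length ms \<and> degree b \<le> length ms \<and> degree c \<le> length ms \<and> degree e \<le> length ms \<and>
    coeff a (length ms) = 1 \<and> coeff b (length ms) = 0 \<and> coeff e (length ms) = 1 \<and>
    (\<forall>z. z \<noteq> 0 \<longrightarrow>
      (let X = foldr (\<lambda>m A. (Phi_factor (\<alpha> m) z ** Phi_factor (\<beta> m) z) ** A) ms (mat 1) in
        z ^ length ms * X$1$1 = poly (cpoly a) z \<and> z ^ length ms * X$1$2 = poly (cpoly b) z \<and>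
        z ^ length ms * X$2$1 = poly (cpoly c) z \<and> z ^ length ms * X$2$2 = poly (cpoly e) z))"
  using assms
proof (induction ms)
  case Nil
  show ?case
    by (rule exI[of _ 1], rule exI[of _ 0], rule exI[of _ 0], rule exI[of _ 1])
      (auto simp: nonneg_coeffs_def mat_def coeff_1)
next
  case (Cons m ms)
  define n where "n = length ms"
  define X where "X = (\<lambda>z. foldr (\<lambda>m A. (Phi_factor (\<alpha> m) z ** Phi_factor (\<beta> m) z) ** A) ms (mat 1))"
  obtain a b c e where nn: "nonneg_coeffs a" "nonneg_coeffs b" "nonneg_coeffs c" "nonneg_coeffs e"
    and deg: "degree a \<le> n" "degree b \<le> n" "degree c \<le> n" "degree e \<le> n"
    and top: "coeff a n = 1" "coeff b n = 0" "coeff e n = 1"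
    and X: "\<And>z. z \<noteq> 0 \<Longrightarrow> z ^ n * X z$1$1 = poly (cpoly a) z"
      "\<And>z. z \<noteq> 0 \<Longrightarrow> z ^ n * X z$1$2 = poly (cpoly b) z"
      "\<And>z. z \<noteq> 0 \<Longrightarrow> z ^ n * X z$2$1 = poly (cpoly c) z"
      "\<And>z. z \<noteq> 0 \<Longrightarrow> z ^ n * X z$2$2 = poly (cpoly e) z"
    using Cons.IH Cons.prems unfolding Let_def n_def X_def by (auto 0 4)
  have pos: "\<alpha> m > 0" "\<beta> m > 0" using Cons.prems by auto
  define s where "s = \<alpha> m / \<beta> m"
  define t where "t = \<alpha> m + \<beta> m"
  define u where "u = 1 / \<alpha> m + 1 / \<beta> m"
  define v where "v = \<beta> m / \<alpha> m"
  have pos': "s \<ge> 0" "t \<ge> 0" "u \<ge> 0" "v \<ge> 0" using pos by (auto simp: s_def t_def u_def v_def)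
  let ?up = "\<lambda>f g. pCons 0 f + smult s f + smult t g"
  let ?lo = "\<lambda>f g. smult u (pCons 0 f) + pCons 0 g + smult v g"
  have degs: "degree (?up f g) \<le> Suc n" "degree (?lo f g) \<le> Suc n"
    if "degree f \<le> n" "degree g \<le> n" for f g
    using that by (auto intro!: degree_add_le order_trans[OF degree_smult_le] order_trans[OF degree_pCons_le])
  have cf: "coeff f (Suc n) = 0" if "degree f \<le> n" for f :: "real poly"
    using that by (intro coeff_eq_0) simp
  have step1: "z ^ Suc n * ((Phi_factor (\<alpha> m) z ** Phi_factor (\<beta> m) z) ** X z)$1$j = poly (cpoly (?up f g)) z"
    if "z \<noteq> 0" "z ^ n * X z$1$j = poly (cpoly f) z" "z ^ n * X z$2$j = poly (cpoly g) z" for z j f g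
  proof -
    have "z ^ Suc n * ((Phi_factor (\<alpha> m) z ** Phi_factor (\<beta> m) z) ** X z)$1$j =
      z ^ n * ((z + of_real s) * X z$1$j + of_real t * X z$2$j)"
      using weight_factor(1)[of z "\<alpha> m" "\<beta> m" "X z" j] pos that(1)
      by (simp add: Phi_factor_def s_def t_def mult.assoc)
    also have "\<dots> = (z + of_real s) * (z ^ n * X z$1$j) + of_real t * (z ^ n * X z$2$j)"
      by (simp add: algebra_simps)
    finally show ?thesis
      unfolding that by (simp add: cpoly_add cpoly_smult algebra_simps)
  qed
  have step2: "z ^ Suc n * ((Phi_factor (\<alpha> m) z ** Phi_factor (\<beta> m) z) ** X z)$2$j = poly (cpoly (?lo f g)) z"
    if "z \<noteq> 0" "z ^ n * X z$1$j = poly (cpoly f) z" "z ^ n * X z$2$j = poly (cpoly g) z" for z j f g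
  proof -
    have "z ^ Suc n * ((Phi_factor (\<alpha> m) z ** Phi_factor (\<beta> m) z) ** X z)$2$j =
      z ^ n * (of_real u * (z * X z$1$j) + (z + of_real v) * X z$2$j)"
      using weight_factor(2)[of z "\<alpha> m" "\<beta> m" "X z" j] pos that(1)
      by (simp add: Phi_factor_def u_def v_def mult.assoc)
    also have "\<dots> = of_real u * z * (z ^ n * X z$1$j) + (z + of_real v) * (z ^ n * X z$2$j)"
      by (simp add: algebra_simps)
    finally show ?thesis
      unfolding that by (simp add: cpoly_add cpoly_smult algebra_simps)
  qed
  have nns: "nonneg_coeffs (?up f g)" "nonneg_coeffs (?lo f g)"
    if "nonneg_coeffs f" "nonneg_coeffs g" for f g
    using that pos' by (auto intro!: nonneg_coeffs_intros)
  have tops: "coeff (?up a c) (Suc n) = 1" "coeff (?up b e) (Suc n) = 0" "coeff (?lo b e) (Suc n) = 1"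
    using top deg by (simp_all add: cf)
  have fold: "foldr (\<lambda>m A. (Phi_factor (\<alpha> m) z ** Phi_factor (\<beta> m) z) ** A) ms (mat 1) = X z" for z
    by (simp add: X_def)
  note N = nns[OF nn(1,3)] nns[OF nn(2,4)]
  note D = degs[OF deg(1,3)] degs[OF deg(2,4)]
  have F: "z ^ Suc n * ((Phi_factor (\<alpha> m) z ** Phi_factor (\<beta> m) z) ** X z)$1$1 = poly (cpoly (?up a c)) z"
    "z ^ Suc n * ((Phi_factor (\<alpha> m) z ** Phi_factor (\<beta> m) z) ** X z)$1$2 = poly (cpoly (?up b e)) z"
    "z ^ Suc n * ((Phi_factor (\<alpha> m) z ** Phi_factor (\<beta> m) z) ** X z)$2$1 = poly (cpoly (?lo a c)) z"
    "z ^ Suc n * ((Phi_factor (\<alpha> m) z ** Phi_factor (\<beta> m) z) ** X z)$2$2 = poly (cpoly (?lo b e)) z"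
    if "z \<noteq> 0" for z
    using step1[OF that X(1,3)] step1[OF that X(2,4)] step2[OF that X(1,3)] step2[OF that X(2,4)] that
    by blast+
  show ?case
    unfolding Let_def list.size foldr.simps comp_def fold n_def[symmetric] add_Suc_right add_0_right
    by (rule exI[of _ "?up a c"], rule exI[of _ "?up b e"], rule exI[of _ "?lo a c"], rule exI[of _ "?lo b e"])
      (intro conjI allI impI; (rule N D tops | (rule F, assumption)))
qed

text \<open>T(1) is a sum of nonnegative coefficients containing the top one, 2. The sign of
  \<open>coeff T (k - 1)\<close> is recorded because it determines the degree and leading sign of
  \<open>N\<close>.\<close>

lemma trace_poly:
  assumes k: "k \<ge> 1" and \<alpha>: "\<And>m. m \<in> {1..k} \<Longrightarrow> \<alpha> m > 0" and \<beta>: "\<And>m. m \<in> {1..k} \<Longrightarrow> \<beta> m > 0"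
  obtains T :: "real poly" where "degree T = k" "coeff T k = 2" "coeff T (k - 1) \<ge> 0" "poly T 1 > 0"
    and "\<And>z. z \<noteq> 0 \<Longrightarrow> z \<noteq> 1 \<Longrightarrow> trace (Phi k \<alpha> \<beta> z) = poly (cpoly T) z / (z - 1) ^ k"
proof -
  define ms where "ms = [1..<Suc k]"
  have ms: "length ms = k" "\<forall>m\<in>set ms. \<alpha> m > 0 \<and> \<beta> m > 0"
    using \<alpha> \<beta> by (auto simp: ms_def simp del: upt_Suc)
  obtain a b c e where H: "nonneg_coeffs a \<and> nonneg_coeffs b \<and> nonneg_coeffs c \<and> nonneg_coeffs e \<and>
    degree a \<le> length ms \<and> degree b \<le> length ms \<and> degree c \<le> length ms \<and> degree e \<le> length ms \<and>
    coeff a (length ms) = 1 \<and> coeff b (length ms) = 0 \<and> coeff e (length ms) = 1 \<and>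
    (\<forall>z. z \<noteq> 0 \<longrightarrow>
      (let X = foldr (\<lambda>m A. (Phi_factor (\<alpha> m) z ** Phi_factor (\<beta> m) z) ** A) ms (mat 1) in
        z ^ length ms * X$1$1 = poly (cpoly a) z \<and> z ^ length ms * X$1$2 = poly (cpoly b) z \<and>
        z ^ length ms * X$2$1 = poly (cpoly c) z \<and> z ^ length ms * X$2$2 = poly (cpoly e) z))"
    using matrix_product_poly[of ms \<alpha> \<beta>, OF ms(2)] by (elim exE) (rule that)
  have nn: "nonneg_coeffs a" "nonneg_coeffs e" and deg: "degree a \<le> k" "degree e \<le> k"
    and top: "coeff a k = 1" "coeff e k = 1"
    using H unfolding ms(1) by blast+
  have X: "z ^ k * trace (foldr (\<lambda>m A. (Phi_factor (\<alpha> m) z ** Phi_factor (\<beta> m) z) ** A) ms (mat 1))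
        = poly (cpoly (a + e)) z" if "z \<noteq> 0" for z
  proof -
    define Y where "Y = foldr (\<lambda>m A. (Phi_factor (\<alpha> m) z ** Phi_factor (\<beta> m) z) ** A) ms (mat 1)"
    have "z ^ k * Y$1$1 = poly (cpoly a) z" "z ^ k * Y$2$2 = poly (cpoly e) z"
      using H that unfolding Let_def ms(1) Y_def by simp_all
    then show ?thesis
      unfolding Y_def[symmetric] trace_def sum_2 cpoly_add poly_add distrib_left by simp
  qed
  define T where "T = a + e"
  have cT: "coeff T k = 2" using top by (simp add: T_def)
  have degT: "degree T = k"
    using degree_add_le[OF deg] le_degree[of T k] cT by (simp add: T_def)
  have nnT: "nonneg_coeffs T" using nn by (auto simp: T_def intro: nonneg_coeffs_intros)
  have "poly T 1 = (\<Sum>i\<le>k. coeff T i)"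
    by (simp add: poly_altdef degT)
  also have "\<dots> \<ge> coeff T k"
    using nnT by (intro member_le_sum) (auto simp: nonneg_coeffs_def)
  finally have "poly T 1 > 0" using cT by simp
  moreover have "trace (Phi k \<alpha> \<beta> z) = poly (cpoly T) z / (z - 1) ^ k" if z: "z \<noteq> 0" "z \<noteq> 1" for z
  proof -
    have tr: "trace (mat s ** Y) = s * trace Y" for s and Y :: "complex^2^2"
      by (simp add: trace_def sum_2 matrix_matrix_mult_def mat_def distrib_left)
    have "1 - inverse z = (z - 1) / z"
      using z by (simp add: field_simps)
    then have "1 / (1 - inverse z) ^ k = z ^ k / (z - 1) ^ k"
      by (simp add: power_divide)
    then show ?thesis
      using X[OF z(1)] by (simp add: Phi_def tr T_def ms_def del: upt_Suc)
  qed
  ultimately show ?thesis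
    using that[of T] degT cT nnT by (auto simp: nonneg_coeffs_def)
qed

lemma p_poly_eq:
  assumes k: "k \<ge> 1"
    and T: "\<And>z. z \<noteq> 0 \<Longrightarrow> z \<noteq> 1 \<Longrightarrow> trace (Phi k \<alpha> \<beta> z) = poly (cpoly T) z / (z - 1) ^ k"
  shows "p_poly k \<alpha> \<beta> = T\<^sup>2 - smult 4 ([:-1, 1:] ^ (2 * k))"
  unfolding p_poly_def
proof (rule the_equality)
  have eq: "poly (cpoly (T\<^sup>2 - smult 4 ([:-1, 1:] ^ (2 * k)))) z =
      ((z - 1) ^ k * trace (Phi k \<alpha> \<beta> z))\<^sup>2 - 4 * (z - 1) ^ (2 * k)"
    if z: "z \<noteq> 0 \<and> z \<noteq> 1" for z
  proof -
    have "(z - 1) ^ k * trace (Phi k \<alpha> \<beta> z) = poly (cpoly T) z"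
      using T z by simp
    then show ?thesis
      by (simp add: cpoly_diff cpoly_smult cpoly_power poly_power)
  qed
  then show "\<forall>z. z \<noteq> 0 \<and> z \<noteq> 1 \<longrightarrow> poly (cpoly (T\<^sup>2 - smult 4 ([:-1, 1:] ^ (2 * k)))) z =
      ((z - 1) ^ k * trace (Phi k \<alpha> \<beta> z))\<^sup>2 - 4 * (z - 1) ^ (2 * k)" by blast
  fix f :: "real poly"
  assume "\<forall>z. z \<noteq> 0 \<and> z \<noteq> 1 \<longrightarrow> poly (cpoly f) z =
      ((z - 1) ^ k * trace (Phi k \<alpha> \<beta> z))\<^sup>2 - 4 * (z - 1) ^ (2 * k)"
  then show "f = T\<^sup>2 - smult 4 ([:-1, 1:] ^ (2 * k))"
    by (intro cpoly_inject) (simp add: eq)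
qed

section \<open>Divisibility and signs of products of linear factors\<close>

text \<open>Since \<open>T\<close> minus its value at \<open>a\<close> is divisible by X - a, the
  constant 1 is a multiple of \<open>T\<close> plus a multiple of X - a; inserting this into the
  second summand raises the exponent by one.\<close>

lemma bezout_linear_power:
  fixes T :: "real poly"
  assumes "poly T a \<noteq> 0"
  shows "\<exists>u v. u * T + v * [:-a, 1:] ^ n = 1"
proof (induction n)
  case 0
  show ?case by (intro exI[of _ 0] exI[of _ 1]) simp
next
  case (Suc n)
  then obtain u v where uv: "u * T + v * [:-a, 1:] ^ n = 1" by blast
  have "poly (T - [:poly T a:]) a = 0" by simp
  then obtain S where S: "T - [:poly T a:] = [:-a, 1:] * S"
    unfolding poly_eq_0_iff_dvd by blast
  define c where "c = inverse (poly T a)"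
  have cT: "c * poly T a = 1"
    using assms by (simp add: c_def)
  have c: "smult c [:poly T a:] = 1"
    unfolding smult_pCons cT by simp
  have "smult c T - smult c (T - [:poly T a:]) = 1"
    unfolding smult_diff_right c by simp
  then have 1: "smult c T - smult c ([:-a, 1:] * S) = 1"
    unfolding S .
  have "1 = u * T + v * [:-a, 1:] ^ n * (smult c T - smult c ([:-a, 1:] * S))"
    using uv 1 by simp
  also have "\<dots> = (u + smult c (v * [:-a, 1:] ^ n)) * T + (- smult c (v * S)) * [:-a, 1:] ^ Suc n"
  proof -
    have "u * T + v * X ^ n * (smult c T - smult c (X * S)) =
      (u + smult c (v * X ^ n)) * T + (- smult c (v * S)) * X ^ Suc n" for X
      by (simp add: algebra_simps)
    then show ?thesis .
  qed
  finally show ?case by metis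
qed

lemma prod_linear_dvd:
  fixes f :: "real poly"
  assumes "finite A" "inj_on x A" "\<And>a. a \<in> A \<Longrightarrow> poly f (x a) = 0"
  shows "(\<Prod>a\<in>A. [:- x a, 1:]) dvd f"
  using assms
proof (induction A arbitrary: f rule: finite_induct)
  case (insert a A)
  obtain g where g: "f = [:- x a, 1:] * g"
    using insert.prems(2)[of a] unfolding poly_eq_0_iff_dvd by blast
  have "poly g (x b) = 0" if "b \<in> A" for b
  proof -
    have "x b \<noteq> x a" using insert.prems(1) insert.hyps that by (auto simp: inj_on_def)
    with insert.prems(2)[of b] that show ?thesis by (simp add: g)
  qed
  then have "(\<Prod>a\<in>A. [:- x a, 1:]) dvd g"
    using insert by (auto simp: inj_on_def)
  then show ?case
    unfolding prod.insert[OF insert.hyps(1,2)] g by (rule mult_dvd_mono[OF dvd_refl])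
qed simp

lemma prod_sign:
  fixes x :: "nat \<Rightarrow> real"
  assumes "m \<le> n" "\<And>j. j \<in> {1..m} \<Longrightarrow> z < x j" "\<And>j. j \<in> {m<..n} \<Longrightarrow> x j < z"
  shows "(-1) ^ m * (\<Prod>j\<in>{1..n}. z - x j) > 0"
proof -
  have "{1..n} = {1..m} \<union> {m<..n}" using assms(1) by auto
  then have "(\<Prod>j\<in>{1..n}. z - x j) = (\<Prod>j\<in>{1..m}. z - x j) * (\<Prod>j\<in>{m<..n}. z - x j)"
    by (simp add: prod.union_disjoint ivl_disj_int)
  also have "(\<Prod>j\<in>{1..m}. z - x j) = (\<Prod>j\<in>{1..m}. (-1) * (x j - z))"
    by simp
  also have "\<dots> = (-1) ^ m * (\<Prod>j\<in>{1..m}. x j - z)"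
    unfolding prod.distrib by simp
  finally have "(-1) ^ m * (\<Prod>j\<in>{1..n}. z - x j) = ((-1) ^ m * (-1) ^ m) * ((\<Prod>j\<in>{1..m}. x j - z) * (\<Prod>j\<in>{m<..n}. z - x j))"
    by (simp only: mult_ac)
  also have "((-1) ^ m * (-1) ^ m :: real) = 1"
    by (simp flip: power_add)
  also have "1 * ((\<Prod>j\<in>{1..m}. x j - z) * (\<Prod>j\<in>{m<..n}. z - x j)) > 0"
    using assms(2,3) by (auto intro!: mult_pos_pos prod_pos)
  finally show ?thesis .
qed

section \<open>The spectral curve and the polynomial r\<close>

locale spectral_curve =
  fixes k k' :: nat and \<alpha> \<beta> x :: "nat \<Rightarrow> real" and q p0 T :: "real poly"
  assumes k: "k \<ge> 1"
    and T: "degree T = k" "coeff T k = 2" "coeff T (k - 1) \<ge> 0" "poly T 1 > 0"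
    and trace_Phi: "\<And>z. z \<noteq> 0 \<Longrightarrow> z \<noteq> 1 \<Longrightarrow> trace (Phi k \<alpha> \<beta> z) = poly (cpoly T) z / (z - 1) ^ k"
    and factorization: "p_poly k \<alpha> \<beta> = q\<^sup>2 * p0"
    and simple: "rsquarefree (cpoly p0)"
    and monic: "lead_coeff q = 1"
    and k': "k' \<ge> 1"
    and deg_p0: "degree p0 = 2 * k' - 1"
    and x0: "x 0 = 0"
    and x_mono: "strict_antimono_on {..2 * (k' - 1)} x"
    and roots: "{t. poly p0 t = 0} = x ` {..2 * (k' - 1)}"
begin

text \<open>The genus of the surface, since \<open>p0\<close> has degree
  \<open>2 * d + 1\<close>.\<close>

abbreviation d :: nat where "d \<equiv> k' - 1"

definition P :: "real poly" where "P = q\<^sup>2 * p0"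

definition N :: "real poly" where "N = [:-1, 1:] * pderiv T - smult (real k) T"

lemma P_eq: "P = T\<^sup>2 - smult 4 ([:-1, 1:] ^ (2 * k))"
  using p_poly_eq[OF k trace_Phi] factorization by (simp add: P_def)

text \<open>The power (z - 1)^(2 k) is an eigenfunction of (z - 1) d/dz with eigenvalue 2 k, so only
  the part T^2 of \<open>P\<close> survives in (z - 1) P' - 2 k P.\<close>

lemma P_deriv: "[:-1, 1:] * pderiv P = 2 * T * N + smult (2 * real k) P"
proof -
  have "[:-1, 1:] * pderiv ([:-1, 1:] ^ Suc n) = smult (real (Suc n)) ([:-1, 1:] ^ Suc n)" for n
    unfolding pderiv_power_Suc by (simp add: pderiv_pCons)
  from this[of "2 * k - 1"] have 1: "[:-1, 1:] * pderiv ([:-1, 1:] ^ (2 * k)) = smult (2 * real k) ([:-1, 1:] ^ (2 * k))"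
    using k by simp
  have "[:-1, 1:] * pderiv P = 2 * T * ([:-1, 1:] * pderiv T) - smult 4 ([:-1, 1:] * pderiv ([:-1, 1:] ^ (2 * k)))"
    unfolding P_eq power2_eq_square[of T] by (simp only: pderiv_diff pderiv_smult pderiv_mult) (simp add: algebra_simps)
  also have "\<dots> = 2 * T * ([:-1, 1:] * pderiv T) - smult (2 * real k) (smult 4 ([:-1, 1:] ^ (2 * k)))"
    unfolding 1 by (simp add: mult.commute)
  also have "smult 4 ([:-1, 1:] ^ (2 * k)) = T\<^sup>2 - P"
    by (simp add: P_eq)
  also have "2 * T * ([:-1, 1:] * pderiv T) - smult (2 * real k) (T\<^sup>2 - P) = 2 * T * N + smult (2 * real k) P"
    unfolding N_def power2_eq_square
    by (intro poly_ext) (simp add: algebra_simps)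
  finally show ?thesis .
qed

text \<open>As \<open>q\<close> divides both \<open>P\<close> and its derivative,
  \<open>P_deriv\<close> gives that \<open>q\<close> divides 2 T N. The factor \<open>T\<close> can
  be removed because \<open>T\<close> and (z - 1)^(2 k) are coprime and 4 (z - 1)^(2 k) is T^2
  modulo \<open>P\<close>.\<close>

lemma q_dvd_N: "q dvd N"
proof -
  obtain u v where uv: "u * T + v * [:-1, 1:] ^ (2 * k) = 1"
    using bezout_linear_power[of T 1 "2 * k"] T(4) by auto
  have qP: "q dvd P" by (simp add: P_def power2_eq_square)
  have "pderiv P = q * (2 * pderiv q * p0 + q * pderiv p0)"
    unfolding P_def power2_eq_square pderiv_mult by (simp add: algebra_simps)
  then have "q dvd [:-1, 1:] * pderiv P"
    by (metis dvd_mult dvd_triv_left)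
  then have "q dvd 2 * T * N + smult (2 * real k) P"
    by (simp only: P_deriv)
  moreover have "q dvd smult (2 * real k) P" using qP by (rule dvd_smult)
  ultimately have TN: "q dvd 2 * T * N"
    using dvd_add_left_iff by blast
  \<comment> \<open>The Bezout identity times \<open>4 * N\<close>; replacing the power of z - 1 by
    T^2 - P turns the right side into a multiple of 2 T N minus a multiple of
    \<open>P\<close>.\<close>
  have "smult 4 N = N * (smult 4 (u * T) + v * smult 4 ([:-1, 1:] ^ (2 * k)))"
    using arg_cong[OF uv, of "\<lambda>f. smult 4 f * N"] by (simp add: smult_add_right mult.commute)
  also have "smult 4 ([:-1, 1:] ^ (2 * k)) = T\<^sup>2 - P"
    by (simp add: P_eq)
  also have "N * (smult 4 (u * T) + v * (T\<^sup>2 - P)) = smult (1/2) (2 * T * N) * (smult 4 u + v * T) - P * (v * N)"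
    by (intro poly_ext) (simp add: algebra_simps power2_eq_square)
  also have "q dvd \<dots>"
    by (rule dvd_diff[OF dvd_mult2[OF dvd_smult[OF TN]] dvd_mult2[OF qP]])
  finally show ?thesis
    by (simp add: dvd_smult_iff)
qed

definition r :: "real poly" where "r = N div q"

lemma q_nz: "q \<noteq> 0" using monic by auto

lemma N_eq: "N = q * r"
  using q_dvd_N by (simp add: r_def)

lemma p0_nz: "p0 \<noteq> 0" using deg_p0 k' by auto

text \<open>The coefficients at degree k cancel, and the next one is minus the sum of
  \<open>coeff T (k - 1)\<close> and 2 k.\<close>

lemma degree_N: "degree N = k - 1" "lead_coeff N < 0"
proof -
  have X: "coeff ([:-1, 1:] * f) (Suc n) = coeff f n - coeff f (Suc n)" for f :: "real poly" and n
    by (simp add: algebra_simps)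
  obtain n where n: "k = Suc n" using k by (cases k) auto
  have cT: "coeff T i = 0" if "i > k" for i using that T(1) by (intro coeff_eq_0) simp
  have "coeff N i = 0" if i: "i > n" for i
  proof -
    obtain j where j: "i = Suc j" using i by (cases i) auto
    have "j > n \<or> j = n" using i j by auto
    then show ?thesis
      unfolding N_def j coeff_diff X coeff_smult coeff_pderiv
      using cT[of "Suc j"] cT[of "Suc (Suc j)"] n by auto
  qed
  then have deg: "degree N \<le> n" by (intro degree_le) auto
  have cn: "coeff N n = - (coeff T n + 2 * real k)"
    unfolding N_def using T(2) n by (cases n) (auto simp: coeff_pderiv algebra_simps)
  have "coeff N n < 0" using T(3) k n cn by simp
  with deg have "degree N = n" by (intro antisym le_degree) auto
  with \<open>coeff N n < 0\<close> n show "degree N = k - 1" "lead_coeff N < 0" by auto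
qed

text \<open>The factorization makes the degree n of \<open>P\<close> odd, so (z - 1) d/dz - 2 k
  multiplies the leading coefficient by the nonzero number n - 2 k. Hence n is the degree of T N,
  and for n = 2 k - 1 the factor -1 turns the negative sign of \<open>N\<close> into the positive
  one of \<open>P\<close>.\<close>

lemma degree_P: "degree P = 2 * k - 1" "lead_coeff P > 0"
proof -
  define n where "n = degree P"
  have "degree P = 2 * degree q + (2 * k' - 1)"
    using q_nz p0_nz by (simp add: P_def degree_mult_eq degree_power_eq deg_p0)
  then have odd: "odd n" using k' by (simp add: n_def)
  have Pnz: "P \<noteq> 0" using q_nz p0_nz by (simp add: P_def)
  define R where "R = [:-1, 1:] * pderiv P - smult (2 * real k) P"
  have R: "R = 2 * T * N" unfolding R_def P_deriv by simp
  have Tn: "T \<noteq> 0" "N \<noteq> 0" using T(2) degree_N by auto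
  have R2: "R = smult 2 (T * N)"
    unfolding R by (intro poly_ext) simp
  have "lead_coeff R = 2 * (lead_coeff T * lead_coeff N)"
    by (simp only: R2 lead_coeff_smult lead_coeff_mult)
  moreover have "degree R = k + (k - 1)"
    using Tn T(1) degree_N(1) by (simp add: R2 degree_mult_eq)
  ultimately have degR: "degree R = k + (k - 1)" "lead_coeff R = 4 * lead_coeff N"
    using T(1,2) by simp_all
  obtain m where m: "n = Suc m" using odd by (cases n) auto
  have big: "coeff P i = 0" if "i > n" for i using that by (simp add: coeff_eq_0 n_def)
  have "coeff R i = 0" if "i > n" for i
    using that big[of i] big[of "Suc i"] by (cases i) (auto simp: R_def coeff_pderiv)
  then have 1: "degree R \<le> n" by (intro degree_le) auto
  have cR: "coeff R n = (real n - 2 * real k) * lead_coeff P"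
    using big[of "Suc n"] by (simp add: R_def m coeff_pderiv algebra_simps n_def[symmetric])
  have "real n \<noteq> 2 * real k"
  proof
    assume "real n = 2 * real k"
    then have "n = 2 * k" by linarith
    with odd show False by simp
  qed
  with Pnz cR have "coeff R n \<noteq> 0" by simp
  then have "degree R = n" using 1 le_degree by (intro antisym)
  with degR k show "degree P = 2 * k - 1" by (simp add: n_def)
  then have "real n = 2 * real k - 1" using k by (simp add: n_def of_nat_diff)
  with cR \<open>degree R = n\<close> degR(2) have "- lead_coeff P = 4 * lead_coeff N" by simp
  with degree_N(2) show "lead_coeff P > 0" by simp
qed

lemma degree_r: "degree r = d"
proof -
  have r_nz: "r \<noteq> 0" using N_eq degree_N by auto
  have "2 * degree q + (2 * k' - 1) = 2 * k - 1"
    using degree_P(1) q_nz p0_nz by (simp add: P_def degree_mult_eq degree_power_eq deg_p0)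
  moreover have "degree q + degree r = k - 1"
    using degree_N(1) q_nz r_nz by (simp add: N_eq degree_mult_eq)
  ultimately show ?thesis using k k' by simp
qed

lemma lead_p0: "lead_coeff p0 > 0"
  using degree_P(2) monic by (simp add: P_def lead_coeff_mult lead_coeff_power)

text \<open>The identity behind \<open>d log \<rho> = r dz / ((z - 1) w)\<close>.\<close>

lemma q_identity: "[:-1, 1:] * (2 * pderiv q * p0 + q * pderiv p0) - smult (2 * real k) (q * p0) = 2 * T * r"
proof -
  have "q * ([:-1, 1:] * (2 * pderiv q * p0 + q * pderiv p0) - smult (2 * real k) (q * p0))
      = [:-1, 1:] * pderiv P - smult (2 * real k) P"
    unfolding P_def power2_eq_square pderiv_mult by (simp add: algebra_simps)
  also have "\<dots> = q * (2 * T * r)"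
    unfolding P_deriv N_eq by (simp add: algebra_simps)
  finally show ?thesis
    using q_nz by simp
qed


definition c0 :: real where "c0 = lead_coeff p0"

definition p1 :: "real poly" where "p1 = smult c0 (\<Prod>j\<in>{1..2 * d}. [:- x j, 1:])"

lemma c0: "c0 > 0" using lead_p0 by (simp add: c0_def)

lemma x_anti: "i < j \<Longrightarrow> j \<le> 2 * d \<Longrightarrow> x j < x i"
  using x_mono by (simp add: monotone_on_def)

text \<open>The \<open>2 * d + 1\<close> distinct real zeros exhaust the degree, so the cofactor of
  their product is the leading coefficient.\<close>

lemma p0_eq: "p0 = pCons 0 p1"
proof -
  have "inj_on x {..2 * d}"
  proof (rule inj_onI)
    fix i j assume "i \<in> {..2 * d}" "j \<in> {..2 * d}" "x i = x j"
    then show "i = j"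
      using x_anti[of i j] x_anti[of j i] by (metis atMost_iff less_irrefl linorder_neqE_nat)
  qed
  then have "(\<Prod>j\<in>{..2 * d}. [:- x j, 1:]) dvd p0"
    using roots by (intro prod_linear_dvd) auto
  then obtain g where g: "p0 = (\<Prod>j\<in>{..2 * d}. [:- x j, 1:]) * g" by blast
  have deg: "degree (\<Prod>j\<in>A. [:- x j, 1:]) = card A" "lead_coeff (\<Prod>j\<in>A. [:- x j, 1:]) = 1" if "finite A" for A
  proof -
    show "degree (\<Prod>j\<in>A. [:- x j, 1:]) = card A"
      by (subst degree_prod_eq_sum_degree) auto
    show "lead_coeff (\<Prod>j\<in>A. [:- x j, 1:]) = 1"
      by (simp only: lead_coeff_prod) simp
  qed
  have gn: "g \<noteq> 0" using p0_nz g by auto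
  have "degree p0 = (2 * d + 1) + degree g"
    unfolding g using gn deg[of "{..2 * d}"] by (subst degree_mult_eq) auto
  then have "degree g = 0" using deg_p0 k' by simp
  then obtain c where c: "g = [:c:]" by (auto elim: degree_eq_zeroE)
  have "lead_coeff p0 = c"
    unfolding g lead_coeff_mult using deg(2)[of "{..2 * d}"] by (simp add: c)
  then have c0c: "c0 = c" by (simp only: c0_def)
  have "{..2 * d} = insert 0 {1..2 * d}" by auto
  then have pr: "(\<Prod>j\<in>{..2 * d}. [:- x j, 1:]) = [:- x 0, 1:] * (\<Prod>j\<in>{1..2 * d}. [:- x j, 1:])"
    by simp
  have "pCons 0 p1 = (\<Prod>j\<in>{..2 * d}. [:- x j, 1:]) * g"
    unfolding c p1_def c0c pr by (simp add: x0)
  with g show ?thesis by metis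
qed

lemma poly_p0: "poly p0 z = z * poly p1 z"
  by (subst p0_eq) simp

lemma poly_pderiv_p0: "poly (pderiv p0) z = poly p1 z + z * poly (pderiv p1) z"
  by (subst p0_eq) (simp add: pderiv_pCons)

lemma poly_p1: "poly p1 z = c0 * (\<Prod>j\<in>{1..2 * d}. z - x j)"
  by (simp add: p1_def poly_prod)

lemma x_neg': "j \<in> {1..2 * d} \<Longrightarrow> x j < 0"
  using x_anti[of 0 j] x0 by auto

lemma p1_pos': "z \<ge> 0 \<Longrightarrow> poly p1 z > 0"
proof -
  assume z: "z \<ge> 0"
  have "(\<Prod>j\<in>{1..2 * d}. z - x j) > 0"
  proof (rule prod_pos)
    fix j assume "j \<in> {1..2 * d}"
    from x_neg'[OF this] z show "0 < z - x j" by simp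
  qed
  with c0 show ?thesis unfolding poly_p1 by simp
qed

lemma p1_neg':
  assumes l: "l \<in> {1..d}" and z: "x (2 * l) < z" "z < x (2 * l - 1)"
  shows "poly p1 z < 0"
proof -
  have "(-1) ^ (2 * l - 1) * (\<Prod>j\<in>{1..2 * d}. z - x j) > 0"
  proof (rule prod_sign)
    have l2: "2 * l - 1 \<le> 2 * d" "2 * l \<le> 2 * d" using l by auto
    then show "2 * l - 1 \<le> 2 * d" by blast
    show "z < x j" if "j \<in> {1..2 * l - 1}" for j
      using that z x_anti[OF _ l2(1), of j] by (cases "j = 2 * l - 1") auto
    show "x j < z" if j: "j \<in> {2 * l - 1<..2 * d}" for j
    proof (cases "j = 2 * l")
      case True
      then show ?thesis using z by simp
    next
      case False
      then have "2 * l < j" "j \<le> 2 * d" using j l by auto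
      from x_anti[OF this] z show ?thesis by simp
    qed
  qed
  moreover have "(-1::real) ^ (2 * l - 1) = -1"
    using l by (intro neg_one_odd_power) auto
  ultimately show ?thesis
    using c0 by (simp add: poly_p1 mult_pos_neg)
qed

text \<open>For \<open>d = 0\<close> there is no \<open>x 1\<close> and the gap is the whole
  negative axis.\<close>

definition t0 :: real where "t0 = (if d = 0 then -1 else x 1 / 2)"

lemma t0': "t0 < 0" "poly p1 t0 > 0" "d \<ge> 1 \<Longrightarrow> x 1 < t0"
proof -
  have 1: "d \<ge> 1 \<Longrightarrow> x 1 < 0" using x_neg'[of 1] by auto
  then show "t0 < 0" by (auto simp: t0_def)
  show 2: "d \<ge> 1 \<Longrightarrow> x 1 < t0" using 1 by (auto simp: t0_def)
  have "x j < t0" if "j \<in> {1..2 * d}" for j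
    using that x_anti[of 1 j] 2 by (cases "j = 1") auto
  then have "(\<Prod>j\<in>{1..2 * d}. t0 - x j) > 0"
    by (intro prod_pos) simp
  with c0 show "poly p1 t0 > 0" unfolding poly_p1 by simp
qed

lemma p1_root': "j \<in> {1..2 * d} \<Longrightarrow> poly p1 (x j) = 0"
  unfolding poly_p1 by (subst prod_zero) auto

lemma p1_simple':
  assumes "j \<in> {1..2 * d}"
  shows "poly (pderiv p1) (x j) \<noteq> 0"
proof -
  have "poly (cpoly p0) (of_real (x j)) = 0"
    using p1_root'[OF assms] by (simp add: poly_cpoly_of_real poly_p0)
  then have "poly (cpoly (pderiv p0)) (of_real (x j)) \<noteq> 0"
    using simple by (auto simp: rsquarefree_roots cpoly_pderiv)
  then show ?thesis
    using p1_root'[OF assms] by (simp add: poly_cpoly_of_real poly_pderiv_p0)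
qed

lemma P_poly: "poly P z = (poly T z)\<^sup>2 - 4 * poly ([:-1, 1:] ^ (2 * k)) z"
  "poly P z = (poly q z)\<^sup>2 * poly p0 z"
  by (simp add: P_eq) (simp add: P_def)

text \<open>On \<open>[x\<^bsub>2l\<^esub>, x\<^bsub>2l-1\<^esub>]\<close> the function \<open>\<rho>\<^sup>2\<close> equals \<open>1\<close> at both end points, and its
  logarithmic derivative is \<open>2 r / ((z - 1) w)\<close>.\<close>

lemma r_root_exists:
  assumes l: "l \<in> {1..d}"
  shows "\<exists>y. x (2 * l) < y \<and> y < x (2 * l - 1) \<and> poly r y = 0"
proof -
  define a where "a = x (2 * l)"
  define b where "b = x (2 * l - 1)"
  have ab: "a < b" "b < 0"
  proof -
    have l': "2 * l - 1 < 2 * l" "2 * l \<le> 2 * d" "2 * l - 1 \<in> {1..2 * d}" using l by auto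
    then show "a < b" "b < 0"
      using x_anti[OF l'(1,2)] x_neg'[OF l'(3)] by (simp_all only: a_def b_def)
  qed
  have p0_ends: "poly p0 a = 0" "poly p0 b = 0"
  proof -
    have l': "2 * l \<in> {1..2 * d}" "2 * l - 1 \<in> {1..2 * d}" using l by auto
    then show "poly p0 a = 0" "poly p0 b = 0"
      using p1_root'[OF l'(1)] p1_root'[OF l'(2)] by (simp_all only: a_def b_def poly_p0 mult_zero_right)
  qed
  have p0_pos: "poly p0 t > 0" if "a < t" "t < b" for t
    using p1_neg'[OF l, of t] that ab by (simp add: a_def b_def poly_p0 mult_neg_neg)
  define V where "V = ([:-1, 1:] :: real poly) ^ (2 * k)"
  have V: "poly V t = (t - 1) ^ (2 * k)" for t by (simp add: V_def)
  have Vpos: "poly V t > 0" if "t \<le> b" for t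
    using that ab by (simp add: V power_mult)
  have V': "(t - 1) * poly (pderiv V) t = 2 * real k * poly V t" for t
  proof -
    have "[:-1, 1:] * pderiv V = smult (2 * real k) V"
      unfolding V_def pderiv_power using k
      by (simp add: pderiv_pCons power_eq_if[of "[:-1, 1:]" "2 * k"])
    from arg_cong[OF this, of "\<lambda>f. poly f t"] show ?thesis by (simp add: algebra_simps)
  qed
  \<comment> \<open>On the sheet w > 0 this is 2 (z - 1)^k \<rho>, so \<open>G\<close> below is 4
    \<rho>^2.\<close>
  define H where "H = (\<lambda>t. poly T t + poly q t * sqrt (poly p0 t))"
  define G where "G = (\<lambda>t. (H t)\<^sup>2 / poly V t)"
  define H' where "H' = (\<lambda>t. poly (pderiv T) t + poly (pderiv q) t * sqrt (poly p0 t)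
      + poly q t * (poly (pderiv p0) t / (2 * sqrt (poly p0 t))))"
  have dH: "(H has_real_derivative H' t) (at t)" if "a < t" "t < b" for t
    unfolding H_def H'_def using p0_pos[OF that]
    by (auto intro!: derivative_eq_intros poly_DERIV simp: field_simps)
  define G' where "G' = (\<lambda>t. (2 * H t * H' t * poly V t - (H t)\<^sup>2 * poly (pderiv V) t) / (poly V t)\<^sup>2)"
  have dG: "(G has_real_derivative G' t) (at t)"
    if "a < t" "t < b" for t
    unfolding G_def G'_def using Vpos[of t] that
    by (auto intro!: derivative_eq_intros poly_DERIV dH simp: power2_eq_square field_simps)
  have "G t = 4" if "poly p0 t = 0" "t \<le> b" for t
    using P_poly[of t] Vpos[of t] that unfolding V_def[symmetric] by (simp add: G_def H_def)
  then have "G a = G b" using p0_ends ab by simp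
  moreover have "continuous_on {a..b} G"
    unfolding G_def H_def using Vpos by (intro continuous_intros) force
  ultimately have "\<exists>t. a < t \<and> t < b \<and> (*) (G' t) = (\<lambda>v. 0)"
    using dG unfolding has_field_derivative_def by (intro Rolle_deriv ab(1))
  then obtain t where t: "a < t" "t < b" and G't: "(*) (G' t) = (\<lambda>v. 0)"
    by blast
  have "G' t = 0" using fun_cong[OF G't, of 1] by simp
  then have eq: "2 * H t * H' t * poly V t = (H t)\<^sup>2 * poly (pderiv V) t"
    using Vpos[of t] t by (simp add: G'_def)
  define w where "w = sqrt (poly p0 t)"
  have w: "w \<noteq> 0" "w\<^sup>2 = poly p0 t" using p0_pos[OF t] by (auto simp: w_def)
  \<comment> \<open>The values of \<rho> on the two sheets are inverse to each other; in particular
    \<open>H\<close> has no zero here and may be cancelled.\<close>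
  have "H t * (poly T t - poly q t * w) = 4 * poly V t"
    using P_poly[of t] w(2) unfolding H_def w_def[symmetric] V_def[symmetric] by algebra
  then have Hnz: "H t \<noteq> 0" using Vpos[of t] t by auto
  have "2 * H t * poly V t * ((t - 1) * H' t - real k * H t) = 0"
    using eq V'[of t] by algebra
  then have e1: "(t - 1) * H' t - real k * H t = 0"
    using Hnz Vpos[of t] t by auto
  have wH: "2 * w * H' t = 2 * w * poly (pderiv T) t + 2 * poly (pderiv q) t * w\<^sup>2 + poly q t * poly (pderiv p0) t"
    using w(1) by (simp add: H'_def w_def[symmetric] field_simps power2_eq_square)
  have N: "(t - 1) * poly (pderiv T) t - real k * poly T t = poly q t * poly r t"
    using arg_cong[OF N_eq, of "\<lambda>f. poly f t"] by (simp add: N_def algebra_simps)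
  have qi: "(t - 1) * (2 * poly (pderiv q) t * poly p0 t + poly q t * poly (pderiv p0) t)
     - 2 * real k * (poly q t * poly p0 t) = 2 * poly T t * poly r t"
    using arg_cong[OF q_identity, of "\<lambda>f. poly f t"] by (simp add: algebra_simps)
  \<comment> \<open>The formula for d log \<rho> multiplied out, with \<open>N\<close> and
    \<open>q_identity\<close> supplying the parts with and without the factor w.\<close>
  have "2 * (poly r t * H t) = 2 * w * ((t - 1) * H' t - real k * H t)"
    using wH N qi w(2) unfolding H_def w_def[symmetric] by algebra
  then have "poly r t = 0" using e1 Hnz by simp
  then show ?thesis using t by (auto simp: a_def b_def)
qed

definition y :: "nat \<Rightarrow> real" where
  "y l = (SOME y. x (2 * l) < y \<and> y < x (2 * l - 1) \<and> poly r y = 0)"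

lemma y': "l \<in> {1..d} \<Longrightarrow> x (2 * l) < y l \<and> y l < x (2 * l - 1) \<and> poly r (y l) = 0"
  unfolding y_def by (rule someI_ex) (rule r_root_exists)

lemma r_only_roots:
  assumes "poly r z = 0"
  shows "z \<in> y ` {1..d}"
proof (rule ccontr)
  assume z: "z \<notin> y ` {1..d}"
  have r_nz: "r \<noteq> 0" using N_eq degree_N by auto
  have dec: "y m < y l" if "l < m" "l \<in> {1..d}" "m \<in> {1..d}" for l m
  proof -
    have "2 * l < 2 * m - 1" "2 * m - 1 \<le> 2 * d" using that by auto
    from x_anti[OF this] have "x (2 * m - 1) \<le> x (2 * l)" by simp
    with y'[OF that(2)] y'[OF that(3)] show ?thesis by linarith
  qed
  have "inj_on y {1..d}"
    by (rule inj_onI) (metis dec less_irrefl linorder_neqE_nat)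
  then have "card (insert z (y ` {1..d})) = Suc d"
    using z by (simp add: card_image)
  moreover have "card (insert z (y ` {1..d})) \<le> card {t. poly r t = 0}"
    using y' assms by (intro card_mono poly_roots_finite r_nz) auto
  moreover have "card {t. poly r t = 0} \<le> d"
    using card_poly_roots_bound[OF r_nz] degree_r by simp
  ultimately show False by simp
qed

text \<open>Together with \<open>P_one\<close> this yields \<open>r_one\<close>. The residue of d
  log \<rho> over z = 1 is k or -k because there \<rho> has a zero of order k on one sheet and a
  pole of order k on the other.\<close>

lemma N_one: "poly q 1 * poly r 1 = - real k * poly T 1"
  using arg_cong[OF N_eq, of "\<lambda>f. poly f 1"] by (simp add: N_def)

lemma P_one: "(poly q 1)\<^sup>2 * poly p1 1 = (poly T 1)\<^sup>2"
  using P_poly[of 1] k by (simp add: poly_p0)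

sublocale hyperelliptic_data "real k" d x y p1 r t0
proof
  show "0 < real k" using k by simp
  show "x 0 = 0" by (rule x0)
  have "degree (pCons 0 p1) = 2 * k' - 1" "pCons 0 p1 \<noteq> 0"
    using deg_p0 p0_nz by (simp_all only: p0_eq[symmetric] not_False_eq_True)
  then show "degree p1 = 2 * d"
    by (auto simp: degree_pCons_eq_if split: if_splits)
  show "degree r = d" by (rule degree_r)
  show "poly r (x j) \<noteq> 0" if "j \<in> {1..2 * d}" for j
  proof
    assume "poly r (x j) = 0"
    then obtain l where "l \<in> {1..d}" "x j = y l" using r_only_roots by blast
    with y'[of l] p1_neg'[of l "x j"] p1_root'[OF that] show False by simp
  qed
  show "poly r z \<noteq> 0" if "t0 \<le> z" for z
  proof
    assume "poly r z = 0"
    then obtain l where l: "l \<in> {1..d}" "z = y l" using r_only_roots by blast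
    have "x (2 * l - 1) \<le> x 1"
    proof (cases "l = 1")
      case False
      then have "1 < 2 * l - 1" "2 * l - 1 \<le> 2 * d" using l by auto
      from x_anti[OF this] show ?thesis by simp
    qed simp
    with y'[OF l(1)] t0'(3) l that show False by auto
  qed
  have "(poly q 1)\<^sup>2 * (poly r 1)\<^sup>2 = (poly q 1)\<^sup>2 * ((real k)\<^sup>2 * poly p1 1)"
    using N_one P_one by algebra
  moreover have "poly q 1 \<noteq> 0" using P_one T(4) by auto
  ultimately show "(poly r 1)\<^sup>2 = (real k)\<^sup>2 * poly p1 1" by simp
qed (use x_anti y' p1_pos' p1_neg' p1_root' p1_simple' t0' in auto)

lemma p_eq: "p = p0"
  by (simp only: p_def p0_eq[symmetric])

end

subsection \<open>Orders of the zeros of the differential\<close>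

lemma has_field_derivative_cong_nhds:
  assumes "(f has_field_derivative D) (at t)" "\<forall>\<^sub>F s in nhds t. f s = g s"
  shows "(g has_field_derivative D) (at t)"
  using assms(1) DERIV_cong_ev[OF refl assms(2) refl] by simp

lemma curve_deriv:
  assumes S: "open S" "t \<in> S" and Z: "Z holomorphic_on S" and W: "W holomorphic_on S"
    and curve: "\<And>s. s \<in> S \<Longrightarrow> (W s)\<^sup>2 = poly f (Z s)"
  shows "2 * W t * deriv W t = poly (pderiv f) (Z t) * deriv Z t"
proof -
  have dZ: "(Z has_field_derivative deriv Z t) (at t)" and dW: "(W has_field_derivative deriv W t) (at t)"
    using holomorphic_derivI[OF _ S] Z W by auto
  have 1: "((\<lambda>s. (W s)\<^sup>2) has_field_derivative 2 * W t * deriv W t) (at t)"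
    using dW by (auto intro!: derivative_eq_intros simp: mult_ac)
  have 2: "((\<lambda>s. poly f (Z s)) has_field_derivative poly (pderiv f) (Z t) * deriv Z t) (at t)"
    using DERIV_chain2[OF poly_DERIV dZ] .
  have 3: "\<forall>\<^sub>F s in nhds t. (W s)\<^sup>2 = poly f (Z s)"
    using eventually_nhds_in_open[OF S] curve by (auto elim: eventually_mono)
  show ?thesis
    by (rule DERIV_unique[OF has_field_derivative_cong_nhds[OF 1 3] 2])
qed

text \<open>Writing V as t^m times a nonvanishing function gives the residue m of its logarithmic
  derivative; it serves to compute the residues of dF for an arbitrary local parameter.\<close>

lemma log_derivative_zero:
  assumes "R > 0" and V: "V holomorphic_on ball 0 R" "V 0 = 0"
    and nz: "\<exists>\<^sub>F t in at 0. V t \<noteq> (0::complex)"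
  obtains m :: nat where "m > 0" "((\<lambda>t. t * deriv V t / V t) \<longlongrightarrow> of_nat m) (at 0)"
    "\<forall>\<^sub>F t in at 0. V t \<noteq> 0"
proof -
  have "\<exists>w\<in>ball 0 R. V w \<noteq> 0"
  proof (rule ccontr)
    assume "\<not> ?thesis"
    then have "\<forall>\<^sub>F t in at 0. V t = 0"
      using eventually_at_ball[OF \<open>R > 0\<close>, of 0 UNIV] by (auto elim: eventually_mono)
    with nz show False
      by (simp add: frequently_def)
  qed
  have "0 \<in> ball (0::complex) R" using \<open>R > 0\<close> by simp
  from zorder_exist_zero[OF V(1) open_ball connected_ball this \<open>\<exists>w\<in>ball 0 R. V w \<noteq> 0\<close>] V(2)
  obtain r where m: "zorder V 0 > 0" and r: "r > 0" "zor_poly V 0 holomorphic_on cball 0 r"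
    and eq: "\<And>w. w \<in> cball 0 r \<Longrightarrow> V w = zor_poly V 0 w * w ^ nat (zorder V 0) \<and> zor_poly V 0 w \<noteq> 0"
    by auto
  define g where "g = zor_poly V 0"
  define m where "m = nat (zorder V 0)"
  have "m > 0" using m by (simp add: m_def)
  have gh: "g holomorphic_on ball 0 r"
    using r(2) by (auto simp: g_def elim: holomorphic_on_subset)
  have ev: "\<forall>\<^sub>F t in at 0. t \<in> ball 0 r - {0}"
    using eventually_at_ball'[OF r(1), of 0 UNIV] by (auto elim: eventually_mono)
  have dV: "deriv V t = deriv g t * t ^ m + g t * (of_nat m * t ^ (m - 1))" if t: "t \<in> ball 0 r" for t
  proof -
    have "((\<lambda>t. g t * t ^ m) has_field_derivative deriv g t * t ^ m + g t * (of_nat m * t ^ (m - 1))) (at t)"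
      using holomorphic_derivI[OF gh open_ball t] by (auto intro!: derivative_eq_intros)
    moreover have "\<forall>\<^sub>F s in nhds t. g s * s ^ m = V s"
      using eventually_nhds_in_open[OF open_ball t] eq by (auto simp: g_def m_def elim!: eventually_mono)
    ultimately show ?thesis
      by (rule DERIV_imp_deriv[OF has_field_derivative_cong_nhds])
  qed
  have "g \<midarrow>0\<rightarrow> g 0" "deriv g \<midarrow>0\<rightarrow> deriv g 0"
    using gh r(1) holomorphic_deriv[OF gh open_ball]
    by (meson centre_in_ball continuous_on_eq_continuous_at holomorphic_on_imp_continuous_on isContD open_ball)+
  moreover have "g 0 \<noteq> 0" using eq[of 0] r(1) by (simp add: g_def)
  ultimately have "((\<lambda>t. t * deriv g t / g t + of_nat m) \<longlongrightarrow> 0 * deriv g 0 / g 0 + of_nat m) (at 0)"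
    by (intro tendsto_intros)
  then have "((\<lambda>t. t * deriv V t / V t) \<longlongrightarrow> 0 * deriv g 0 / g 0 + of_nat m) (at 0)"
  proof (rule Lim_transform_eventually)
    show "\<forall>\<^sub>F t in at 0. t * deriv g t / g t + of_nat m = t * deriv V t / V t"
      using ev
    proof eventually_elim
      case (elim t)
      then have t: "t \<in> ball 0 r" "t \<noteq> 0" by auto
      have V: "V t = g t * t ^ m" "g t \<noteq> 0" using eq[of t] t by (auto simp: g_def m_def)
      have tm: "t ^ m = t * t ^ (m - 1)" using \<open>m > 0\<close> by (simp add: power_eq_if)
      show ?case
        unfolding dV[OF t(1)] V(1) tm using V(2) t(2) by (simp add: field_simps)
    qed
  qed
  moreover have "\<forall>\<^sub>F t in at 0. V t \<noteq> 0"
    using ev eq by (auto simp: g_def m_def elim!: eventually_mono)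
  ultimately show ?thesis
    using that[OF \<open>m > 0\<close>] by simp
qed

text \<open>The second part provides the power of t with a cofactor that has a limit, which later
  bounds the order from above.\<close>

lemma zorder_ge_two_iff:
  assumes "R > 0" and f: "f holomorphic_on ball 0 R"
    and nz: "\<exists>\<^sub>F t in at 0. f t \<noteq> (0::complex)"
  shows "zorder f 0 \<ge> 2 \<longleftrightarrow> f 0 = 0 \<and> deriv f 0 = 0"
    and "\<exists>g. g \<midarrow>0\<rightarrow> g 0 \<and> (\<forall>\<^sub>F t in at 0. f t = g t * t ^ nat (zorder f 0))"
proof -
  have "\<exists>w\<in>ball 0 R. f w \<noteq> 0"
  proof (rule ccontr)
    assume "\<not> ?thesis"
    then have "\<forall>\<^sub>F t in at 0. f t = 0"
      using eventually_at_ball[OF \<open>R > 0\<close>, of 0 UNIV] by (auto elim: eventually_mono)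
    with nz show False
      by (simp add: frequently_def)
  qed
  have "0 \<in> ball (0::complex) R" using \<open>R > 0\<close> by simp
  note E = zorder_exist_zero[OF f open_ball connected_ball this \<open>\<exists>w\<in>ball 0 R. f w \<noteq> 0\<close>]
  obtain r where r: "r > 0" "zor_poly f 0 holomorphic_on cball 0 r"
    and eq: "\<And>w. w \<in> cball 0 r \<Longrightarrow> f w = zor_poly f 0 w * w ^ nat (zorder f 0) \<and> zor_poly f 0 w \<noteq> 0"
    using conjunct2[OF E] by auto
  define g where "g = zor_poly f 0"
  define m where "m = nat (zorder f 0)"
  have gh: "g holomorphic_on ball 0 r"
    using r(2) by (auto simp: g_def elim: holomorphic_on_subset)
  have 0: "(0::complex) \<in> ball 0 r" using r(1) by simp
  have "((\<lambda>t. g t * t ^ m) has_field_derivative deriv g 0 * 0 ^ m + g 0 * (of_nat m * 0 ^ (m - 1))) (at 0)"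
    using holomorphic_derivI[OF gh open_ball 0] by (auto intro!: derivative_eq_intros)
  moreover have "\<forall>\<^sub>F s in nhds 0. g s * s ^ m = f s"
    using eventually_nhds_in_open[OF open_ball 0] eq by (auto simp: g_def m_def elim!: eventually_mono)
  ultimately have df: "deriv f 0 = deriv g 0 * 0 ^ m + g 0 * (of_nat m * 0 ^ (m - 1))"
    by (rule DERIV_imp_deriv[OF has_field_derivative_cong_nhds])
  have g0: "g 0 \<noteq> 0" and f0: "f 0 = g 0 * 0 ^ m" using eq[of 0] r(1) by (auto simp: g_def m_def)
  have "(m \<ge> 2) \<longleftrightarrow> f 0 = 0 \<and> deriv f 0 = 0"
  proof -
    consider "m = 0" | "m = 1" | "m \<ge> 2" by linarith
    then show ?thesis
      using g0 by cases (auto simp: f0 df power_0_left)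
  qed
  moreover have "m \<ge> 2 \<longleftrightarrow> zorder f 0 \<ge> 2"
    unfolding m_def by linarith
  ultimately show "zorder f 0 \<ge> 2 \<longleftrightarrow> f 0 = 0 \<and> deriv f 0 = 0"
    by simp
  have "g \<midarrow>0\<rightarrow> g 0"
    using gh 0 by (meson continuous_on_eq_continuous_at holomorphic_on_imp_continuous_on isContD open_ball)
  moreover have "\<forall>\<^sub>F t in at 0. f t = g t * t ^ m"
    using eventually_at_ball[OF r(1), of 0 UNIV] eq by (auto simp: g_def m_def elim!: eventually_mono)
  ultimately show "\<exists>g. g \<midarrow>0\<rightarrow> g 0 \<and> (\<forall>\<^sub>F t in at 0. f t = g t * t ^ nat (zorder f 0))"
    unfolding m_def by blast
qed

lemma zorder_simple_pole:
  assumes "R > 0" and f: "f holomorphic_on ball 0 R - {0}"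
    and lim: "((\<lambda>t. t * f t) \<longlongrightarrow> l) (at 0)" and nz: "l \<noteq> (0::complex)"
  shows "zorder f 0 = -1"
proof (rule zorder_eqI[where S = "ball 0 R" and g = "\<lambda>t. if t = 0 then l else t * f t"])
  show "(\<lambda>t. if t = 0 then l else t * f t) holomorphic_on ball 0 R"
    using f lim by (intro removable_singularity holomorphic_intros) auto
qed (use assms in \<open>auto simp: power_int_minus\<close>)

lemma cpoly_numeral: "cpoly (numeral n) = numeral n"
  by (simp add: numeral_poly)

section \<open>The tangency ordinate and the logarithmic differential of rho\<close>

context spectral_curve
begin

text \<open>At z = 1 the number \<eta> + 1 is 1 + p1'/p1 - 2 r'/r, which equals P'/P - 2 N'/N, the
  contributions of \<open>q\<close> cancelling. Since P'/P = 2 T'/T and N'/N = (k - 1) T' / (k T)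
  there, the result is P'/P divided by k.\<close>

lemma tangency: "snd (cmap 1) = tangency_ordinate k \<alpha> \<beta>"
proof -
  define t where "t = poly T 1"
  define t' where "t' = poly (pderiv T) 1"
  define u where "u = poly q 1"
  define u' where "u' = poly (pderiv q) 1"
  define v where "v = poly p1 1"
  define v' where "v' = poly (pderiv p1) 1"
  define s where "s = poly r 1"
  define s' where "s' = poly (pderiv r) 1"
  define a where "a = poly (pderiv P) 1"
  have e1: "u * s = - real k * t" using N_one by (simp add: u_def s_def t_def)
  have e2: "u\<^sup>2 * v = t\<^sup>2" using P_one by (simp add: u_def v_def t_def)
  have "poly (pderiv N) 1 = (1 - real k) * t'"
    unfolding N_def pderiv_diff pderiv_mult pderiv_smult by (simp add: pderiv_pCons t'_def algebra_simps)
  then have e3: "u' * s + u * s' = (1 - real k) * t'"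
    unfolding N_eq pderiv_mult by (simp add: u_def u'_def s_def s'_def algebra_simps)
  have "poly (pderiv ([:-1, 1:] ^ (2 * k))) (1::real) = 0"
    unfolding pderiv_power using k by simp
  then have e4: "a = 2 * t * t'"
    unfolding a_def P_eq pderiv_diff pderiv_smult power2_eq_square pderiv_mult
    by (simp add: t_def t'_def)
  have e5: "a = 2 * u * u' * v + u\<^sup>2 * (v + v')"
    unfolding a_def P_def pderiv_mult power2_eq_square
    by (simp add: poly_p0 poly_pderiv_p0 u_def u'_def v_def v'_def algebra_simps)
  have k0: "real k \<noteq> 0" using k by simp
  have nz: "t \<noteq> 0" "u \<noteq> 0" "v \<noteq> 0" "s \<noteq> 0"
    using T(4) e1 e2 k0 by (auto simp: t_def)
  \<comment> \<open>The factor u^3 clears the denominators that arise when the values of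
    \<open>r\<close> and \<open>p1\<close> are expressed through those of \<open>N\<close>,
    \<open>P\<close> and \<open>q\<close>.\<close>
  have "u\<^sup>2 * u * (real k * (s * (v + v') - 2 * s' * v) * t\<^sup>2) = u\<^sup>2 * u * (a * s * v)"
    using e1 e2 e3 e4 e5 by algebra
  then have main: "real k * (s * (v + v') - 2 * s' * v) * t\<^sup>2 = a * s * v"
    using nz by simp
  have P1: "poly P 1 = t\<^sup>2" using P_poly(1)[of 1] k by (simp add: t_def)
  have "snd (cmap 1) + 1 = (s * (v + v') - 2 * s' * v) / (s * v)"
    using nz by (simp add: cmap_def D1_one poly_E s_def[symmetric] s'_def[symmetric] v_def[symmetric] v'_def[symmetric] field_simps)
  also have "\<dots> = 1 / real k * (a / t\<^sup>2)"
    using main nz k0 by (simp add: field_simps)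
  finally show ?thesis
    using P1 by (simp add: tangency_ordinate_def factorization P_def[symmetric] a_def)
qed

abbreviation pc :: "real poly \<Rightarrow> complex \<Rightarrow> complex" where "pc f \<equiv> poly (cpoly f)"

abbreviation pc' :: "real poly \<Rightarrow> complex \<Rightarrow> complex" where "pc' f \<equiv> poly (pderiv (cpoly f))"

lemma cN: "(z - 1) * pc' T z - of_nat k * pc T z = pc q z * pc r z"
  using arg_cong[OF N_eq, of "\<lambda>f. pc f z"]
  by (simp add: N_def cpoly_diff cpoly_add cpoly_mult cpoly_smult cpoly_pderiv algebra_simps)

lemma cq_identity: "(z - 1) * (2 * pc' q z * pc p0 z + pc q z * pc' p0 z)
    - 2 * of_nat k * (pc q z * pc p0 z) = 2 * pc T z * pc r z"
proof -
  have "pc ([:-1, 1:] * (2 * pderiv q * p0 + q * pderiv p0) - smult (2 * real k) (q * p0)) z = pc (2 * T * r) z"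
    by (simp only: q_identity)
  then show ?thesis
    by (simp add: cpoly_diff cpoly_add cpoly_mult cpoly_smult cpoly_pderiv cpoly_numeral algebra_simps
        del: mult_pCons_left)
qed

lemma cP: "(pc T z)\<^sup>2 - 4 * (z - 1) ^ (2 * k) = (pc q z)\<^sup>2 * pc p0 z"
proof -
  have "pc (T\<^sup>2 - smult 4 ([:-1, 1:] ^ (2 * k))) z = pc (q\<^sup>2 * p0) z"
    by (simp only: P_eq[symmetric] P_def[symmetric])
  then show ?thesis
    by (simp add: cpoly_diff cpoly_mult cpoly_smult cpoly_power poly_power)
qed

lemma cp0: "pc p0 z = z * pc p1 z" "pc' p0 z = pc p1 z + z * pc' p1 z"
  by (subst p0_eq, simp) (subst p0_eq, simp add: pderiv_pCons)

lemma cr_one: "(pc r 1)\<^sup>2 = (of_nat k)\<^sup>2 * pc p0 1"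
proof -
  have "pc r 1 = of_real (poly r 1)" "pc p0 1 = of_real (poly p1 1)"
    using poly_cpoly_of_real[of r 1] poly_cpoly_of_real[of p0 1] by (auto simp: poly_p0)
  then show ?thesis
    using arg_cong[OF r_one, of complex_of_real] by simp
qed

definition dF :: "real \<Rightarrow> real \<Rightarrow> real \<Rightarrow> complex \<Rightarrow> complex \<Rightarrow> complex" where
  "dF A B C z w = of_real A / z + of_real B / (z - 1) + of_real C * pc r z / ((z - 1) * w)"

lemma dF_coeff_eq:
  assumes S: "open S" "t \<in> S" and Z: "Z holomorphic_on S" and W: "W holomorphic_on S"
    and curve: "\<And>s. s \<in> S \<Longrightarrow> (W s)\<^sup>2 = pc p0 (Z s)"
    and nz: "Z t \<noteq> 0" "Z t \<noteq> 1" "W t \<noteq> 0"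
  shows "dF_coeff k \<alpha> \<beta> q (chi, \<eta>) Z W t =
    deriv Z t * dF (real k / 4 * (\<eta> + 1)) (- (real k / 2)) (- (chi / 2)) (Z t) (W t)"
proof -
  define Y where "Y = (\<lambda>s. pc T (Z s) + pc q (Z s) * W s)"
  define V where "V = (\<lambda>s. (Z s - 1) ^ k)"
  have dZ: "(Z has_field_derivative deriv Z t) (at t)" and dW: "(W has_field_derivative deriv W t) (at t)"
    using holomorphic_derivI[OF _ S] Z W by auto
  have dcurve: "2 * W t * deriv W t = pc' p0 (Z t) * deriv Z t"
    by (rule curve_deriv[OF S Z W curve])
  define Y' where "Y' = pc' T (Z t) * deriv Z t + (pc' q (Z t) * deriv Z t * W t + pc q (Z t) * deriv W t)"
  have dY: "(Y has_field_derivative Y') (at t)"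
    unfolding Y_def Y'_def
    by (rule derivative_eq_intros DERIV_chain2[OF poly_DERIV dZ] dW refl | simp)+
  define V' where "V' = of_nat k * (Z t - 1) ^ (k - 1) * deriv Z t"
  have dV: "(V has_field_derivative V') (at t)"
    unfolding V_def V'_def using dZ by (auto intro!: derivative_eq_intros)
  have Vnz: "V t \<noteq> 0" using nz by (simp add: V_def)
  have V': "(Z t - 1) * V' = of_nat k * V t * deriv Z t"
    using k by (simp add: V'_def V_def power_eq_if)
  have "continuous_on S Z" using Z by (rule holomorphic_on_imp_continuous_on)
  then have "open (S \<inter> Z -` (- {0, 1}))"
    using S(1) by (intro continuous_open_preimage) auto
  then have "\<forall>\<^sub>F s in nhds t. s \<in> S \<inter> Z -` (- {0, 1})"
    using S nz by (intro eventually_nhds_in_open) auto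
  then have ev: "\<forall>\<^sub>F s in nhds t. rho k \<alpha> \<beta> q (Z s) (W s) = Y s / (2 * V s)"
    by eventually_elim (auto simp: rho_def trace_Phi Y_def V_def add_divide_distrib)
  have "((\<lambda>s. Y s / (2 * V s)) has_field_derivative (Y' * (2 * V t) - Y t * (2 * V')) / ((2 * V t) * (2 * V t))) (at t)"
    using Vnz by (intro DERIV_divide dY DERIV_cmult dV) auto
  then have drho: "deriv (\<lambda>s. rho k \<alpha> \<beta> q (Z s) (W s)) t = (Y' * (2 * V t) - Y t * (2 * V')) / ((2 * V t) * (2 * V t))"
    by (rule DERIV_imp_deriv[OF has_field_derivative_cong_nhds]) (use ev in eventually_elim, simp)
  have rho_t: "rho k \<alpha> \<beta> q (Z t) (W t) = Y t / (2 * V t)"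
    using ev by (rule eventually_nhds_x_imp_x)
  \<comment> \<open>The product over the two sheets is 4 (z - 1)^(2 k), so \<rho> has neither zeros
    nor poles away from z = 0 and z = 1.\<close>
  have "Y t * (pc T (Z t) - pc q (Z t) * W t) = (pc T (Z t))\<^sup>2 - (pc q (Z t))\<^sup>2 * (W t)\<^sup>2"
    by (simp add: Y_def power2_eq_square algebra_simps)
  also have "\<dots> = 4 * (Z t - 1) ^ (2 * k)"
    unfolding curve[OF S(2)] cP[symmetric] by simp
  finally have Ynz: "Y t \<noteq> 0" using nz by auto
  \<comment> \<open>After multiplication by w the terms containing a factor w match by
    \<open>cN\<close> and the remaining ones by \<open>cq_identity\<close>.\<close>
  have "2 * W t * (Y' * ((Z t - 1) * W t) - of_nat k * Y t * W t * deriv Z t) = 2 * W t * (deriv Z t * pc r (Z t) * Y t)"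
    using cN[of "Z t"] cq_identity[of "Z t"] curve[OF S(2)] dcurve unfolding Y'_def Y_def by algebra
  then have key: "Y' * ((Z t - 1) * W t) - of_nat k * Y t * W t * deriv Z t = deriv Z t * pc r (Z t) * Y t"
    using nz by simp
  have "(Y' * V t - Y t * V') * ((Z t - 1) * W t) = deriv Z t * pc r (Z t) * Y t * V t"
    using key V' by algebra
  then have "(Y' * V t - Y t * V') / (V t * Y t) = deriv Z t * pc r (Z t) / ((Z t - 1) * W t)"
    using Vnz Ynz nz by (simp add: frac_eq_eq mult_ac)
  moreover have "(Y' * (2 * V t) - Y t * (2 * V')) / ((2 * V t) * (2 * V t)) / (Y t / (2 * V t))
      = (Y' * V t - Y t * V') / (V t * Y t)"
    using Vnz Ynz by (simp add: divide_simps)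
  ultimately have log_rho: "(Y' * (2 * V t) - Y t * (2 * V')) / ((2 * V t) * (2 * V t)) / (Y t / (2 * V t))
      = deriv Z t * pc r (Z t) / ((Z t - 1) * W t)"
    by simp
  have gen: "a * (e / u) - b * (e / v) - c * (e * f / g) = e * (a / u + (- b) / v + (- c) * f / g)"
    for a b c e f g u v :: complex
    by (simp add: algebra_simps)
  show ?thesis
    unfolding dF_coeff_def prod.case drho rho_t dF_def log_rho of_real_minus by (rule gen)
qed

end

lemma product_double_zero:
  assumes "R > 0" and h: "h holomorphic_on ball 0 R" and u: "u holomorphic_on ball 0 R"
    and u0: "u 0 \<noteq> (0::complex)"
  shows "h 0 * u 0 = 0 \<and> deriv (\<lambda>t. h t * u t) 0 = 0 \<longleftrightarrow> h 0 = 0 \<and> deriv h 0 = 0"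
proof -
  have 0: "0 \<in> ball (0::complex) R" using assms by simp
  have "((\<lambda>t. h t * u t) has_field_derivative deriv h 0 * u 0 + deriv u 0 * h 0) (at 0)"
    using holomorphic_derivI[OF h open_ball 0] holomorphic_derivI[OF u open_ball 0]
    by (rule DERIV_mult)
  then have "deriv (\<lambda>t. h t * u t) 0 = deriv h 0 * u 0 + deriv u 0 * h 0"
    by (rule DERIV_imp_deriv)
  with u0 show ?thesis by auto
qed

lemma ball_in_preimage:
  assumes "R > 0" and f: "continuous_on (ball (0::complex) R) f" and g: "continuous_on (ball (0::complex) R) g"
    and "open S" "f 0 \<in> S" "open T" "g 0 \<in> T"
  obtains r where "r > 0" "r \<le> R" "\<And>t. t \<in> ball 0 r \<Longrightarrow> f t \<in> S" "\<And>t. t \<in> ball 0 r \<Longrightarrow> g t \<in> T"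
proof -
  have "open ((ball 0 R \<inter> f -` S) \<inter> (ball 0 R \<inter> g -` T))"
    using assms by (intro open_Int continuous_open_preimage) auto
  moreover have "0 \<in> (ball 0 R \<inter> f -` S) \<inter> (ball 0 R \<inter> g -` T)"
    using assms by simp
  ultimately obtain r where r: "r > 0" "ball 0 r \<subseteq> (ball 0 R \<inter> f -` S) \<inter> (ball 0 R \<inter> g -` T)"
    using openE by blast
  then have "ball 0 (min r R) \<subseteq> (ball 0 R \<inter> f -` S) \<inter> (ball 0 R \<inter> g -` T)"
    by auto
  with r(1) assms(1) show ?thesis
    by (intro that[of "min r R"]) auto
qed

context spectral_curve
begin

definition cL :: "real \<Rightarrow> real \<Rightarrow> complex \<Rightarrow> complex" where
  "cL A B z = of_real A * (z - 1) + of_real B * z"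

definition hh :: "real \<Rightarrow> real \<Rightarrow> real \<Rightarrow> complex \<Rightarrow> complex \<Rightarrow> complex" where
  "hh A B C z w = cL A B z * w + of_real C * z * pc r z"

lemma dF_hh:
  assumes "z \<noteq> 0" "z \<noteq> 1" "w \<noteq> 0"
  shows "dF A B C z w = hh A B C z w / (z * (z - 1) * w)"
proof -
  have "z - 1 \<noteq> 0" using assms by simp
  then show ?thesis
    unfolding dF_def hh_def cL_def using assms(1,3) by (simp add: divide_simps)
qed

lemma hh_deriv:
  assumes S: "open S" "t \<in> S" and Z: "Z holomorphic_on S" and W: "W holomorphic_on S"
  shows "deriv (\<lambda>t. hh A B C (Z t) (W t)) t =
    of_real (A + B) * deriv Z t * W t + cL A B (Z t) * deriv W t
      + of_real C * (pc r (Z t) + Z t * pc' r (Z t)) * deriv Z t"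
proof -
  have dZ: "(Z has_field_derivative deriv Z t) (at t)" and dW: "(W has_field_derivative deriv W t) (at t)"
    using holomorphic_derivI[OF _ S] Z W by auto
  show ?thesis
    unfolding hh_def cL_def
    by (rule DERIV_imp_deriv)
      (rule derivative_eq_intros DERIV_chain2[OF poly_DERIV dZ] dZ dW refl | simp add: algebra_simps)+
qed

lemma hh_holomorphic:
  "Z holomorphic_on S \<Longrightarrow> W holomorphic_on S \<Longrightarrow> (\<lambda>t. hh A B C (Z t) (W t)) holomorphic_on S"
  unfolding hh_def cL_def by (intro holomorphic_intros)

definition ctangent :: "real \<Rightarrow> real \<Rightarrow> real \<Rightarrow> complex \<Rightarrow> complex \<Rightarrow> bool" where
  "ctangent A B C z w \<longleftrightarrow> hh A B C z w = 0 \<and>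
     2 * of_real (A + B) * pc p0 z + cL A B z * pc' p0 z + 2 * w * of_real C * (pc r z + z * pc' r z) = 0"

text \<open>Where w is nonzero, z is a local coordinate, so dF is the numerator \<open>hh\<close>
  times a nonvanishing holomorphic function and its double zeros are those of
  \<open>hh\<close>.\<close>

lemma regular_order:
  fixes chi \<eta> :: real
  defines "A \<equiv> real k / 4 * (\<eta> + 1)" and "B \<equiv> - (real k / 2)" and "C \<equiv> - (chi / 2)"
  assumes lp: "local_param p0 (Affine z w) Z W" and nz: "z \<noteq> 0" "z \<noteq> 1" "w \<noteq> 0"
    and fr: "\<exists>\<^sub>F t in at 0. dF_coeff k \<alpha> \<beta> q (chi, \<eta>) Z W t \<noteq> 0"
  shows "zorder (dF_coeff k \<alpha> \<beta> q (chi, \<eta>) Z W) 0 \<ge> 2 \<longleftrightarrow> ctangent A B C z w"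
    and "\<exists>g. g \<midarrow>0\<rightarrow> g 0 \<and> (\<forall>\<^sub>F t in at 0. deriv Z t * hh A B C (Z t) (W t) / (Z t * (Z t - 1) * W t)
      = g t * t ^ nat (zorder (dF_coeff k \<alpha> \<beta> q (chi, \<eta>) Z W) 0))"
proof -
  obtain R0 where R0: "R0 > 0" "Z holomorphic_on ball 0 R0" "W holomorphic_on ball 0 R0"
    "inj_on (\<lambda>t. (Z t, W t)) (ball 0 R0)" "\<And>t. t \<in> ball 0 R0 \<Longrightarrow> (W t)\<^sup>2 = pc p0 (Z t)"
    and ZW0: "Z 0 = z" "W 0 = w"
    using lp by (auto simp: local_param_def)
  obtain R where R: "R > 0" "R \<le> R0" and ZR: "\<And>t. t \<in> ball 0 R \<Longrightarrow> Z t \<in> - {0, 1}"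
    and WR: "\<And>t. t \<in> ball 0 R \<Longrightarrow> W t \<in> ball w (norm w)"
    using nz ZW0 R0
    by (elim ball_in_preimage[of R0 Z W "- {0, 1}" "ball w (norm w)"])
      (auto intro: holomorphic_on_imp_continuous_on)
  have sub: "ball 0 R \<subseteq> ball 0 R0" using R by auto
  have Zh: "Z holomorphic_on ball 0 R" and Wh: "W holomorphic_on ball 0 R"
    using R0 sub holomorphic_on_subset by blast+
  have curve: "\<And>t. t \<in> ball 0 R \<Longrightarrow> (W t)\<^sup>2 = pc p0 (Z t)"
    using R0(5) sub by blast
  have Wnz: "W t \<noteq> 0" if "t \<in> ball 0 R" for t
    using WR[OF that] by (auto simp: dist_norm)
  have 0: "0 \<in> ball (0::complex) R" using R by simp
  \<comment> \<open>\<open>W\<close> stays in the ball of radius |w| about w, which contains no pair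
    of opposite numbers; hence \<open>Z\<close> determines \<open>W\<close>, and injectivity of the
    pair passes to \<open>Z\<close>.\<close>
  have "inj_on Z (ball 0 R)"
  proof (rule inj_onI)
    fix s t assume st: "s \<in> ball 0 R" "t \<in> ball 0 R" "Z s = Z t"
    then have "(W s)\<^sup>2 = (W t)\<^sup>2" using curve by simp
    then have "W s = W t \<or> W s = - W t" by (simp add: power2_eq_iff)
    moreover have "W s \<noteq> - W t"
    proof
      assume "W s = - W t"
      then have "2 * w = (w - W s) + (w - W t)" by simp
      then have "2 * norm w \<le> norm (w - W s) + norm (w - W t)"
        by (metis norm_mult norm_numeral norm_triangle_ineq)
      also have "\<dots> < norm w + norm w"
        using WR[OF st(1)] WR[OF st(2)] by (intro add_strict_mono) (simp_all add: dist_norm)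
      finally show False by simp
    qed
    ultimately have "(Z s, W s) = (Z t, W t)" using st by simp
    then show "s = t"
      using R0(4) st(1,2) sub unfolding inj_on_def by blast
  qed
  then have dZ0: "deriv Z 0 \<noteq> 0"
    using holomorphic_injective_imp_regular[OF Zh open_ball _ 0] by blast
  define u where "u = (\<lambda>t. deriv Z t / (Z t * (Z t - 1) * W t))"
  have uh: "u holomorphic_on ball 0 R"
    unfolding u_def using ZR Wnz by (intro holomorphic_intros Zh Wh) auto
  define h where "h = (\<lambda>t. hh A B C (Z t) (W t))"
  have hol: "h holomorphic_on ball 0 R"
    unfolding h_def by (intro hh_holomorphic Zh Wh)
  have eq: "dF_coeff k \<alpha> \<beta> q (chi, \<eta>) Z W t = h t * u t" if t: "t \<in> ball 0 R" for t
    using dF_coeff_eq[OF open_ball t Zh Wh curve, of chi \<eta>] ZR[OF t] Wnz[OF t]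
    by (simp add: dF_hh h_def u_def A_def B_def C_def)
  have ev: "\<forall>\<^sub>F t in at 0. dF_coeff k \<alpha> \<beta> q (chi, \<eta>) Z W t = h t * u t"
    using eventually_at_ball[OF R(1), of 0 UNIV] eq by (auto elim: eventually_mono)
  have zo: "zorder (dF_coeff k \<alpha> \<beta> q (chi, \<eta>) Z W) 0 = zorder (\<lambda>t. h t * u t) 0"
    by (rule zorder_cong[OF ev refl])
  have fr': "\<exists>\<^sub>F t in at 0. h t * u t \<noteq> 0"
    using fr by (rule frequently_rev_mp) (use ev in eventually_elim, simp)
  have hu: "(\<lambda>t. h t * u t) holomorphic_on ball 0 R" by (intro holomorphic_intros hol uh)
  note Z2 = zorder_ge_two_iff[OF R(1) hu fr']
  have u0: "u 0 \<noteq> 0" using dZ0 ZR[OF 0] Wnz[OF 0] by (simp add: u_def)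
  \<comment> \<open>Multiplying by 2 w allows the derivative of \<open>W\<close> to be replaced
    through the equation of the curve.\<close>
  have dh: "2 * w * deriv h 0 = deriv Z 0 *
      (2 * of_real (A + B) * pc p0 z + cL A B z * pc' p0 z + 2 * w * of_real C * (pc r z + z * pc' r z))"
    using hh_deriv[OF open_ball 0 Zh Wh, of A B C] curve_deriv[OF open_ball 0 Zh Wh curve] curve[OF 0]
    unfolding h_def ZW0 by algebra
  have "h 0 = 0 \<and> deriv h 0 = 0 \<longleftrightarrow> ctangent A B C z w"
    using dh nz dZ0 unfolding ctangent_def by (auto simp: h_def ZW0)
  then show "zorder (dF_coeff k \<alpha> \<beta> q (chi, \<eta>) Z W) 0 \<ge> 2 \<longleftrightarrow> ctangent A B C z w"
    using Z2(1) product_double_zero[OF R(1) hol uh u0] zo by simp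
  show "\<exists>g. g \<midarrow>0\<rightarrow> g 0 \<and> (\<forall>\<^sub>F t in at 0. deriv Z t * hh A B C (Z t) (W t) / (Z t * (Z t - 1) * W t)
      = g t * t ^ nat (zorder (dF_coeff k \<alpha> \<beta> q (chi, \<eta>) Z W) 0))"
    using Z2(2) unfolding zo by (simp add: h_def u_def mult_ac)
qed

lemma pc_of_real: "pc f (of_real t) = of_real (poly f t)" "pc' f (of_real t) = of_real (poly (pderiv f) t)"
  by (simp_all add: poly_cpoly_of_real flip: cpoly_pderiv)

text \<open>At a branch point w is a local coordinate and dz / w = 2 dw / p0'(z) is regular. Since
  the derivative of z vanishes there, the two conditions on \<open>hh\<close> separate into one on
  \<open>C\<close> and one on \<open>A\<close> and \<open>B\<close>.\<close>

lemma branch_order: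
  fixes chi \<eta> :: real
  defines "A \<equiv> real k / 4 * (\<eta> + 1)" and "B \<equiv> - (real k / 2)" and "C \<equiv> - (chi / 2)"
  assumes j: "j \<in> {1..2 * d}" and lp: "local_param p0 (Affine (of_real (x j)) 0) Z W"
    and fr: "\<exists>\<^sub>F t in at 0. dF_coeff k \<alpha> \<beta> q (chi, \<eta>) Z W t \<noteq> 0"
  shows "zorder (dF_coeff k \<alpha> \<beta> q (chi, \<eta>) Z W) 0 \<ge> 2 \<longleftrightarrow> C = 0 \<and> A * (x j - 1) + B * x j = 0"
proof -
  define \<xi> where "\<xi> = complex_of_real (x j)"
  have \<xi>: "\<xi> \<noteq> 0" "\<xi> \<noteq> 1" using x_neg[OF j] by (auto simp: \<xi>_def)
  have p0\<xi>: "pc p0 \<xi> = 0" "pc' p0 \<xi> \<noteq> 0"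
    using p1_root[OF j] p1_simple[OF j] x_neg[OF j]
    by (auto simp: \<xi>_def pc_of_real poly_p0 poly_pderiv_p0)
  obtain R0 where R0: "R0 > 0" "Z holomorphic_on ball 0 R0" "W holomorphic_on ball 0 R0"
    "inj_on (\<lambda>t. (Z t, W t)) (ball 0 R0)" "\<And>t. t \<in> ball 0 R0 \<Longrightarrow> (W t)\<^sup>2 = pc p0 (Z t)"
    and ZW0: "Z 0 = \<xi>" "W 0 = 0"
    using lp by (auto simp: local_param_def \<xi>_def)
  have "pc p0 holomorphic_on UNIV" by (intro holomorphic_intros)
  moreover have "deriv (pc p0) \<xi> \<noteq> 0"
    using p0\<xi>(2) DERIV_imp_deriv[OF poly_DERIV] by metis
  ultimately obtain \<delta> where \<delta>: "\<delta> > 0" "inj_on (pc p0) (ball \<xi> \<delta>)"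
    using has_complex_derivative_locally_injective[of "pc p0" UNIV \<xi>] by auto
  have "open {z. pc' p0 z \<noteq> 0}"
    by (intro open_Collect_neq continuous_intros)
  moreover have "open (- {0, 1 :: complex})"
    by (intro open_Compl finite_imp_closed) simp
  ultimately have "open (ball \<xi> \<delta> \<inter> - {0, 1} \<inter> {z. pc' p0 z \<noteq> 0})"
    by (intro open_Int open_ball)
  then obtain R where R: "R > 0" "R \<le> R0"
    and ZR: "\<And>t. t \<in> ball 0 R \<Longrightarrow> Z t \<in> ball \<xi> \<delta> \<inter> - {0, 1} \<inter> {z. pc' p0 z \<noteq> 0}"
    using \<xi> \<delta> p0\<xi> ZW0 R0
    by (elim ball_in_preimage[of R0 Z W "ball \<xi> \<delta> \<inter> - {0, 1} \<inter> {z. pc' p0 z \<noteq> 0}" UNIV])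
      (auto intro: holomorphic_on_imp_continuous_on)
  have sub: "ball 0 R \<subseteq> ball 0 R0" using R by auto
  have Zh: "Z holomorphic_on ball 0 R" and Wh: "W holomorphic_on ball 0 R"
    using R0 sub holomorphic_on_subset by blast+
  have curve: "\<And>t. t \<in> ball 0 R \<Longrightarrow> (W t)\<^sup>2 = pc p0 (Z t)"
    using R0(5) sub by blast
  have 0: "0 \<in> ball (0::complex) R" using R by simp
  have injW: "inj_on W (ball 0 R)"
  proof (rule inj_onI)
    fix s t assume st: "s \<in> ball 0 R" "t \<in> ball 0 R" "W s = W t"
    then have "pc p0 (Z s) = pc p0 (Z t)" using curve by metis
    then have "Z s = Z t" using \<delta>(2) ZR[OF st(1)] ZR[OF st(2)] by (auto simp: inj_on_def)
    with st have "(Z s, W s) = (Z t, W t)" by simp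
    then show "s = t"
      using R0(4) st(1,2) sub unfolding inj_on_def by blast
  qed
  then have dW0: "deriv W 0 \<noteq> 0"
    using holomorphic_injective_imp_regular[OF Wh open_ball _ 0] by blast
  have Wnz: "W t \<noteq> 0" if "t \<in> ball 0 R" "t \<noteq> 0" for t
    using injW that 0 ZW0 by (auto simp: inj_on_def)
  have dZ0: "deriv Z 0 = 0"
    using curve_deriv[OF open_ball 0 Zh Wh curve] ZW0 p0\<xi>(2) by simp
  \<comment> \<open>The quotient of the derivative of \<open>Z\<close> by \<open>W\<close> is
    rewritten with the curve equation, so that the factor is holomorphic and nonzero also at t =
    0.\<close>
  define u where "u = (\<lambda>t. 2 * deriv W t / (pc' p0 (Z t) * (Z t * (Z t - 1))))"
  have uh: "u holomorphic_on ball 0 R"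
    unfolding u_def using ZR by (intro holomorphic_intros Zh Wh) auto
  define h where "h = (\<lambda>t. hh A B C (Z t) (W t))"
  have hol: "h holomorphic_on ball 0 R"
    unfolding h_def by (intro hh_holomorphic Zh Wh)
  have eq: "dF_coeff k \<alpha> \<beta> q (chi, \<eta>) Z W t = h t * u t" if t: "t \<in> ball 0 R" "t \<noteq> 0" for t
  proof -
    have nz: "Z t \<noteq> 0" "Z t \<noteq> 1" "W t \<noteq> 0" "pc' p0 (Z t) \<noteq> 0"
      using ZR[OF t(1)] Wnz[OF t] by auto
    have "deriv Z t / W t = 2 * deriv W t / pc' p0 (Z t)"
      using curve_deriv[OF open_ball t(1) Zh Wh curve] nz by (simp add: field_simps)
    then have "deriv Z t / W t * (h t / (Z t * (Z t - 1))) = 2 * deriv W t / pc' p0 (Z t) * (h t / (Z t * (Z t - 1)))"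
      by simp
    moreover have "dF_coeff k \<alpha> \<beta> q (chi, \<eta>) Z W t = deriv Z t * (h t / (Z t * (Z t - 1) * W t))"
      using dF_coeff_eq[OF open_ball t(1) Zh Wh curve, of chi \<eta>] nz
      by (simp add: dF_hh h_def A_def B_def C_def)
    ultimately show ?thesis by (simp add: u_def mult_ac)
  qed
  have ev: "\<forall>\<^sub>F t in at 0. dF_coeff k \<alpha> \<beta> q (chi, \<eta>) Z W t = h t * u t"
    using eventually_at_ball'[OF R(1), of 0 UNIV] eq by (auto elim: eventually_mono)
  have zo: "zorder (dF_coeff k \<alpha> \<beta> q (chi, \<eta>) Z W) 0 = zorder (\<lambda>t. h t * u t) 0"
    by (rule zorder_cong[OF ev refl])
  have fr': "\<exists>\<^sub>F t in at 0. h t * u t \<noteq> 0"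
    using fr by (rule frequently_rev_mp) (use ev in eventually_elim, simp)
  have hu: "(\<lambda>t. h t * u t) holomorphic_on ball 0 R" by (intro holomorphic_intros hol uh)
  have u0: "u 0 \<noteq> 0" using dW0 ZR[OF 0] by (simp add: u_def)
  have h0: "h 0 = of_real (C * x j * poly r (x j))"
    by (simp add: h_def hh_def ZW0 \<xi>_def pc_of_real)
  have h1: "deriv h 0 = of_real (A * (x j - 1) + B * x j) * deriv W 0"
    using hh_deriv[OF open_ball 0 Zh Wh, of A B C] unfolding h_def dZ0 ZW0
    by (simp add: cL_def \<xi>_def)
  have "h 0 = 0 \<longleftrightarrow> C = 0" "deriv h 0 = 0 \<longleftrightarrow> A * (x j - 1) + B * x j = 0"
    unfolding h0 h1 of_real_eq_0_iff mult_eq_0_iff using x_neg[OF j] r_x[OF j] dW0 by auto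
  then show ?thesis
    using zorder_ge_two_iff(1)[OF R(1) hu fr'] product_double_zero[OF R(1) hol uh u0] zo by simp
qed

lemma ctangent_of_real:
  assumes "w \<noteq> 0" "w\<^sup>2 = poly p0 z"
  shows "ctangent A B C (of_real z) (of_real w) \<longleftrightarrow> tangent A B C z w"
proof -
  have 1: "hh A B C (of_real z) (of_real w) = of_real ((A * (z - 1) + B * z) * w + C * z * poly r z)"
    by (simp add: hh_def cL_def pc_of_real)
  have 2: "2 * of_real (A + B) * pc p0 (of_real z) + cL A B (of_real z) * pc' p0 (of_real z)
      + 2 * of_real w * of_real C * (pc r (of_real z) + of_real z * pc' r (of_real z)) =
    of_real (2 * (A + B) * poly p0 z + (A * (z - 1) + B * z) * poly (pderiv p0) z
      + 2 * w * C * (poly r z + z * poly (pderiv r) z))"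
    by (simp add: cL_def pc_of_real)
  show ?thesis
    unfolding ctangent_def tangent_def 1 2 of_real_eq_0_iff p_eq using assms by simp
qed

end

subsection \<open>The poles of the differential\<close>

text \<open>Limits of terms containing w are obtained from their squares, which are rational in
  z.\<close>

lemma tendsto_zero_power2_cancel:
  fixes f :: "'a \<Rightarrow> 'b::real_normed_div_algebra"
  assumes "((\<lambda>t. (f t)\<^sup>2) \<longlongrightarrow> 0) F"
  shows "(f \<longlongrightarrow> 0) F"
proof -
  have "((\<lambda>t. sqrt (norm ((f t)\<^sup>2))) \<longlongrightarrow> sqrt (norm (0::'b))) F"
    by (intro tendsto_intros assms)
  then show ?thesis
    by (simp add: norm_power tendsto_norm_zero_iff)
qed

text \<open>If \<open>Z\<close> were constant near 0, \<open>W\<close> could take at most two values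
  on infinitely many points.\<close>

lemma inj_curve_nonconstant:
  fixes W :: "complex \<Rightarrow> complex"
  assumes "R > 0" "inj_on (\<lambda>t. (Z t, W t)) (ball 0 R)"
    and "\<And>t. t \<in> ball 0 R \<Longrightarrow> (W t)\<^sup>2 = f (Z t)"
  shows "\<exists>\<^sub>F t in at 0. Z t - a \<noteq> (0::complex)"
proof (rule ccontr)
  assume "\<not> ?thesis"
  then have "\<forall>\<^sub>F t in at 0. Z t = a"
    by (simp add: not_frequently)
  then obtain e where e: "e > 0" "\<And>t. t \<noteq> 0 \<Longrightarrow> dist t 0 < e \<Longrightarrow> Z t = a"
    unfolding eventually_at by auto
  define s where "s = (\<lambda>n::nat. complex_of_real (min e R / (real n + 2)))"
  have pos: "min e R > 0" using e assms(1) by simp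
  have s: "s n \<noteq> 0" "norm (s n) < e" "s n \<in> ball 0 R" for n
  proof -
    have "min e R * 1 < min e R * (real n + 2)"
      by (intro mult_strict_left_mono pos) simp
    then have "min e R / (real n + 2) < min e R"
      by (subst pos_divide_less_eq) simp_all
    then show "s n \<noteq> 0" "norm (s n) < e" "s n \<in> ball 0 R"
      using pos by (auto simp: s_def simp del: of_real_divide)
  qed
  have "W (s n) \<in> {u. u\<^sup>2 = f a}" for n
    using assms(3)[OF s(3)[of n]] e(2)[of "s n"] s[of n] by simp
  then have "range (\<lambda>n. W (s n)) \<subseteq> {u. u\<^sup>2 = f a}" by blast
  moreover have "finite {u. u\<^sup>2 = f a}"
  proof (rule finite_subset)
    show "{u. u\<^sup>2 = f a} \<subseteq> {csqrt (f a), - csqrt (f a)}"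
    proof
      fix u assume "u \<in> {u. u\<^sup>2 = f a}"
      then have "u\<^sup>2 = (csqrt (f a))\<^sup>2" by simp
      then show "u \<in> {csqrt (f a), - csqrt (f a)}"
        unfolding power2_eq_iff by simp
    qed
  qed simp
  ultimately have "finite (range (\<lambda>n. W (s n)))" using finite_subset by blast
  moreover have "inj (\<lambda>n. W (s n))"
  proof (rule injI)
    fix m n assume "W (s m) = W (s n)"
    then have "(Z (s m), W (s m)) = (Z (s n), W (s n))"
      using e(2)[of "s m"] e(2)[of "s n"] s by simp
    then have "s m = s n"
      using assms(2) s(3) unfolding inj_on_def by blast
    then show "m = n" using pos by (simp add: s_def)
  qed
  ultimately show False using finite_imageD infinite_UNIV_nat by blast
qed

context spectral_curve
begin

text \<open>The limit is the residue of dF; if it is nonzero, the point is a simple pole and cannot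
  be critical.\<close>

lemma pole_order:
  fixes chi \<eta> :: real
  defines "A \<equiv> real k / 4 * (\<eta> + 1)" and "B \<equiv> - (real k / 2)" and "C \<equiv> - (chi / 2)"
  assumes R: "R > 0" and Zh: "Z holomorphic_on ball 0 R - {0}" and Wh: "W holomorphic_on ball 0 R - {0}"
    and curve: "\<And>t. t \<in> ball 0 R - {0} \<Longrightarrow> (W t)\<^sup>2 = pc p0 (Z t)"
    and nz: "\<forall>\<^sub>F t in at 0. Z t \<noteq> 0 \<and> Z t \<noteq> 1 \<and> W t \<noteq> 0"
    and lim: "((\<lambda>t. t * (deriv Z t * dF A B C (Z t) (W t))) \<longlongrightarrow> l) (at 0)" and l: "l \<noteq> 0"
  shows "zorder (dF_coeff k \<alpha> \<beta> q (chi, \<eta>) Z W) 0 = -1"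
proof -
  obtain e where e: "e > 0" "\<And>t. t \<noteq> 0 \<Longrightarrow> dist t 0 < e \<Longrightarrow> Z t \<noteq> 0 \<and> Z t \<noteq> 1 \<and> W t \<noteq> 0"
    using nz unfolding eventually_at by auto
  define S where "S = ball 0 (min e R) - {0 :: complex}"
  have S: "open S" "S \<subseteq> ball 0 R - {0}" by (auto simp: S_def)
  have Zh': "Z holomorphic_on S" and Wh': "W holomorphic_on S"
    using Zh Wh S holomorphic_on_subset by blast+
  have nzS: "Z t \<noteq> 0 \<and> Z t \<noteq> 1 \<and> W t \<noteq> 0" if "t \<in> S" for t
    using e(2)[of t] that by (auto simp: S_def)
  have eq: "dF_coeff k \<alpha> \<beta> q (chi, \<eta>) Z W t = deriv Z t * dF A B C (Z t) (W t)" if "t \<in> S" for t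
    unfolding A_def B_def C_def
    using nzS[OF that] by (intro dF_coeff_eq[OF S(1) that Zh' Wh'] curve) (use S(2) in auto)
  have "(\<lambda>t. deriv Z t * dF A B C (Z t) (W t)) holomorphic_on S"
    unfolding dF_def using nzS by (intro holomorphic_intros Zh' Wh' S(1)) auto
  then have "zorder (\<lambda>t. deriv Z t * dF A B C (Z t) (W t)) 0 = -1"
    using e(1) R lim l by (intro zorder_simple_pole[of "min e R"]) (auto simp: S_def)
  moreover have ev: "\<forall>\<^sub>F t in at 0. dF_coeff k \<alpha> \<beta> q (chi, \<eta>) Z W t = deriv Z t * dF A B C (Z t) (W t)"
  proof -
    have "\<forall>\<^sub>F t in at 0. t \<in> S"
      using eventually_at_ball'[of "min e R" 0 UNIV] e(1) R by (auto simp: S_def elim: eventually_mono)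
    then show ?thesis by eventually_elim (rule eq)
  qed
  ultimately show ?thesis
    by (simp only: zorder_cong[OF ev refl])
qed

text \<open>The residue is m (B + C r(1) / w) with m the multiplicity of \<open>Z - 1\<close>.
  Squaring eliminates w, and by \<open>cr_one\<close> it vanishes only for chi^2 = 1.\<close>

lemma not_critical_one:
  assumes chi: "\<bar>chi\<bar> < 1" and w: "w\<^sup>2 = pc p0 1"
  shows "\<not> critical_point k \<alpha> \<beta> q p0 (chi, \<eta>) (Affine 1 w) n"
proof
  assume "critical_point k \<alpha> \<beta> q p0 (chi, \<eta>) (Affine 1 w) n"
  then obtain Z W where lp: "local_param p0 (Affine 1 w) Z W" and n: "n \<ge> 1"
    and zo: "zorder (dF_coeff k \<alpha> \<beta> q (chi, \<eta>) Z W) 0 = int n"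
    by (auto simp: critical_point_def)
  obtain R where R: "R > 0" "Z holomorphic_on ball 0 R" "W holomorphic_on ball 0 R"
    "inj_on (\<lambda>t. (Z t, W t)) (ball 0 R)" "\<And>t. t \<in> ball 0 R \<Longrightarrow> (W t)\<^sup>2 = pc p0 (Z t)"
    and ZW0: "Z 0 = 1" "W 0 = w"
    using lp by (auto simp: local_param_def)
  define A where "A = real k / 4 * (\<eta> + 1)"
  define B where "B = - (real k / 2)"
  define C where "C = - (chi / 2)"
  have cont: "Z \<midarrow>0\<rightarrow> 1" "W \<midarrow>0\<rightarrow> w"
    using R(1-3) ZW0 by (metis centre_in_ball continuous_on_eq_continuous_at holomorphic_on_imp_continuous_on isContD open_ball)+
  have p01: "pc p0 1 \<noteq> 0"
    using pc_of_real(1)[of p0 1] p1_pos[of 1] by (simp add: poly_p0)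
  have w0: "w \<noteq> 0" using w p01 by auto
  obtain m where m: "m > 0" "((\<lambda>t. t * deriv (\<lambda>t. Z t - 1) t / (Z t - 1)) \<longlongrightarrow> of_nat m) (at 0)"
    and Znz: "\<forall>\<^sub>F t in at 0. Z t - 1 \<noteq> 0"
  proof -
    have "(\<lambda>t. Z t - 1) holomorphic_on ball 0 R" "Z 0 - 1 = 0"
      using R(2) ZW0 by (auto intro!: holomorphic_intros)
    from log_derivative_zero[OF R(1) this inj_curve_nonconstant[OF R(1,4,5)]] show ?thesis
      using that by blast
  qed
  have ev: "\<forall>\<^sub>F t in at 0. t \<in> ball 0 R - {0}"
    using eventually_at_ball'[OF R(1), of 0 UNIV] by simp
  have nz: "\<forall>\<^sub>F t in at 0. Z t \<noteq> 0 \<and> Z t \<noteq> 1 \<and> W t \<noteq> 0"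
    using Znz tendsto_imp_eventually_ne[OF cont(1) one_neq_zero] tendsto_imp_eventually_ne[OF cont(2) w0]
    by eventually_elim auto
  have "((\<lambda>t. t * deriv (\<lambda>t. Z t - 1) t / (Z t - 1) *
      (of_real A * (Z t - 1) / Z t + of_real B + of_real C * pc r (Z t) / W t))
      \<longlongrightarrow> of_nat m * (of_real A * (1 - 1) / 1 + of_real B + of_real C * pc r 1 / w)) (at 0)"
    by (intro tendsto_intros m cont w0 isCont_tendsto_compose[OF _ cont(1)]) auto
  then have "((\<lambda>t. t * (deriv Z t * dF A B C (Z t) (W t)))
      \<longlongrightarrow> of_nat m * (of_real A * (1 - 1) / 1 + of_real B + of_real C * pc r 1 / w)) (at 0)"
  proof (rule Lim_transform_eventually)
    show "\<forall>\<^sub>F t in at 0. t * deriv (\<lambda>t. Z t - 1) t / (Z t - 1) *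
      (of_real A * (Z t - 1) / Z t + of_real B + of_real C * pc r (Z t) / W t)
      = t * (deriv Z t * dF A B C (Z t) (W t))"
      using nz ev
    proof eventually_elim
      case (elim t)
      have "deriv (\<lambda>t. Z t - 1) t = deriv Z t"
        using elim holomorphic_on_imp_differentiable_at[OF R(2) open_ball, of t] by simp
      moreover have "dF A B C (Z t) (W t) = (of_real A * (Z t - 1) / Z t + of_real B + of_real C * pc r (Z t) / W t) / (Z t - 1)"
        using elim unfolding dF_def by (simp add: add_divide_distrib mult_ac)
      ultimately show ?case by simp
    qed
  qed
  moreover have "of_nat m * (of_real A * (1 - 1) / 1 + of_real B + of_real C * pc r 1 / w) \<noteq> 0"
  proof
    assume "of_nat m * (of_real A * (1 - 1) / 1 + of_real B + of_real C * pc r 1 / w) = 0"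
    then have "of_real B + of_real C * pc r 1 / w = 0"
      using m(1) by simp
    then have "of_real C * pc r 1 = - of_real B * w"
      using w0 by (simp add: field_simps eq_neg_iff_add_eq_0)
    then have "(of_real C)\<^sup>2 * (pc r 1)\<^sup>2 = (of_real B)\<^sup>2 * w\<^sup>2"
      by algebra
    then have "((of_real C)\<^sup>2 * (of_nat k)\<^sup>2 - (of_real B)\<^sup>2) * pc p0 1 = 0"
      unfolding w cr_one by (simp add: algebra_simps)
    then have "complex_of_real (C\<^sup>2 * (real k)\<^sup>2 - B\<^sup>2) = 0"
      using p01 by simp
    then have "C\<^sup>2 * (real k)\<^sup>2 - B\<^sup>2 = 0"
      unfolding of_real_eq_0_iff .
    then have "chi\<^sup>2 = 1" using k by (simp add: B_def C_def field_simps power2_eq_square)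
    with chi show False by (auto simp: power2_eq_1_iff)
  qed
  ultimately have "zorder (dF_coeff k \<alpha> \<beta> q (chi, \<eta>) Z W) 0 = -1"
    using R nz unfolding A_def B_def C_def
    by (intro pole_order[OF R(1)]) (auto intro: holomorphic_on_subset)
  with zo show False by simp
qed

text \<open>The residue is m A, where A = k (\<eta> + 1) / 4. The term with \<open>C\<close>
  contributes nothing, because the square of r z / ((z - 1) w) is r^2 z / ((z - 1)^2 p1).\<close>

lemma not_critical_zero:
  assumes \<eta>: "\<bar>\<eta>\<bar> < 1" and w: "w\<^sup>2 = pc p0 0"
  shows "\<not> critical_point k \<alpha> \<beta> q p0 (chi, \<eta>) (Affine 0 w) n"
proof
  assume "critical_point k \<alpha> \<beta> q p0 (chi, \<eta>) (Affine 0 w) n"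
  then obtain Z W where lp: "local_param p0 (Affine 0 w) Z W" and n: "n \<ge> 1"
    and zo: "zorder (dF_coeff k \<alpha> \<beta> q (chi, \<eta>) Z W) 0 = int n"
    by (auto simp: critical_point_def)
  obtain R where R: "R > 0" "Z holomorphic_on ball 0 R" "W holomorphic_on ball 0 R"
    "inj_on (\<lambda>t. (Z t, W t)) (ball 0 R)" "\<And>t. t \<in> ball 0 R \<Longrightarrow> (W t)\<^sup>2 = pc p0 (Z t)"
    and ZW0: "Z 0 = 0" "W 0 = w"
    using lp by (auto simp: local_param_def)
  define A where "A = real k / 4 * (\<eta> + 1)"
  define B where "B = - (real k / 2)"
  define C where "C = - (chi / 2)"
  have cont: "Z \<midarrow>0\<rightarrow> 0"
    using R(1,2) ZW0 by (metis centre_in_ball continuous_on_eq_continuous_at holomorphic_on_imp_continuous_on isContD open_ball)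
  have p10: "pc p1 0 \<noteq> 0"
    using pc_of_real(1)[of p1 0] p1_pos[of 0] by simp
  obtain m where m: "m > 0" "((\<lambda>t. t * deriv Z t / Z t) \<longlongrightarrow> of_nat m) (at 0)"
    and Znz: "\<forall>\<^sub>F t in at 0. Z t \<noteq> 0"
  proof -
    have "\<exists>\<^sub>F t in at 0. Z t \<noteq> 0"
      using inj_curve_nonconstant[OF R(1,4,5), of 0] by simp
    from log_derivative_zero[OF R(1,2) ZW0(1) this] show ?thesis
      using that by blast
  qed
  have ev: "\<forall>\<^sub>F t in at 0. t \<in> ball 0 R - {0}"
    using eventually_at_ball'[OF R(1), of 0 UNIV] by simp
  have contp1: "((\<lambda>t. pc p1 (Z t)) \<longlongrightarrow> pc p1 0) (at 0)" and contr: "((\<lambda>t. pc r (Z t)) \<longlongrightarrow> pc r 0) (at 0)"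
    by (intro isCont_tendsto_compose[OF _ cont]; simp)+
  have W2: "\<forall>\<^sub>F t in at 0. (W t)\<^sup>2 = Z t * pc p1 (Z t)"
    using ev by eventually_elim (simp add: R(5) cp0)
  have nz: "\<forall>\<^sub>F t in at 0. Z t \<noteq> 0 \<and> Z t \<noteq> 1 \<and> W t \<noteq> 0"
    using Znz tendsto_imp_eventually_ne[OF cont zero_neq_one] tendsto_imp_eventually_ne[OF contp1 p10] W2
    by eventually_elim auto
  have "((\<lambda>t. (pc r (Z t))\<^sup>2 * Z t / ((Z t - 1)\<^sup>2 * pc p1 (Z t))) \<longlongrightarrow> (pc r 0)\<^sup>2 * 0 / ((0 - 1)\<^sup>2 * pc p1 0)) (at 0)"
    using p10 by (intro tendsto_intros cont contp1 contr) auto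
  then have "((\<lambda>t. (pc r (Z t) * Z t / ((Z t - 1) * W t))\<^sup>2) \<longlongrightarrow> (pc r 0)\<^sup>2 * 0 / ((0 - 1)\<^sup>2 * pc p1 0)) (at 0)"
  proof (rule Lim_transform_eventually)
    show "\<forall>\<^sub>F t in at 0. (pc r (Z t))\<^sup>2 * Z t / ((Z t - 1)\<^sup>2 * pc p1 (Z t)) = (pc r (Z t) * Z t / ((Z t - 1) * W t))\<^sup>2"
      using nz W2 by eventually_elim (simp add: power_divide power_mult_distrib, simp add: power2_eq_square mult_ac)
  qed
  also have "(pc r 0)\<^sup>2 * 0 / ((0 - 1)\<^sup>2 * pc p1 0) = 0" by simp
  finally have X0: "((\<lambda>t. pc r (Z t) * Z t / ((Z t - 1) * W t)) \<longlongrightarrow> 0) (at 0)"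
    by (rule tendsto_zero_power2_cancel)
  have "((\<lambda>t. t * deriv Z t / Z t * (of_real A + of_real B * Z t / (Z t - 1) + of_real C * (pc r (Z t) * Z t / ((Z t - 1) * W t))))
      \<longlongrightarrow> of_nat m * (of_real A + of_real B * 0 / (0 - 1) + of_real C * 0)) (at 0)"
    by (intro tendsto_intros m cont X0) auto
  then have "((\<lambda>t. t * (deriv Z t * dF A B C (Z t) (W t)))
      \<longlongrightarrow> of_nat m * (of_real A + of_real B * 0 / (0 - 1) + of_real C * 0)) (at 0)"
  proof (rule Lim_transform_eventually)
    show "\<forall>\<^sub>F t in at 0. t * deriv Z t / Z t * (of_real A + of_real B * Z t / (Z t - 1) + of_real C * (pc r (Z t) * Z t / ((Z t - 1) * W t)))
      = t * (deriv Z t * dF A B C (Z t) (W t))"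
      using nz
    proof eventually_elim
      case (elim t)
      have "dF A B C (Z t) (W t) = (of_real A + of_real B * Z t / (Z t - 1) + of_real C * (pc r (Z t) * Z t / ((Z t - 1) * W t))) / Z t"
        using elim unfolding dF_def by (simp add: add_divide_distrib mult_ac)
      then show ?case by simp
    qed
  qed
  moreover have "of_nat m * (of_real A + of_real B * 0 / (0 - 1) + of_real C * 0) \<noteq> (0::complex)"
    using m(1) \<eta> k by (simp add: A_def complex_eq_iff)
  ultimately have "zorder (dF_coeff k \<alpha> \<beta> q (chi, \<eta>) Z W) 0 = -1"
    using R nz unfolding A_def B_def C_def
    by (intro pole_order[OF R(1)]) (auto intro: holomorphic_on_subset)
  with zo show False by simp
qed

text \<open>With m the order of the zero of 1 / Z, the residue is -m (A + B), and A + B = k (\<eta>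
  - 1) / 4. The square of the term with \<open>C\<close> is, up to a constant, a quotient of
  polynomials of degrees 2 d + 2 and 2 d + 3.\<close>

lemma not_critical_Infty:
  assumes \<eta>: "\<bar>\<eta>\<bar> < 1"
  shows "\<not> critical_point k \<alpha> \<beta> q p0 (chi, \<eta>) Infty n"
proof
  assume "critical_point k \<alpha> \<beta> q p0 (chi, \<eta>) Infty n"
  then obtain Z W where lp: "local_param p0 Infty Z W" and n: "n \<ge> 1"
    and zo: "zorder (dF_coeff k \<alpha> \<beta> q (chi, \<eta>) Z W) 0 = int n"
    by (auto simp: critical_point_def)
  obtain R0 where R0: "R0 > 0" "Z holomorphic_on ball 0 R0 - {0}" "W holomorphic_on ball 0 R0 - {0}"
    "\<And>t. t \<in> ball 0 R0 - {0} \<Longrightarrow> (W t)\<^sup>2 = pc p0 (Z t)"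
    and pole: "is_pole Z 0"
    using lp by (auto simp: local_param_def)
  define A where "A = real k / 4 * (\<eta> + 1)"
  define B where "B = - (real k / 2)"
  define C where "C = - (chi / 2)"
  have Zinf: "filterlim Z at_infinity (at 0)" using pole by (simp add: is_pole_def)
  define V where "V = (\<lambda>t. if t = 0 then 0 else inverse (Z t))"
  have "\<forall>\<^sub>F z in at_infinity. pc p0 z \<noteq> 0 \<and> z \<noteq> 0 \<and> z \<noteq> 1"
  proof -
    have "cpoly p0 \<noteq> 0" using p0_nz by (simp add: map_poly_eq_0_iff)
    then have "finite ({z. pc p0 z = 0} \<union> {0, 1})" by (simp add: poly_roots_finite)
    then have "bounded ({z. pc p0 z = 0} \<union> {0, 1})" by (rule finite_imp_bounded)
    then obtain b where "\<forall>z\<in>{z. pc p0 z = 0} \<union> {0, 1}. norm z \<le> b"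
      unfolding bounded_iff by blast
    then show ?thesis
      unfolding eventually_at_infinity by (intro exI[of _ "b + 1"]) force
  qed
  then have "\<forall>\<^sub>F t in at 0. pc p0 (Z t) \<noteq> 0 \<and> Z t \<noteq> 0 \<and> Z t \<noteq> 1"
    using Zinf by (rule eventually_compose_filterlim)
  moreover have ev0: "\<forall>\<^sub>F t in at 0. t \<in> ball 0 R0 - {0}"
    using eventually_at_ball'[OF R0(1), of 0 UNIV] by simp
  ultimately have nz: "\<forall>\<^sub>F t in at 0. Z t \<noteq> 0 \<and> Z t \<noteq> 1 \<and> W t \<noteq> 0"
    by eventually_elim (metis R0(4) zero_power2)
  obtain e where e: "e > 0" "\<And>t. t \<noteq> 0 \<Longrightarrow> dist t 0 < e \<Longrightarrow> Z t \<noteq> 0 \<and> Z t \<noteq> 1 \<and> W t \<noteq> 0"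
    using nz unfolding eventually_at by auto
  define R where "R = min e R0"
  have R: "R > 0" and RZ: "Z holomorphic_on ball 0 R - {0}"
    using e(1) R0 by (auto simp: R_def intro: holomorphic_on_subset)
  have Vh: "V holomorphic_on ball 0 R"
    unfolding V_def using e(2) RZ pole
    by (intro is_pole_inverse_holomorphic[OF open_ball]) (auto simp: R_def)
  have evR: "\<forall>\<^sub>F t in at 0. t \<in> ball 0 R - {0}"
    using eventually_at_ball'[OF R, of 0 UNIV] by simp
  have "\<forall>\<^sub>F t in at 0. V t \<noteq> 0"
    using nz evR by eventually_elim (simp add: V_def)
  then have "\<exists>\<^sub>F t in at 0. V t \<noteq> 0"
    by (rule eventually_frequently[rotated]) simp
  then obtain m where m: "m > 0" "((\<lambda>t. t * deriv V t / V t) \<longlongrightarrow> of_nat m) (at 0)"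
    using log_derivative_zero[OF R Vh] by (auto simp: V_def)
  have dlog: "deriv V t / V t = - (deriv Z t / Z t)" if t: "t \<in> ball 0 R - {0}" for t
  proof -
    have Znz: "Z t \<noteq> 0" using e(2)[of t] t by (auto simp: R_def)
    have op: "open (ball 0 R - {0::complex})" by auto
    have "((\<lambda>t. inverse (Z t)) has_field_derivative - (inverse (Z t) * deriv Z t * inverse (Z t))) (at t)"
      using holomorphic_derivI[OF RZ op t] Znz by (intro DERIV_inverse') auto
    moreover have "\<forall>\<^sub>F s in nhds t. inverse (Z s) = V s"
      using eventually_nhds_in_open[OF op t] by eventually_elim (auto simp: V_def)
    ultimately have "deriv V t = - (inverse (Z t) * deriv Z t * inverse (Z t))"
      by (rule DERIV_imp_deriv[OF has_field_derivative_cong_nhds])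
    with t Znz show ?thesis by (simp add: V_def divide_inverse)
  qed
  have X0: "((\<lambda>t. pc r (Z t) * Z t / ((Z t - 1) * W t)) \<longlongrightarrow> 0) (at 0)"
  proof -
    define a where "a = [:0, 1:]\<^sup>2 * (cpoly r)\<^sup>2"
    define b where "b = [:-1, 1:]\<^sup>2 * cpoly p0"
    have r_nz: "r \<noteq> 0" using N_eq degree_N by auto
    have "degree (cpoly r) = d" "degree (cpoly p0) = 2 * k' - 1" "cpoly r \<noteq> 0" "cpoly p0 \<noteq> 0"
      using degree_r deg_p0 r_nz p0_nz by (auto simp: map_poly_eq_0_iff degree_map_poly)
    then have "degree b > degree a"
      using k' by (simp add: a_def b_def degree_mult_eq degree_power_eq)
    then have "((\<lambda>z. poly a z / poly b z) \<longlongrightarrow> 0) at_infinity"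
      by (rule poly_divide_tendsto_0_at_infinity)
    then have "((\<lambda>t. poly a (Z t) / poly b (Z t)) \<longlongrightarrow> 0) (at 0)"
      using Zinf by (rule filterlim_compose)
    then have "((\<lambda>t. (pc r (Z t) * Z t / ((Z t - 1) * W t))\<^sup>2) \<longlongrightarrow> 0) (at 0)"
    proof (rule Lim_transform_eventually)
      show "\<forall>\<^sub>F t in at 0. poly a (Z t) / poly b (Z t) = (pc r (Z t) * Z t / ((Z t - 1) * W t))\<^sup>2"
        using ev0 by eventually_elim
          (simp add: a_def b_def R0(4) poly_power power_divide power_mult_distrib mult_ac)
    qed
    then show ?thesis
      by (rule tendsto_zero_power2_cancel)
  qed
  have Zinv: "((\<lambda>t. inverse (Z t)) \<longlongrightarrow> 0) (at 0)"
    using Zinf by (rule filterlim_compose[OF tendsto_inverse_0])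
  have "((\<lambda>t. - (t * deriv V t / V t) * (of_real A + of_real B / (1 - inverse (Z t)) + of_real C * (pc r (Z t) * Z t / ((Z t - 1) * W t))))
      \<longlongrightarrow> - of_nat m * (of_real A + of_real B / (1 - 0) + of_real C * 0)) (at 0)"
    by (intro tendsto_intros m Zinv X0) auto
  then have "((\<lambda>t. t * (deriv Z t * dF A B C (Z t) (W t)))
      \<longlongrightarrow> - of_nat m * (of_real A + of_real B / (1 - 0) + of_real C * 0)) (at 0)"
  proof (rule Lim_transform_eventually)
    show "\<forall>\<^sub>F t in at 0. - (t * deriv V t / V t) * (of_real A + of_real B / (1 - inverse (Z t)) + of_real C * (pc r (Z t) * Z t / ((Z t - 1) * W t)))
      = t * (deriv Z t * dF A B C (Z t) (W t))"
      using nz evR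
    proof eventually_elim
      case (elim t)
      have "1 - inverse (Z t) = (Z t - 1) / Z t" using elim by (simp add: field_simps)
      then have "dF A B C (Z t) (W t) = (of_real A + of_real B / (1 - inverse (Z t)) + of_real C * (pc r (Z t) * Z t / ((Z t - 1) * W t))) / Z t"
        using elim unfolding dF_def by (simp add: add_divide_distrib mult_ac)
      moreover have "- (t * deriv V t / V t) = t * (deriv Z t / Z t)"
        using dlog[of t] elim by (metis minus_equation_iff mult_minus_right times_divide_eq_right)
      ultimately show ?case by simp
    qed
  qed
  moreover have "- of_nat m * (of_real A + of_real B / (1 - 0) + of_real C * 0) \<noteq> (0::complex)"
  proof -
    have "A + B = real k / 4 * (\<eta> - 1)" by (simp add: A_def B_def field_simps)
    moreover have "real k / 4 \<noteq> 0" "\<eta> - 1 \<noteq> 0" using \<eta> k by auto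
    ultimately have "A + B \<noteq> 0" by (simp only: mult_eq_0_iff not_False_eq_True simp_thms)
    then have "complex_of_real A + of_real B \<noteq> 0"
      by (metis of_real_add of_real_eq_0_iff)
    with m(1) show ?thesis by simp
  qed
  ultimately have "zorder (dF_coeff k \<alpha> \<beta> q (chi, \<eta>) Z W) 0 = -1"
    using R0 nz unfolding A_def B_def C_def
    by (intro pole_order[OF R0(1)]) auto
  with zo show False by simp
qed


subsection \<open>The curves\<close>

lemma surface_iff: "Affine z w \<in> surface p0 \<longleftrightarrow> w\<^sup>2 = pc p0 z"
  by (auto simp: surface_def)

text \<open>Inside the open square the poles over 0 and 1 are excluded; what remains is a point with
  w equal to one of the two real square roots, whose sign selects \<open>cmap\<close> or its mirror
  image, or a branch point.\<close>

lemma critical_imp_cmap: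
  assumes sq: "(chi, \<eta>) \<in> {-1<..<1} \<times> {-1<..<1}" and z: "z \<in> Ubar"
    and crit: "critical_point k \<alpha> \<beta> q p0 (chi, \<eta>) (Affine (of_real z) w) n" and n: "n \<ge> 2"
  shows "(chi, \<eta>) = cmap z \<or> (chi, \<eta>) = mirror (cmap z)"
proof -
  have w2: "w\<^sup>2 = of_real (poly p0 z)"
    using crit by (auto simp: critical_point_def surface_iff pc_of_real)
  obtain Z W where lp: "local_param p0 (Affine (of_real z) w) Z W"
    and fr: "\<exists>\<^sub>F t in at 0. dF_coeff k \<alpha> \<beta> q (chi, \<eta>) Z W t \<noteq> 0"
    and zo: "zorder (dF_coeff k \<alpha> \<beta> q (chi, \<eta>) Z W) 0 \<ge> 2"
    using crit n by (auto simp: critical_point_def)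
  have not0: "z \<noteq> 0"
    using not_critical_zero[of \<eta> w chi n] crit sq w2 by (auto simp: pc_of_real(1)[of p0 0, simplified])
  have not1: "z \<noteq> 1"
    using not_critical_one[of chi w \<eta> n] crit sq w2 by (auto simp: pc_of_real(1)[of p0 1, simplified])
  from z show ?thesis
  proof (cases rule: Ubar_cases)
    case 1
    have pos: "poly p0 z > 0" using p_pos[OF 1] by (simp add: p_eq)
    have "w\<^sup>2 = (complex_of_real (sqrt (poly p0 z)))\<^sup>2"
      using pos w2 by (simp flip: of_real_power)
    then obtain v where v: "w = of_real v" "v = sqrt (poly p0 z) \<or> v = - sqrt (poly p0 z)"
      unfolding power2_eq_iff by (metis of_real_minus)
    have v2: "v \<noteq> 0" "v\<^sup>2 = poly p0 z" using v(2) pos by auto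
    have "ctangent (real k / 4 * (\<eta> + 1)) (- (real k / 2)) (- (chi / 2)) (of_real z) w"
      using regular_order(1)[OF lp _ _ _ fr] zo not0 not1 v v2 by simp
    then have "tangent (real k / 4 * (\<eta> + 1)) (- (real k / 2)) (- (chi / 2)) z v"
      unfolding v(1) ctangent_of_real[OF v2] .
    then have "chi = real k * poly p1 z * v / poly D1 z \<and> \<eta> = z * poly E z / poly D1 z - 1"
      using tangent_iff[OF 1 v2(1)] v2(2) by (simp add: p_eq)
    then show ?thesis
      using v(2) by (auto simp: cmap_def p_eq)
  next
    case (2 j)
    then have j: "j \<in> {1..2 * d}" using not0 x0 by (cases "j = 0") auto
    have "w = 0" using w2 2 p1_root[OF j] by (simp add: poly_p0)
    then have "- (chi / 2) = 0 \<and> real k / 4 * (\<eta> + 1) * (x j - 1) + - (real k / 2) * x j = 0"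
      using branch_order[OF j _ fr] lp zo 2 by simp
    then have chi: "chi = 0" and "real k * ((\<eta> + 1) * (x j - 1) - 2 * x j) = 0"
      by (auto simp: field_simps)
    then have "(\<eta> + 1) * (x j - 1) - 2 * x j = 0" using k by simp
    then have "\<eta> = (x j + 1) / (x j - 1)" using x_neg[OF j] by (simp add: field_simps)
    then show ?thesis using chi 2 cmap_root(2)[of j] by simp
  qed
qed

lemma cpoly_eventually_nonzero:
  assumes "f \<noteq> 0" "\<forall>\<^sub>F t in at 0. pc f (a + t) = 0"
  shows False
proof -
  obtain e where e: "e > 0" "\<And>t. t \<noteq> 0 \<Longrightarrow> dist t 0 < e \<Longrightarrow> pc f (a + t) = 0"
    using assms(2) unfolding eventually_at by auto
  have "(\<lambda>s. a + of_real s) ` {0<..<e} \<subseteq> {z. pc f z = 0}"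
    using e(2) by (auto simp: dist_norm)
  moreover have "cpoly f \<noteq> 0" using assms(1) by (simp add: map_poly_eq_0_iff)
  then have "finite {z. pc f z = 0}" by (rule poly_roots_finite)
  ultimately have "finite ((\<lambda>s. a + complex_of_real s) ` {0<..<e})" by (rule finite_subset)
  moreover have "inj_on (\<lambda>s. a + complex_of_real s) {0<..<e}" by (auto simp: inj_on_def)
  ultimately have "finite {0<..<e}" by (rule finite_imageD)
  with infinite_Ioo[OF e(1)] show False by blast
qed

lemma Q_hh:
  assumes "w\<^sup>2 = pc p0 z"
  shows "hh A B C z w * (cL A B z * w - of_real C * z * pc r z) = z * pc (Q A B C) z"
proof -
  have "pc (Q A B C) z = (cL A B z)\<^sup>2 * pc p1 z - (of_real C)\<^sup>2 * z * (pc r z)\<^sup>2"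
    unfolding Q_def by (simp add: cpoly_diff cpoly_mult cpoly_smult cpoly_power poly_power cL_def algebra_simps)
  then show ?thesis
    using assms cp0(1)[of z] unfolding hh_def by algebra
qed

text \<open>A local parameter has to be exhibited here. That dF does not vanish identically follows
  from \<open>Q\<close> being a nonzero polynomial.\<close>

lemma tangent_imp_critical:
  assumes z: "z \<in> U" "z \<noteq> 1" and v: "v \<noteq> 0" "v\<^sup>2 = poly p0 z" and chi: "chi \<noteq> 0"
    and t: "tangent (real k / 4 * (\<eta> + 1)) (- (real k / 2)) (- (chi / 2)) z v"
  shows "\<exists>n\<ge>2. critical_point k \<alpha> \<beta> q p0 (chi, \<eta>) (Affine (of_real z) (of_real v)) n \<and> (z > 0 \<longrightarrow> n = 2)"
proof -
  define A where "A = real k / 4 * (\<eta> + 1)"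
  define B where "B = - (real k / 2)"
  define C where "C = - (chi / 2)"
  define a where "a = complex_of_real z"
  define b where "b = complex_of_real v"
  define Z where "Z = (\<lambda>t. a + t)"
  \<comment> \<open>The principal root is taken of a quantity equal to 1 at t = 0, so that
    \<open>W\<close> is holomorphic nearby and starts at \<open>b\<close>, whichever sheet is
    meant.\<close>
  define W where "W = (\<lambda>t. b * csqrt (pc p0 (a + t) / b\<^sup>2))"
  have b: "b \<noteq> 0" "b\<^sup>2 = pc p0 a" using v by (auto simp: a_def b_def pc_of_real simp flip: of_real_power)
  have b1: "pc p0 a / b\<^sup>2 = 1" unfolding b(2)[symmetric] using b(1) by simp
  have a: "a \<noteq> 0" "a \<noteq> 1" using U_nz[OF z(1)] z(2) by (auto simp: a_def)
  have "continuous_on (ball 0 1) (\<lambda>t. pc p0 (a + t) / b\<^sup>2)"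
    using b(1) by (intro continuous_intros) auto
  then obtain R where R: "R > 0" "R \<le> 1" "\<And>t. t \<in> ball 0 R \<Longrightarrow> pc p0 (a + t) / b\<^sup>2 \<in> ball 1 1"
    by (rule ball_in_preimage[of 1 "\<lambda>t. pc p0 (a + t) / b\<^sup>2" "\<lambda>t. t" "ball 1 1" UNIV, rotated])
      (auto simp: b1)
  have slit: "u \<notin> \<real>\<^sub>\<le>\<^sub>0" if "u \<in> ball 1 1" for u :: complex
  proof
    assume "u \<in> \<real>\<^sub>\<le>\<^sub>0"
    then have "Re u \<le> 0" by (simp add: complex_nonpos_Reals_iff)
    moreover have "\<bar>Re (1 - u)\<bar> < 1"
      using that abs_Re_le_cmod[of "1 - u"] by (simp add: dist_norm)
    ultimately show False by simp
  qed
  have hol: "Z holomorphic_on ball 0 R" "W holomorphic_on ball 0 R"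
    unfolding Z_def W_def using b(1) by (intro holomorphic_intros slit R(3); simp)+
  have curve: "(W t)\<^sup>2 = pc p0 (Z t)" for t
    using b(1) by (simp add: W_def Z_def power_mult_distrib)
  have W0: "W 0 = b" by (simp add: W_def b1)
  have lp: "local_param p0 (Affine a b) Z W"
    unfolding local_param_def using R(1) hol curve W0
    by (auto simp: Z_def inj_on_def)
  have dZ: "deriv Z t = 1" for t by (simp add: Z_def)
  have cont: "Z \<midarrow>0\<rightarrow> a" "W \<midarrow>0\<rightarrow> b"
    using hol R(1) W0
    by (metis Z_def add.right_neutral centre_in_ball continuous_on_eq_continuous_at holomorphic_on_imp_continuous_on isContD open_ball)+
  have nz: "\<forall>\<^sub>F t in at 0. Z t \<noteq> 0 \<and> Z t \<noteq> 1 \<and> W t \<noteq> 0 \<and> t \<in> ball 0 R"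
    using tendsto_imp_eventually_ne[OF cont(1) a(1)] tendsto_imp_eventually_ne[OF cont(1) a(2)]
      tendsto_imp_eventually_ne[OF cont(2) b(1)] eventually_at_ball[OF R(1), of 0 UNIV]
    by eventually_elim auto
  have C: "C \<noteq> 0" using chi by (simp add: C_def)
  have Qnz: "Q A B C \<noteq> 0" using Q_pos(3)[OF C, of A B] by auto
  have fr: "\<exists>\<^sub>F t in at 0. dF_coeff k \<alpha> \<beta> q (chi, \<eta>) Z W t \<noteq> 0"
  proof (rule ccontr)
    assume "\<not> ?thesis"
    then have "\<forall>\<^sub>F t in at 0. dF_coeff k \<alpha> \<beta> q (chi, \<eta>) Z W t = 0"
      by (simp add: not_frequently)
    then have "\<forall>\<^sub>F t in at 0. pc (Q A B C) (a + t) = 0"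
      using nz
    proof eventually_elim
      case (elim t)
      have "hh A B C (Z t) (W t) = 0"
        using dF_coeff_eq[OF open_ball _ hol curve, of t chi \<eta>] elim
        by (simp add: dZ dF_hh A_def B_def C_def)
      then show ?case
        using Q_hh[OF curve, of A B C t] elim by (simp add: Z_def)
    qed
    then show False by (rule cpoly_eventually_nonzero[OF Qnz])
  qed
  note order = regular_order[OF lp a b(1) fr, folded A_def B_def C_def]
  have "ctangent A B C a b"
    unfolding a_def b_def ctangent_of_real[OF v] A_def B_def C_def by (rule t)
  then have zo: "zorder (dF_coeff k \<alpha> \<beta> q (chi, \<eta>) Z W) 0 \<ge> 2"
    using order(1) by simp
  define n where "n = nat (zorder (dF_coeff k \<alpha> \<beta> q (chi, \<eta>) Z W) 0)"
  have n: "n \<ge> 2" "zorder (dF_coeff k \<alpha> \<beta> q (chi, \<eta>) Z W) 0 = int n"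
    using zo by (auto simp: n_def)
  have crit: "critical_point k \<alpha> \<beta> q p0 (chi, \<eta>) (Affine a b) n"
    unfolding critical_point_def surface_iff using n lp fr b(2) by auto
  \<comment> \<open>\<open>E_FR\<close> asks for order exactly two. By \<open>Q_hh\<close> a zero of
    order three would make the quotient of \<open>Q\<close> by the square vanish at
    \<open>z\<close>, against the positivity in \<open>tangent_bounds\<close>.\<close>
  have "n = 2" if zpos: "z > 0"
  proof (rule ccontr)
    assume "n \<noteq> 2"
    then obtain m where m: "n = Suc (Suc (Suc m))" using n(1)
      by (metis One_nat_def Suc_1 Suc_le_D le_antisym not_less_eq_eq)
    obtain S where S: "Q A B C = [:-z, 1:]\<^sup>2 * S" "poly S z \<noteq> 0"
      using tangent_bounds(3)[OF t[folded A_def B_def C_def] z(1) C zpos] by blast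
    obtain g where g: "g \<midarrow>0\<rightarrow> g 0"
      "\<forall>\<^sub>F t in at 0. deriv Z t * hh A B C (Z t) (W t) / (Z t * (Z t - 1) * W t) = g t * t ^ n"
      using order(2) unfolding n_def by blast
    define M where "M = (\<lambda>t. (Z t * (Z t - 1) * W t) * (cL A B (Z t) * W t - of_real C * Z t * pc r (Z t)))"
    have pcr: "((\<lambda>t. pc r (Z t)) \<longlongrightarrow> pc r a) (at 0)" and pcS: "((\<lambda>t. pc S (Z t)) \<longlongrightarrow> pc S a) (at 0)"
      by (intro isCont_tendsto_compose[OF _ cont(1)]; simp)+
    define l where "l = (a * (a - 1) * b) * ((of_real A * (a - 1) + of_real B * a) * b - of_real C * a * pc r a)"
    have l: "(M \<longlongrightarrow> l) (at 0)"
      unfolding M_def cL_def l_def by (intro tendsto_intros cont pcr)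
    have "((\<lambda>t. g t * (t * t ^ m) * M t) \<longlongrightarrow> g 0 * (0 * 0 ^ m) * l) (at 0)"
      by (intro tendsto_intros g(1) l)
    moreover have "\<forall>\<^sub>F t in at 0. g t * (t * t ^ m) * M t = Z t * pc S (Z t)"
      using nz g(2) eventually_neq_at_within[of 0 0 UNIV]
    proof eventually_elim
      case (elim t)
      define D where "D = Z t * (Z t - 1) * W t"
      have D: "D \<noteq> 0" using elim by (simp add: D_def)
      have "hh A B C (Z t) (W t) / D = g t * t ^ n" using elim by (simp add: dZ D_def)
      then have h: "hh A B C (Z t) (W t) = g t * t ^ n * D" using D by (simp add: field_simps)
      have "pc (Q A B C) (Z t) = t\<^sup>2 * pc S (Z t)"
        unfolding S(1) by (simp add: cpoly_mult cpoly_power poly_power Z_def a_def)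
      then have "Z t * (t\<^sup>2 * pc S (Z t)) = g t * t ^ n * D * (cL A B (Z t) * W t - of_real C * Z t * pc r (Z t))"
        using Q_hh[OF curve, of A B C t] h by simp
      also have "\<dots> = t\<^sup>2 * (g t * (t * t ^ m) * M t)"
        by (simp add: m M_def D_def power2_eq_square)
      finally have "t\<^sup>2 * (Z t * pc S (Z t)) = t\<^sup>2 * (g t * (t * t ^ m) * M t)"
        by (simp add: mult_ac)
      then show ?case using elim by simp
    qed
    ultimately have "((\<lambda>t. Z t * pc S (Z t)) \<longlongrightarrow> g 0 * (0 * 0 ^ m) * l) (at 0)"
      by (rule Lim_transform_eventually)
    moreover have "((\<lambda>t. Z t * pc S (Z t)) \<longlongrightarrow> a * pc S a) (at 0)"
      by (intro tendsto_intros cont pcS)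
    ultimately have "a * pc S a = g 0 * (0 * 0 ^ m) * l"
      using tendsto_unique[OF trivial_limit_at] by blast
    then show False using a(1) S(2) by (simp add: a_def pc_of_real)
  qed
  with crit n(1) show ?thesis by (auto simp: a_def b_def)
qed

text \<open>Here chi = 0 and the numerator of dF is a multiple of (z - \<xi>) dz. In the coordinate
  w this has order three, because z - \<xi> behaves like w^2; the definition of \<open>E_RS\<close>
  admits every order from two on.\<close>

lemma branch_imp_critical:
  assumes j: "j \<in> {1..2 * d}"
  shows "\<exists>n\<ge>2. critical_point k \<alpha> \<beta> q p0 (cmap (x j)) (Affine (of_real (x j)) 0) n"
proof -
  define \<eta> where "\<eta> = (x j + 1) / (x j - 1)"
  have c: "cmap (x j) = (0, \<eta>)" using cmap_root(2)[of j] j by (simp add: \<eta>_def)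
  define A where "A = real k / 4 * (\<eta> + 1)"
  define B where "B = - (real k / 2)"
  define \<xi> where "\<xi> = complex_of_real (x j)"
  have xj: "x j < 0" by (rule x_neg[OF j])
  have AB: "A * (x j - 1) + B * x j = 0" "A + B \<noteq> 0"
    using xj k by (simp_all add: A_def B_def \<eta>_def field_simps)
  have L: "cL A B z = of_real (A + B) * (z - \<xi>)" for z
  proof -
    have "of_real (A * (x j - 1) + B * x j) = (0 :: complex)" by (simp only: AB(1) of_real_0)
    then have "of_real A * (\<xi> - 1) + of_real B * \<xi> = (0 :: complex)" by (simp add: \<xi>_def)
    then show ?thesis unfolding cL_def of_real_add by algebra
  qed
  have \<xi>: "\<xi> \<noteq> 0" "\<xi> \<noteq> 1" using xj by (auto simp: \<xi>_def)
  have p0\<xi>: "pc p0 \<xi> = 0" "pc' p0 \<xi> \<noteq> 0"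
    using p1_root[OF j] p1_simple[OF j] xj
    by (auto simp: \<xi>_def pc_of_real poly_p0 poly_pderiv_p0)
  have hol: "pc p0 holomorphic_on UNIV" by (intro holomorphic_intros)
  have "deriv (pc p0) \<xi> \<noteq> 0"
    using p0\<xi>(2) DERIV_imp_deriv[OF poly_DERIV] by metis
  then obtain \<delta> where \<delta>: "\<delta> > 0" "open (pc p0 ` ball \<xi> \<delta>)" "inj_on (pc p0) (ball \<xi> \<delta>)"
    by (rule has_complex_derivative_locally_invertible[OF hol UNIV_I open_UNIV])
  obtain g where g: "g holomorphic_on (pc p0 ` ball \<xi> \<delta>)" "\<And>z. z \<in> ball \<xi> \<delta> \<Longrightarrow> g (pc p0 z) = z"
    by (rule holomorphic_has_inverse[OF holomorphic_on_subset[OF hol subset_UNIV] open_ball \<delta>(3)]) (rule that)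
  have "0 \<in> pc p0 ` ball \<xi> \<delta>" using p0\<xi>(1) \<delta>(1) by (metis centre_in_ball imageI)
  then obtain e where e: "e > 0" "ball 0 e \<subseteq> pc p0 ` ball \<xi> \<delta>"
    using \<delta>(2) openE by blast
  define R where "R = min e 1"
  \<comment> \<open>With w = t as parameter, z is recovered from w^2 = p0(z) by the local inverse
    \<open>g\<close> of \<open>p0\<close>.\<close>
  define Z where "Z = (\<lambda>t. g (t\<^sup>2))"
  define W where "W = (\<lambda>t::complex. t)"
  have R: "R > 0" using e by (simp add: R_def)
  have sq: "t\<^sup>2 \<in> pc p0 ` ball \<xi> \<delta>" if "t \<in> ball 0 R" for t
  proof -
    have "norm t * norm t \<le> norm t * 1"
      using that by (intro mult_left_mono) (auto simp: R_def)
    then have "t\<^sup>2 \<in> ball 0 e"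
      using that by (simp add: power2_eq_square norm_mult R_def)
    with e(2) show ?thesis by blast
  qed
  have Zh: "Z holomorphic_on ball 0 R"
    unfolding Z_def
    by (rule holomorphic_on_compose_gen[OF _ g(1), of "\<lambda>t. t\<^sup>2", unfolded o_def])
      (use sq in \<open>auto intro: holomorphic_intros\<close>)
  have Wh: "W holomorphic_on ball 0 R" unfolding W_def by (intro holomorphic_intros)
  have curve: "(W t)\<^sup>2 = pc p0 (Z t)" if "t \<in> ball 0 R" for t
    using sq[OF that] g(2) by (auto simp: W_def Z_def)
  have Z0: "Z 0 = \<xi>"
    using g(2)[of \<xi>] \<delta>(1) p0\<xi>(1) by (simp add: Z_def)
  have lp: "local_param p0 (Affine \<xi> 0) Z W"
    unfolding local_param_def using R Zh Wh curve Z0 by (auto simp: W_def inj_on_def)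
  have cont: "Z \<midarrow>0\<rightarrow> \<xi>"
    using Zh R Z0 by (metis centre_in_ball continuous_on_eq_continuous_at holomorphic_on_imp_continuous_on isContD open_ball)
  have ev: "\<forall>\<^sub>F t in at 0. Z t \<noteq> 0 \<and> Z t \<noteq> 1 \<and> t \<noteq> 0 \<and> t \<in> ball 0 R"
    using tendsto_imp_eventually_ne[OF cont \<xi>(1)] tendsto_imp_eventually_ne[OF cont \<xi>(2)]
      eventually_at_ball'[OF R, of 0 UNIV]
    by eventually_elim auto
  have "\<forall>\<^sub>F t in at 0. dF_coeff k \<alpha> \<beta> q (0, \<eta>) Z W t \<noteq> 0"
    using ev
  proof eventually_elim
    case (elim t)
    have "Z t \<noteq> \<xi>"
      using curve[of t] p0\<xi>(1) elim by (auto simp: W_def)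
    then have "hh A B 0 (Z t) (W t) \<noteq> 0"
      using AB(2) elim by (simp add: hh_def L W_def flip: of_real_add)
    moreover have "deriv Z t \<noteq> 0"
      using curve_deriv[OF open_ball _ Zh Wh curve, of t] elim by (auto simp: W_def)
    ultimately show ?case
      using dF_coeff_eq[OF open_ball _ Zh Wh curve, of t 0 \<eta>] elim
      by (simp add: dF_hh A_def B_def W_def)
  qed
  then have fr: "\<exists>\<^sub>F t in at 0. dF_coeff k \<alpha> \<beta> q (0, \<eta>) Z W t \<noteq> 0"
    by (rule eventually_frequently[rotated]) simp
  have "zorder (dF_coeff k \<alpha> \<beta> q (0, \<eta>) Z W) 0 \<ge> 2"
    using branch_order[OF j lp[unfolded \<xi>_def] fr] AB(1) by (simp add: A_def B_def)
  then have "nat (zorder (dF_coeff k \<alpha> \<beta> q (0, \<eta>) Z W) 0) \<ge> 2"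
    "zorder (dF_coeff k \<alpha> \<beta> q (0, \<eta>) Z W) 0 = int (nat (zorder (dF_coeff k \<alpha> \<beta> q (0, \<eta>) Z W) 0))"
    by auto
  then show ?thesis
    unfolding c critical_point_def surface_iff \<xi>_def[symmetric]
    using lp fr p0\<xi>(1) by (intro exI[of _ "nat (zorder (dF_coeff k \<alpha> \<beta> q (0, \<eta>) Z W) 0)"]) auto
qed

lemma cmap_imp_critical:
  assumes z: "z \<in> U" "z \<noteq> 1" and c: "c = cmap z \<or> c = mirror (cmap z)"
  shows "\<exists>w. w\<^sup>2 = pc p0 (of_real z) \<and>
    (\<exists>n\<ge>2. critical_point k \<alpha> \<beta> q p0 c (Affine (of_real z) w) n \<and> (z > 0 \<longrightarrow> n = 2))"
proof -
  have pos: "poly p0 z > 0" using p_pos[OF z(1)] by (simp add: p_eq)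
  obtain chi \<eta> where cm: "cmap z = (chi, \<eta>)" by (cases "cmap z")
  have v: "sqrt (poly p0 z) \<noteq> 0" "(sqrt (poly p0 z))\<^sup>2 = poly p0 z"
    "- sqrt (poly p0 z) \<noteq> 0" "(- sqrt (poly p0 z))\<^sup>2 = poly p0 z"
    using pos by auto
  note ct = cmap_tangent[OF z(1), unfolded cm p_eq fst_conv snd_conv]
  have "- chi \<noteq> 0" using ct(1) by simp
  note crit = tangent_imp_critical[OF z v(1,2) ct(1,2)] tangent_imp_critical[OF z v(3,4) this ct(3)]
  have w: "(complex_of_real (sqrt (poly p0 z)))\<^sup>2 = pc p0 (of_real z)"
    "(complex_of_real (- sqrt (poly p0 z)))\<^sup>2 = pc p0 (of_real z)"
    unfolding of_real_power[symmetric] v pc_of_real by (rule refl)+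
  show ?thesis
    using c unfolding cm mirror_simps
  proof
    assume "c = (chi, \<eta>)"
    then show ?thesis using crit(1) w(1) by blast
  next
    assume "c = (- chi, \<eta>)"
    then show ?thesis using crit(2) w(2) by blast
  qed
qed


text \<open>The interior of the interval is covered once by each sheet; its ends are branch points,
  whose images are fixed by \<open>mirror\<close>.\<close>

lemma E_RS_eq:
  assumes l: "l \<in> {1..d}"
  shows "E_RS k \<alpha> \<beta> q p0 x l =
    cmap ` {x (2 * l)..x (2 * l - 1)} \<union> mirror ` cmap ` {x (2 * l)..x (2 * l - 1)}"
proof -
  note sub = oval_subset[OF l]
  have cl: "closure {x (2 * l)<..<x (2 * l - 1)} = {x (2 * l)..x (2 * l - 1)}"
    using sub(3) by (rule closure_greaterThanLessThan)
  have j: "2 * l \<in> {1..2 * d}" "2 * l - 1 \<in> {1..2 * d}" using l by auto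
  show ?thesis
  proof (intro set_eqI iffI)
    fix c assume "c \<in> E_RS k \<alpha> \<beta> q p0 x l"
    then obtain z w n where c: "c \<in> {-1<..<1} \<times> {-1<..<1}" "z \<in> {x (2 * l)..x (2 * l - 1)}"
      "n \<ge> 2" "critical_point k \<alpha> \<beta> q p0 c (Affine (of_real z) w) n"
      unfolding E_RS_def oval_def cl by blast
    obtain chi \<eta> where ce: "c = (chi, \<eta>)" by (cases c)
    have "c = cmap z \<or> c = mirror (cmap z)"
      unfolding ce using c sub(1) unfolding ce by (intro critical_imp_cmap) auto
    with c(2) show "c \<in> cmap ` {x (2 * l)..x (2 * l - 1)} \<union> mirror ` cmap ` {x (2 * l)..x (2 * l - 1)}"
      by blast
  next
    fix c assume "c \<in> cmap ` {x (2 * l)..x (2 * l - 1)} \<union> mirror ` cmap ` {x (2 * l)..x (2 * l - 1)}"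
    then obtain z where z: "z \<in> {x (2 * l)..x (2 * l - 1)}" and c: "c = cmap z \<or> c = mirror (cmap z)"
      by blast
    have mem: "c \<in> E_RS k \<alpha> \<beta> q p0 x l"
      if "c \<in> {-1<..<1} \<times> {-1<..<1}" "critical_point k \<alpha> \<beta> q p0 c (Affine (of_real z) w) n" "n \<ge> 2" for w n
      using that z unfolding E_RS_def oval_def cl critical_point_def by blast
    have sq: "mirror c' \<in> {-1<..<1} \<times> {-1<..<1}" if "c' \<in> {-1<..<1} \<times> {-1<..<1}" for c'
      using that by (cases c') auto
    show "c \<in> E_RS k \<alpha> \<beta> q p0 x l"
    proof (cases "z \<in> {x (2 * l)<..<x (2 * l - 1)}")
      case True
      then have U: "z \<in> U" using sub(2) by blast
      have "x (2 * l - 1) < 0" by (rule x_neg[OF j(2)])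
      with True have "z \<noteq> 1" by auto
      obtain w n where crit: "n \<ge> 2" "critical_point k \<alpha> \<beta> q p0 c (Affine (of_real z) w) n"
        using cmap_imp_critical[OF U \<open>z \<noteq> 1\<close> c] by blast
      have "c \<in> {-1<..<1} \<times> {-1<..<1}"
        using c
      proof
        assume "c = cmap z"
        then show ?thesis using cmap_tangent(4)[OF U \<open>z \<noteq> 1\<close>] by simp
      next
        assume "c = mirror (cmap z)"
        then show ?thesis using sq[OF cmap_tangent(4)[OF U \<open>z \<noteq> 1\<close>]] by simp
      qed
      then show ?thesis using crit(2,1) by (rule mem)
    next
      case False
      with z have "z = x (2 * l) \<or> z = x (2 * l - 1)" by auto
      then obtain i where i: "i \<in> {1..2 * d}" "z = x i" using j by blast
      then have fst0: "cmap z = (0, (x i + 1) / (x i - 1))" using cmap_root(2)[of i] by simp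
      with c have "c = cmap (x i)" using i by auto
      obtain n where crit: "n \<ge> 2" "critical_point k \<alpha> \<beta> q p0 c (Affine (of_real z) 0) n"
        using branch_imp_critical[OF i(1)] unfolding \<open>c = cmap (x i)\<close> i(2) by blast
      have "c \<in> {-1<..<1} \<times> {-1<..<1}"
        unfolding \<open>c = cmap (x i)\<close> by (rule cmap_root_in_square[OF i(1)])
      then show ?thesis using crit(2,1) by (rule mem)
    qed
  qed
qed

text \<open>The added points are \<open>cmap 0\<close>, the limit at infinity, and
  \<open>cmap 1\<close> with its mirror image. The sign of the abscissa of \<open>cmap 1\<close> may
  stay undecided because both points belong to the set.\<close>

lemma E_FR_ext_eq:
  "E_FR_ext k \<alpha> \<beta> q p0 = insert (0, 1) (cmap ` {0..}) \<union> mirror ` insert (0, 1) (cmap ` {0..})"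
    (is "_ = ?S")
proof -
  define \<tau> where "\<tau> = tangency_ordinate k \<alpha> \<beta>"
  have c1: "cmap 1 = (1, \<tau>) \<or> cmap 1 = (-1, \<tau>)"
    using cmap_one tangency by (cases "cmap 1") (auto simp: \<tau>_def abs_if split: if_splits)
  have one: "(1, \<tau>) \<in> ?S" "(-1, \<tau>) \<in> ?S"
  proof -
    have m: "cmap 1 \<in> ?S" "mirror (cmap 1) \<in> ?S" by auto
    with c1 show "(1, \<tau>) \<in> ?S" "(-1, \<tau>) \<in> ?S" by (metis mirror_simps(1) minus_minus)+
  qed
  show ?thesis
  proof (intro set_eqI iffI)
    fix c assume c: "c \<in> E_FR_ext k \<alpha> \<beta> q p0"
    then consider "c \<in> E_FR k \<alpha> \<beta> q p0" | "c = (0, 1)" | "c = (0, -1)" | "c = (1, \<tau>)" | "c = (-1, \<tau>)"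
      by (auto simp: E_FR_ext_def \<tau>_def)
    then show "c \<in> ?S"
    proof cases
      case 1
      then obtain Pt where sq: "c \<in> {-1<..<1} \<times> {-1<..<1}" and Pt: "Pt \<in> oval0 p0"
        and crit: "critical_point k \<alpha> \<beta> q p0 c Pt 2"
        unfolding E_FR_def by blast
      obtain chi \<eta> where ce: "c = (chi, \<eta>)" by (cases c)
      have "\<bar>\<eta>\<bar> < 1" using sq ce by (simp add: abs_less_iff)
      then have "Pt \<noteq> Infty"
        using not_critical_Infty[of \<eta> chi 2] crit ce by auto
      then obtain z w where z: "z \<ge> 0" "Pt = Affine (of_real z) w"
        using Pt by (auto simp: oval0_def)
      then have "z \<in> Ubar" unfolding Ubar_def by auto
      then have "c = cmap z \<or> c = mirror (cmap z)"
        using critical_imp_cmap[of chi \<eta> z w 2] sq crit z(2) unfolding ce by simp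
      with z(1) show ?thesis by auto
    next
      case 3
      have "cmap 0 \<in> ?S" by auto
      with 3 show ?thesis by (simp only: cmap_zero)
    qed (use one in auto)
  next
    fix c assume "c \<in> ?S"
    then consider "c = (0, 1)" | z where "z \<ge> 0" "c = cmap z \<or> c = mirror (cmap z)"
      by auto
    then show "c \<in> E_FR_ext k \<alpha> \<beta> q p0"
    proof cases
      case 1
      then show ?thesis by (simp add: E_FR_ext_def)
    next
      case 2
      consider "z = 0" | "z = 1" | "z > 0" "z \<noteq> 1" using 2(1) by linarith
      then show ?thesis
      proof cases
        case 1
        then show ?thesis using 2(2) by (auto simp: cmap_zero E_FR_ext_def)
      next
        case z1: 2
        then show ?thesis using 2(2) c1 by (auto simp: E_FR_ext_def \<tau>_def)
      next
        case 3
        then have U: "z \<in> U" unfolding U_def by simp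
        obtain w where w: "w\<^sup>2 = pc p0 (of_real z)"
          and crit: "critical_point k \<alpha> \<beta> q p0 c (Affine (of_real z) w) 2"
          using cmap_imp_critical[OF U 3(2) 2(2)] 3(1) by blast
        have "Affine (of_real z) w \<in> oval0 p0"
          using w 2(1) by (auto simp: oval0_def surface_iff)
        moreover have "c \<in> {-1<..<1} \<times> {-1<..<1}"
          using cmap_tangent(4)[OF U 3(2)] 2(2) by (cases "cmap z") auto
        ultimately show ?thesis
          using crit unfolding E_FR_ext_def E_FR_def by blast
      qed
    qed
  qed
qed

lemma E_RS_mem:
  assumes "l \<in> {1..d}" "c \<in> E_RS k \<alpha> \<beta> q p0 x l"
  obtains z where "z \<in> {x (2 * l)..x (2 * l - 1)}" "z \<in> Ubar" "c = cmap z \<or> c = mirror (cmap z)"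
  using assms(2) oval_subset(1)[OF assms(1)] unfolding E_RS_eq[OF assms(1)] by blast

lemma cmap_inj':
  assumes "z \<in> Ubar" "z' \<in> Ubar" "c = cmap z \<or> c = mirror (cmap z)" "c = cmap z' \<or> c = mirror (cmap z')"
  shows "z = z'"
  by (intro cmap_inj assms(1,2)) (metis assms(3,4) mirror_simps(2))

text \<open>By injectivity a common point would come from a single z that is both nonnegative and in
  a negative interval. The point (0, 1), which is not a value of \<open>cmap\<close> on the half
  line, lies outside the open square.\<close>

lemma outer_inner_disjoint:
  assumes l: "l \<in> {1..d}"
  shows "E_FR_ext k \<alpha> \<beta> q p0 \<inter> E_RS k \<alpha> \<beta> q p0 x l = {}"
proof (rule ccontr)
  assume "E_FR_ext k \<alpha> \<beta> q p0 \<inter> E_RS k \<alpha> \<beta> q p0 x l \<noteq> {}"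
  then obtain c where c: "c \<in> E_FR_ext k \<alpha> \<beta> q p0" "c \<in> E_RS k \<alpha> \<beta> q p0 x l" by blast
  from c(2) have "c \<in> {-1<..<1} \<times> {-1<..<1}" by (simp add: E_RS_def)
  then have "c \<noteq> (0, 1)" by auto
  then obtain z where z: "z \<ge> 0" "c = cmap z \<or> c = mirror (cmap z)"
    using c(1) unfolding E_FR_ext_eq by auto
  obtain z' where z': "z' \<in> {x (2 * l)..x (2 * l - 1)}" "z' \<in> Ubar" "c = cmap z' \<or> c = mirror (cmap z')"
    using E_RS_mem[OF l c(2)] .
  have "z \<in> Ubar" using z(1) unfolding Ubar_def by auto
  then have "z = z'" using z'(2) z(2) z'(3) by (rule cmap_inj')
  moreover have "2 * l - 1 \<in> {1..2 * d}" using l by auto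
  then have "x (2 * l - 1) < 0" by (rule x_neg)
  ultimately show False using z(1) z'(1) by simp
qed

lemma inner_disjoint:
  assumes l: "l \<in> {1..d}" and m: "m \<in> {1..d}" and less: "l < m"
  shows "E_RS k \<alpha> \<beta> q p0 x l \<inter> E_RS k \<alpha> \<beta> q p0 x m = {}"
proof (rule ccontr)
  assume "E_RS k \<alpha> \<beta> q p0 x l \<inter> E_RS k \<alpha> \<beta> q p0 x m \<noteq> {}"
  then obtain c where c: "c \<in> E_RS k \<alpha> \<beta> q p0 x l" "c \<in> E_RS k \<alpha> \<beta> q p0 x m" by blast
  obtain z where z: "z \<in> {x (2 * l)..x (2 * l - 1)}" "z \<in> Ubar" "c = cmap z \<or> c = mirror (cmap z)"
    using E_RS_mem[OF l c(1)] .
  obtain z' where z': "z' \<in> {x (2 * m)..x (2 * m - 1)}" "z' \<in> Ubar" "c = cmap z' \<or> c = mirror (cmap z')"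
    using E_RS_mem[OF m c(2)] .
  have "z = z'" using cmap_inj'[OF z(2) z'(2) z(3) z'(3)] .
  moreover have "2 * l < 2 * m - 1" "2 * m - 1 \<le> 2 * d" using l m less by auto
  then have "x (2 * m - 1) < x (2 * l)" by (rule x_anti)
  ultimately show False using z(1) z'(1) by simp
qed

lemma E_RS_curve:
  assumes l: "l \<in> {1..d}"
  shows "simple_closed_curve (E_RS k \<alpha> \<beta> q p0 x l)" "symmetric_chi (E_RS k \<alpha> \<beta> q p0 x l)"
    "(0, (x (2 * l) + 1) / (x (2 * l) - 1)) \<in> E_RS k \<alpha> \<beta> q p0 x l"
    "(0, (x (2 * l - 1) + 1) / (x (2 * l - 1) - 1)) \<in> E_RS k \<alpha> \<beta> q p0 x l"
proof -
  show "simple_closed_curve (E_RS k \<alpha> \<beta> q p0 x l)" "symmetric_chi (E_RS k \<alpha> \<beta> q p0 x l)"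
    unfolding E_RS_eq[OF l] by (rule oval_simple_closed_curve[OF l] symmetric_chi_mirror_union)+
  have j: "2 * l \<le> 2 * d" "2 * l - 1 \<le> 2 * d" using l by auto
  have "x (2 * l) \<in> {x (2 * l)..x (2 * l - 1)}" "x (2 * l - 1) \<in> {x (2 * l)..x (2 * l - 1)}"
    using oval_subset(3)[OF l] by auto
  then have "cmap (x (2 * l)) \<in> E_RS k \<alpha> \<beta> q p0 x l" "cmap (x (2 * l - 1)) \<in> E_RS k \<alpha> \<beta> q p0 x l"
    unfolding E_RS_eq[OF l] by blast+
  then show "(0, (x (2 * l) + 1) / (x (2 * l) - 1)) \<in> E_RS k \<alpha> \<beta> q p0 x l"
    "(0, (x (2 * l - 1) + 1) / (x (2 * l - 1) - 1)) \<in> E_RS k \<alpha> \<beta> q p0 x l"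
    unfolding cmap_root(2)[OF j(1)] cmap_root(2)[OF j(2)] .
qed

end

theorem proposition2p5:
  fixes k k' :: nat and \<alpha> \<beta> x :: "nat \<Rightarrow> real" and q p0 :: "real poly"
  assumes "k \<ge> 1"
    and "\<And>m. m \<in> {1..k} \<Longrightarrow> \<alpha> m > 0"
    and "\<And>m. m \<in> {1..k} \<Longrightarrow> \<beta> m > 0"
    and "(\<Prod>m=1..k. \<alpha> m) = (\<Prod>m=1..k. \<beta> m)"
    and "p_poly k \<alpha> \<beta> = q\<^sup>2 * p0"
    and "rsquarefree (cpoly q)" and "rsquarefree (cpoly p0)" and "lead_coeff q = 1"
    and "k' \<ge> 1" and "degree p0 = 2 * k' - 1"
    and "x 0 = 0" and "strict_antimono_on {..2 * (k' - 1)} x"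
    and "{t. poly p0 t = 0} = x ` {..2 * (k' - 1)}"
  shows
    "(\<forall>l\<in>{1..k' - 1}.
        simple_closed_curve (E_RS k \<alpha> \<beta> q p0 x l) \<and>
        (0, (x (2 * l) + 1) / (x (2 * l) - 1)) \<in> E_RS k \<alpha> \<beta> q p0 x l \<and>
        (0, (x (2 * l - 1) + 1) / (x (2 * l - 1) - 1)) \<in> E_RS k \<alpha> \<beta> q p0 x l) \<and>
     simple_closed_curve (E_FR_ext k \<alpha> \<beta> q p0) \<and>
     (\<forall>l\<in>{1..k' - 1}. E_FR_ext k \<alpha> \<beta> q p0 \<inter> E_RS k \<alpha> \<beta> q p0 x l = {}) \<and>
     (\<forall>l\<in>{1..k' - 1}. \<forall>m\<in>{1..k' - 1}. l \<noteq> m \<longrightarrow>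
        E_RS k \<alpha> \<beta> q p0 x l \<inter> E_RS k \<alpha> \<beta> q p0 x m = {}) \<and>
     symmetric_chi (E_FR_ext k \<alpha> \<beta> q p0) \<and>
     (\<forall>l\<in>{1..k' - 1}. symmetric_chi (E_RS k \<alpha> \<beta> q p0 x l))"
proof -
  obtain T :: "real poly" where T: "degree T = k" "coeff T k = 2" "coeff T (k - 1) \<ge> 0" "poly T 1 > 0"
    and trace: "\<And>z. z \<noteq> 0 \<Longrightarrow> z \<noteq> 1 \<Longrightarrow> trace (Phi k \<alpha> \<beta> z) = poly (cpoly T) z / (z - 1) ^ k"
    using trace_poly[of k \<alpha> \<beta>] assms(1-3) by blast
  interpret spectral_curve k k' \<alpha> \<beta> x q p0 T
    by unfold_locales (use assms T trace in auto)
  have "E_RS k \<alpha> \<beta> q p0 x l \<inter> E_RS k \<alpha> \<beta> q p0 x m = {}"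
    if "l \<in> {1..k' - 1}" "m \<in> {1..k' - 1}" "l \<noteq> m" for l m
    using inner_disjoint[OF that(1,2)] inner_disjoint[OF that(2,1)] that(3)
    by (metis Int_commute linorder_neqE_nat)
  moreover have "simple_closed_curve (E_FR_ext k \<alpha> \<beta> q p0)" "symmetric_chi (E_FR_ext k \<alpha> \<beta> q p0)"
    unfolding E_FR_ext_eq by (rule outer_simple_closed_curve symmetric_chi_mirror_union)+
  ultimately show ?thesis
    using E_RS_curve outer_inner_disjoint by blast
qed

end
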